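(* Let $\frac13<s_-<s_+<1$, $\Lambda>0$ and $\alpha>0$. There exists a constant $c=c(s_-,s_+,\Lambda,\alpha)>0$ such that the following holds for any $s\in[s_-,s_+]$; set $p=\frac1s$. For any $\varepsilon>0$ and $t\in(0,s]$ there exists $\delta>0$ such that: let $u\in W^{\frac{3-p}2,2}\cap W^{s,\frac1s}\cap C^\alpha(\mathbb S^1,\mathbb S^1)$ satisfy $$[u]_{W^{s,1/s}(\mathbb S^1)}+[u]_{C^\alpha(\mathbb S^1)}\le\Lambda,$$ and, if $p<2$, assume in addition that $$[u]_{\mathrm{Lip}}\le\frac{\Lambda}{|p-2|}.$$ If $[u-\mathrm{id}]_{W^{t,1/t}(\mathbb S^1)}\le\delta$, then there exists $\phi=e^{\mathrm i\lambda}m_b\in\mathcal M$ with $|b|\le\varepsilon$, $\lambda\in\mathbb R$, and $$E_s(u\circ\phi)-E_s(\mathrm{id})\ge c\,\inf_{\psi\in\mathcal M}\,[u\circ\psi-\mathrm{id}]^2_{H^{\frac{3-p}2}(\mathbb S^1)} .$$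
   Context: $\mathbb S^1\subset\mathbb C\simeq\mathbb R^2$ is the unit circle, $|x-y|$ is the Euclidean distance in $\mathbb C$, and $dx,dy$ denote arclength measure on $\mathbb S^1$. For $s\in(0,1)$ and $u:\mathbb S^1\to\mathbb S^1\subset\mathbb R^2$, $$E_s(u)=\iint_{\mathbb S^1\times\mathbb S^1}\frac{|u(x)-u(y)|^{1/s}}{|x-y|^2}\,dx\,dy .$$ For $0<s<1$, $1\le q<\infty$, $[f]_{W^{s,q}(\mathbb S^1)}^q=\iint_{\mathbb S^1\times\mathbb S^1}\frac{|f(x)-f(y)|^q}{|x-y|^{1+sq}}\,dx\,dy$, and $[f]_{H^s}=[f]_{W^{s,2}}$. $[f]_{C^\alpha}=\sup_{x\ne y}|f(x)-f(y)|/|x-y|^\alpha$ and $[f]_{\mathrm{Lip}}=\sup_{x\ne y}|f(x)-f(y)|/|x-y|$. The set $\mathcal M$ of Möbius transforms consists of the maps $e^{\mathrm i\lambda}m_b:\mathbb S^1\to\mathbb S^1$ with $\lambda\in\mathbb R$, $b\in\mathbb C$, $|b|<1$, where $m_b(z)=\frac{z+b}{1+\overline b z}$. *)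

theory Defs
  imports "HOL-Analysis.Analysis"
begin

text \<open>
  Maps on the unit circle are represented by total functions of type
  \<^typ>\<open>complex \<Rightarrow> complex\<close>; only their values on \<^term>\<open>sphere (0::complex) 1\<close> matter.
  The underlying measurable space of the arclength measure is the circle itself (not all of the
  plane), so that measurability too only concerns the values on the circle.
\<close>

definition arclength :: "complex measure" where
  "arclength = distr (restrict_space lborel {0..<2 * pi}) (restrict_space borel (sphere 0 1)) cis"

text \<open>
  Energies and seminorms take values in \<^typ>\<open>ennreal\<close>, so that a divergent integral has the value
  infinity. On the diagonal, a null set, the integrands below are \<open>0 / 0 = 0\<close>.
\<close>

definition energy :: "real \<Rightarrow> (complex \<Rightarrow> complex) \<Rightarrow> ennreal" where
  "energy s u = (\<integral>\<^sup>+ (x, y). ennreal (dist (u x) (u y) powr (1 / s) / (dist x y)\<^sup>2)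
                   \<partial>(arclength \<Otimes>\<^sub>M arclength))"

definition ennreal_powr :: "ennreal \<Rightarrow> real \<Rightarrow> ennreal" where
  "ennreal_powr x a = (if x = \<infinity> then \<infinity> else ennreal (enn2real x powr a))"
    \<comment> \<open>the real power, extended to infinity for exponents \<open>a > 0\<close>\<close>

definition sobolev_seminorm :: "real \<Rightarrow> real \<Rightarrow> (complex \<Rightarrow> complex) \<Rightarrow> ennreal" where
  "sobolev_seminorm s q f =
     ennreal_powr
       (\<integral>\<^sup>+ (x, y). ennreal (dist (f x) (f y) powr q / dist x y powr (1 + s * q))
          \<partial>(arclength \<Otimes>\<^sub>M arclength))
       (1 / q)"

definition sobolev_space :: "real \<Rightarrow> real \<Rightarrow> (complex \<Rightarrow> complex) set" where
  "sobolev_space s q =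
     {f \<in> borel_measurable arclength.
        (\<integral>\<^sup>+ x. ennreal (norm (f x) powr q) \<partial>arclength) < \<infinity> \<and> sobolev_seminorm s q f < \<infinity>}"

definition hoelder_seminorm :: "real \<Rightarrow> (complex \<Rightarrow> complex) \<Rightarrow> ennreal" where
  "hoelder_seminorm \<alpha> f =
     (SUP (x, y) \<in> {(x, y). x \<in> sphere 0 1 \<and> y \<in> sphere 0 1 \<and> x \<noteq> y}.
        ennreal (dist (f x) (f y) / dist x y powr \<alpha>))"

definition hoelder_space :: "real \<Rightarrow> (complex \<Rightarrow> complex) set" where
  "hoelder_space \<alpha> = {f. continuous_on (sphere 0 1) f \<and> hoelder_seminorm \<alpha> f < \<infinity>}"

definition lip_seminorm :: "(complex \<Rightarrow> complex) \<Rightarrow> ennreal" where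
  "lip_seminorm f =
     (SUP (x, y) \<in> {(x, y). x \<in> sphere 0 1 \<and> y \<in> sphere 0 1 \<and> x \<noteq> y}.
        ennreal (dist (f x) (f y) / dist x y))"

definition moebius_map :: "complex \<Rightarrow> complex \<Rightarrow> complex" where
  "moebius_map b z = (z + b) / (1 + cnj b * z)"

definition moebius_group :: "(complex \<Rightarrow> complex) set" where
  "moebius_group = {\<lambda>z. exp (\<i> * of_real l) * moebius_map b z | (l::real) b. norm b < 1}"

end

theory Submission
  imports Defs
begin

text \<open>
  Put \<open>p = 1 / s\<close>, so \<open>1 < p < 3\<close>. A map that is uniformly close to the identity has the form
  \<open>u x = x * cis (f x)\<close> with a small real function \<open>f\<close>. Write \<open>x = \<omega> * y\<close> with \<open>\<omega> = cis h\<close>,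
  \<open>S = norm (\<omega> - 1)\<close> and \<open>g = f (\<omega> * y) - f y\<close>; then the energy of \<open>u\<close> is the integral over \<open>\<omega>\<close> and
  \<open>y\<close> of \<open>\<bar>2 * sin ((h + g) / 2)\<bar> powr p / S\<^sup>2\<close>. In the expansion at \<open>g = 0\<close> the linear term
  integrates to zero over \<open>y\<close> for every single \<open>\<omega>\<close>, because rotations preserve arclength. The
  quadratic term is a rotation-invariant quadratic form in \<open>f\<close> with kernel
  \<open>p * (p - 1) / 2 * S powr (p - 4) - p\<^sup>2 / 8 * S powr (p - 2)\<close>. By Parseval it is diagonal in the
  Fourier modes of \<open>f\<close>. Its multiplier vanishes at the modes \<open>0\<close> and \<open>\<plusminus>1\<close>, the infinitesimal Moebius
  transforms, and on all other modes it dominates the multiplier of the squared \<open>H\<close>-seminorm of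
  order \<open>(3 - p) / 2\<close> (\<open>chord_moment_coercive\<close>).

  Two things stand between this computation and the theorem. First, near the diagonal \<open>g\<close> need not
  be small compared with \<open>h\<close>, and the expansion is not available. It is replaced by a convexity
  inequality (\<open>abs_powr_lower_superquadratic\<close>, \<open>abs_powr_lower_subquadratic\<close>) that has the right
  form with a smaller constant. For \<open>p < 2\<close> this needs the new chord to be at most \<open>L\<close> times the
  old one, and costs a factor \<open>L powr (p - 2)\<close>; for \<open>L\<close> of size \<open>\<Lambda> / (2 - p)\<close> this factor stays away from zero up
  to \<open>p = 2\<close> (\<open>lipschitz_exponent_bound\<close>), which is what makes the final constant uniform in \<open>s\<close>.
  The smaller constant does no harm if it is used on a small neighbourhood of the diagonal only:
  low modes hardly see that neighbourhood, and on high modes the part \<open>S powr (p - 4)\<close> of the kernel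
  wins with any positive constant (\<open>truncated_multiplier_coercive\<close>).

  Secondly, \<open>f\<close> must have no modes \<open>0\<close> and \<open>\<plusminus>1\<close>. Brouwer's fixed point theorem provides a Moebius
  transform near the identity such that \<open>u\<close> composed with it has this property
  (\<open>moebius_balancing\<close>). This transform serves both as the \<open>\<phi>\<close> of the conclusion and as a
  competitor in the infimum. That a small Sobolev seminorm of \<open>u - id\<close> makes \<open>u\<close> uniformly close to
  the identity follows from the Hoelder bound (\<open>sobolev_close_imp_uniformly_close\<close>).
\<close>

section \<open>The arclength measure\<close>

lemma space_arclength [simp]: "space arclength = sphere 0 1"
  by (simp add: arclength_def space_restrict_space)

lemma sets_arclength [measurable_cong]:
  "sets arclength = sets (restrict_space borel (sphere (0::complex) 1))"
  by (simp add: arclength_def)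

lemma cis_measurable_circle:
  "cis \<in> restrict_space lborel {0..<2 * pi} \<rightarrow>\<^sub>M restrict_space borel (sphere 0 1)"
proof (rule measurable_restrict_space2)
  have "cis \<in> borel_measurable borel"
    by (intro borel_measurable_continuous_onI continuous_intros)
  then show "cis \<in> restrict_space lborel {0..<2 * pi} \<rightarrow>\<^sub>M borel"
    by (intro measurable_restrict_space1) simp
qed auto

lemma borel_measurable_arclengthI:
  "f \<in> borel_measurable borel \<Longrightarrow> f \<in> borel_measurable arclength"
  using measurable_restrict_space1[of f borel borel "sphere 0 1"]
    measurable_cong_sets[OF sets_arclength refl] by blast

lemma continuous_borel_measurable_arclength:
  fixes f :: "complex \<Rightarrow> 'a::topological_space"
  shows "continuous_on (sphere 0 1) f \<Longrightarrow> f \<in> borel_measurable arclength"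
  using borel_measurable_continuous_on_restrict[of "sphere 0 1" f]
    measurable_cong_sets[OF sets_arclength refl] by blast

lemma ident_measurable_arclength [measurable]: "(\<lambda>x. x) \<in> borel_measurable arclength"
  by (rule borel_measurable_arclengthI) simp

lemma nn_integral_arclength:
  assumes "f \<in> borel_measurable arclength"
  shows "(\<integral>\<^sup>+x. f x \<partial>arclength) = (\<integral>\<^sup>+\<theta>. f (cis \<theta>) * indicator {0..<2 * pi} \<theta> \<partial>lborel)"
proof -
  have f: "f \<in> borel_measurable (restrict_space borel (sphere 0 1))"
    using assms measurable_cong_sets[OF sets_arclength refl] by blast
  show ?thesis
    unfolding arclength_def using f
    by (subst nn_integral_distr[OF cis_measurable_circle])
       (auto simp: nn_integral_restrict_space)
qed

lemma cis_shift_measurable: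
  assumes "f \<in> borel_measurable arclength"
  shows "(\<lambda>\<theta>::real. f (cis (\<theta> + h)) :: 'b::topological_space) \<in> borel_measurable borel"
proof -
  have "(\<lambda>\<theta>::real. cis (\<theta> + h)) \<in> borel \<rightarrow>\<^sub>M restrict_space borel (sphere (0::complex) 1)"
    by (intro measurable_restrict_space2 borel_measurable_continuous_onI continuous_intros) auto
  moreover have "f \<in> borel_measurable (restrict_space borel (sphere 0 1))"
    using assms measurable_cong_sets[OF sets_arclength refl] by blast
  ultimately show ?thesis
    by (rule measurable_compose)
qed

lemma cis_Arg2pi_unit: "norm a = 1 \<Longrightarrow> cis (Arg2pi a) = a"
  using Arg2pi_eq[of a] by (simp add: cis_conv_exp)

lemma nn_integral_arclength_rotate:
  assumes f: "f \<in> borel_measurable arclength" and a: "norm a = 1"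
  shows "(\<integral>\<^sup>+x. f (a * x) \<partial>arclength) = (\<integral>\<^sup>+x. f x \<partial>arclength)"
proof -
  obtain h where h: "0 \<le> h" "h < 2 * pi" "a = cis h"
    using that[of "Arg2pi a"] cis_Arg2pi_unit[OF a] Arg2pi_ge_0[of a] Arg2pi_lt_2pi[of a] by simp
  define F where "F = (\<lambda>\<theta>. f (cis \<theta>))"
  have F[measurable]: "F \<in> borel_measurable borel"
    using cis_shift_measurable[OF f, of 0] by (simp add: F_def)
  have per: "F (\<theta> + 2 * pi) = F \<theta>" for \<theta>
    by (simp add: F_def cis_mult[symmetric] )
  have shift: "(\<integral>\<^sup>+\<theta>. F \<theta> * indicator {0..<h} \<theta> \<partial>lborel) =
     (\<integral>\<^sup>+\<theta>. F \<theta> * indicator {2*pi..<2*pi+h} \<theta> \<partial>lborel)"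
    by (subst (2) nn_integral_real_affine[where c=1 and t="2*pi"])
       (auto simp: per add.commute[of "2*pi"] indicator_def intro!: nn_integral_cong)
  have fa: "(\<lambda>x. f (a * x)) \<in> borel_measurable arclength"
  proof -
    have "(\<lambda>x. a * x) \<in> restrict_space borel (sphere (0::complex) 1) \<rightarrow>\<^sub>M restrict_space borel (sphere 0 1)"
      using a by (intro measurable_restrict_space2 measurable_restrict_space1
         borel_measurable_continuous_onI continuous_intros) (auto simp: norm_mult space_restrict_space)
    then have "(\<lambda>x. a * x) \<in> arclength \<rightarrow>\<^sub>M arclength"
      using measurable_cong_sets[OF sets_arclength sets_arclength] by blast
    then show ?thesis using f by (rule measurable_compose)
  qed
  have "(\<integral>\<^sup>+x. f (a * x) \<partial>arclength) = (\<integral>\<^sup>+\<theta>. F (h + \<theta>) * indicator {0..<2*pi} \<theta> \<partial>lborel)"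
    by (subst nn_integral_arclength[OF fa]) (simp add: F_def h(3) cis_mult)
  also have "\<dots> = (\<integral>\<^sup>+\<theta>. F \<theta> * indicator {h..<2*pi+h} \<theta> \<partial>lborel)"
    by (subst (2) nn_integral_real_affine[where c=1 and t=h])
       (auto simp: indicator_def intro!: nn_integral_cong)
  also have "\<dots> = (\<integral>\<^sup>+\<theta>. F \<theta> * indicator {h..<2*pi} \<theta> + F \<theta> * indicator {2*pi..<2*pi+h} \<theta> \<partial>lborel)"
    using h by (intro nn_integral_cong) (auto simp: indicator_def)
  also have "\<dots> = (\<integral>\<^sup>+\<theta>. F \<theta> * indicator {h..<2*pi} \<theta> \<partial>lborel) + (\<integral>\<^sup>+\<theta>. F \<theta> * indicator {0..<h} \<theta> \<partial>lborel)"
    by (subst nn_integral_add) (auto simp: shift)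
  also have "\<dots> = (\<integral>\<^sup>+\<theta>. F \<theta> * indicator {h..<2*pi} \<theta> + F \<theta> * indicator {0..<h} \<theta> \<partial>lborel)"
    by (subst nn_integral_add) auto
  also have "\<dots> = (\<integral>\<^sup>+\<theta>. F \<theta> * indicator {0..<2*pi} \<theta> \<partial>lborel)"
    using h by (intro nn_integral_cong) (auto simp: indicator_def)
  also have "\<dots> = (\<integral>\<^sup>+x. f x \<partial>arclength)"
    by (simp add: nn_integral_arclength[OF f] F_def)
  finally show ?thesis .
qed

lemma circle_mult_measurable:
  "(\<lambda>(x, y). x * y) \<in> arclength \<Otimes>\<^sub>M arclength \<rightarrow>\<^sub>M arclength"
proof -
  have "(\<lambda>z. fst z * snd z) \<in> borel_measurable (arclength \<Otimes>\<^sub>M arclength)"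
    by measurable
  then have "(\<lambda>z. fst z * snd z) \<in> arclength \<Otimes>\<^sub>M arclength \<rightarrow>\<^sub>M restrict_space borel (sphere 0 1)"
    by (intro measurable_restrict_space2) (auto simp: space_pair_measure norm_mult)
  then show ?thesis
    using measurable_cong_sets[OF refl sets_arclength] by (simp add: case_prod_unfold)
qed

lemma rotation_measurable:
  assumes "norm a = 1"
  shows "(\<lambda>x. a * x) \<in> arclength \<rightarrow>\<^sub>M arclength"
proof -
  have "(\<lambda>x. (a, x)) \<in> arclength \<rightarrow>\<^sub>M arclength \<Otimes>\<^sub>M arclength"
    using assms by (intro measurable_Pair1') auto
  from measurable_compose[OF this circle_mult_measurable] show ?thesis by simp
qed

lemma distr_arclength_rotate:
  assumes "norm a = 1"
  shows "distr arclength arclength (\<lambda>x. a * x) = arclength"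
proof (rule measure_eqI)
  fix X assume X: "X \<in> sets (distr arclength arclength (\<lambda>x. a * x))"
  then have X: "X \<in> sets arclength" by simp
  have "emeasure (distr arclength arclength (\<lambda>x. a * x)) X = (\<integral>\<^sup>+x. indicator X x \<partial>distr arclength arclength (\<lambda>x. a * x))"
    using X by simp
  also have "\<dots> = (\<integral>\<^sup>+x. indicator X (a * x) \<partial>arclength)"
    using X rotation_measurable[OF assms] by (subst nn_integral_distr) auto
  also have "\<dots> = (\<integral>\<^sup>+x. indicator X x \<partial>arclength)"
    using X by (intro nn_integral_arclength_rotate assms) auto
  finally show "emeasure (distr arclength arclength (\<lambda>x. a * x)) X = emeasure arclength X"
    using X by simp
qed simp

lemma integral_arclength_rotate:
  fixes f :: "complex \<Rightarrow> 'b::{banach, second_countable_topology}"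
  assumes "f \<in> borel_measurable arclength" "norm a = 1"
  shows "(\<integral>x. f (a * x) \<partial>arclength) = (\<integral>x. f x \<partial>arclength)"
  using integral_distr[OF rotation_measurable[OF assms(2)] assms(1)] assms(2)
  by (simp add: distr_arclength_rotate)

lemma emeasure_arclength_sphere: "emeasure arclength (sphere 0 1) = ennreal (2 * pi)"
proof -
  have "emeasure arclength (space arclength) = (\<integral>\<^sup>+x. 1 \<partial>arclength)"
    by simp
  also have "\<dots> = ennreal (2 * pi)"
    by (subst nn_integral_arclength) auto
  finally show ?thesis by simp
qed

lemma finite_measure_arclength: "finite_measure arclength"
  by (rule finite_measureI) (simp add: emeasure_arclength_sphere)

interpretation arclength: finite_measure arclength
  by (rule finite_measure_arclength)

interpretation arclength_pair: pair_sigma_finite arclength arclength ..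

lemma measure_arclength_sphere [simp]: "measure arclength (sphere 0 1) = 2 * pi"
  by (simp add: measure_def emeasure_arclength_sphere)

lemma continuous_integrable_arclength:
  fixes f :: "complex \<Rightarrow> 'b::{banach, second_countable_topology}"
  assumes "continuous_on (sphere 0 1) f"
  shows "integrable arclength f"
proof -
  have "bounded (f ` sphere 0 1)"
    by (intro compact_imp_bounded compact_continuous_image assms) simp
  then obtain B where "\<forall>x\<in>sphere 0 1. norm (f x) \<le> B"
    by (auto simp: bounded_iff)
  then show ?thesis
    by (intro arclength.integrable_const_bound[of _ B] continuous_borel_measurable_arclength assms)
       auto
qed

text \<open>
  Substituting \<open>x = \<omega> * y\<close> in the inner integral turns a kernel of \<open>dist x y\<close> into a function of
  \<open>\<omega>\<close> alone. All double integrals below are treated in these coordinates.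
\<close>

lemma nn_integral_circle_pair_rotate:
  fixes H :: "complex \<Rightarrow> complex \<Rightarrow> ennreal"
  assumes H: "(\<lambda>(x, y). H x y) \<in> borel_measurable (arclength \<Otimes>\<^sub>M arclength)"
  shows "(\<integral>\<^sup>+ (x, y). H x y \<partial>(arclength \<Otimes>\<^sub>M arclength)) =
         (\<integral>\<^sup>+ \<omega>. \<integral>\<^sup>+ y. H (\<omega> * y) y \<partial>arclength \<partial>arclength)"
proof -
  have 1: "(\<lambda>(\<omega>, y). (\<omega> * y, y)) \<in> arclength \<Otimes>\<^sub>M arclength \<rightarrow>\<^sub>M arclength \<Otimes>\<^sub>M arclength"
    using measurable_Pair[OF circle_mult_measurable measurable_snd]
    by (simp add: case_prod_unfold)
  have 2: "(\<lambda>(\<omega>, y). H (\<omega> * y) y) \<in> borel_measurable (arclength \<Otimes>\<^sub>M arclength)"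
    using measurable_compose[OF 1 H] by (simp add: case_prod_unfold)
  have "(\<integral>\<^sup>+ (x, y). H x y \<partial>(arclength \<Otimes>\<^sub>M arclength)) = (\<integral>\<^sup>+ y. \<integral>\<^sup>+ x. H x y \<partial>arclength \<partial>arclength)"
    using arclength_pair.nn_integral_snd[OF H] by simp
  also have "\<dots> = (\<integral>\<^sup>+ y. \<integral>\<^sup>+ \<omega>. H (y * \<omega>) y \<partial>arclength \<partial>arclength)"
  proof (rule nn_integral_cong)
    fix y assume y: "y \<in> space arclength"
    have "(\<lambda>x. H x y) \<in> borel_measurable arclength"
      using measurable_compose[OF measurable_Pair2'[OF y] H] by simp
    then show "(\<integral>\<^sup>+ x. H x y \<partial>arclength) = (\<integral>\<^sup>+ \<omega>. H (y * \<omega>) y \<partial>arclength)"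
      using nn_integral_arclength_rotate[of "\<lambda>x. H x y" y] y by simp
  qed
  also have "\<dots> = (\<integral>\<^sup>+ y. \<integral>\<^sup>+ \<omega>. H (\<omega> * y) y \<partial>arclength \<partial>arclength)"
    by (simp add: mult.commute)
  also have "\<dots> = (\<integral>\<^sup>+ \<omega>. \<integral>\<^sup>+ y. H (\<omega> * y) y \<partial>arclength \<partial>arclength)"
    using arclength_pair.Fubini[OF 2] by simp
  finally show ?thesis .
qed

text \<open>
  Rotating by a root \<open>a\<close> of \<open>a ^ n = -1\<close> changes the sign of the integrand.
\<close>

lemma integral_circle_power:
  assumes "n > 0"
  shows "(\<integral>x. x ^ n \<partial>arclength) = 0"
proof -
  define a where "a = cis (pi / n)"
  have "a ^ n = cis (n * (pi / n))" unfolding a_def by (rule Complex.DeMoivre)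
  then have an: "a ^ n = -1" using assms by simp
  have "(\<integral>x. x ^ n \<partial>arclength) = (\<integral>x. (a * x) ^ n \<partial>arclength)"
    by (rule integral_arclength_rotate[symmetric])
       (auto simp: a_def intro!: continuous_borel_measurable_arclength continuous_intros)
  also have "\<dots> = - (\<integral>x. x ^ n \<partial>arclength)"
    by (simp add: power_mult_distrib an)
  finally show ?thesis by simp
qed

section \<open>Parseval's identity on the circle\<close>

text \<open>
  The Fourier coefficient of index \<open>- n\<close>, not divided by \<open>2 * pi\<close>. For real \<open>f\<close> the coefficient of
  index \<open>n\<close> is its conjugate, so natural numbers suffice.
\<close>

definition fourier_coeff :: "(complex \<Rightarrow> real) \<Rightarrow> nat \<Rightarrow> complex" where
  "fourier_coeff f n = (\<integral>x. of_real (f x) * x ^ n \<partial>arclength)"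

lemma power_mult_cnj_power:
  assumes "norm (x::complex) = 1" "n \<le> m"
  shows "x ^ m * cnj x ^ n = x ^ (m - n)"
proof -
  have "x * cnj x = 1" using assms(1) by (simp add: complex_norm_square[symmetric])
  then have "x ^ n * cnj x ^ n = 1" by (metis power_mult_distrib power_one)
  moreover have "x ^ m = x ^ (m - n) * x ^ n" using assms(2) by (simp flip: power_add)
  ultimately show ?thesis by simp
qed

lemma integral_power_cnj_power:
  "(\<integral>x. x ^ j * cnj x ^ k \<partial>arclength) = (if j = k then complex_of_real (2 * pi) else 0)"
proof (cases j k rule: linorder_cases)
  case less
  have "(\<integral>x. x ^ j * cnj x ^ k \<partial>arclength) = (\<integral>x. cnj (x ^ (k - j)) \<partial>arclength)"
    using less power_mult_cnj_power[of "cnj _" j k]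
    by (intro Bochner_Integration.integral_cong) (auto simp: mult.commute)
  also have "\<dots> = cnj (\<integral>x. x ^ (k - j) \<partial>arclength)"
    by (rule Bochner_Integration.integral_cnj)
  finally show ?thesis using less by (simp add: integral_circle_power)
next
  case equal
  have "(\<integral>x. x ^ j * cnj x ^ k \<partial>arclength) = (\<integral>x. 1 \<partial>arclength)"
    using equal power_mult_cnj_power[of _ k k]
    by (intro Bochner_Integration.integral_cong) auto
  then show ?thesis using equal by (simp add: scaleR_conv_of_real)
next
  case greater
  have "(\<integral>x. x ^ j * cnj x ^ k \<partial>arclength) = (\<integral>x. x ^ (j - k) \<partial>arclength)"
    using greater power_mult_cnj_power[of _ k j]
    by (intro Bochner_Integration.integral_cong) auto
  then show ?thesis using greater by (simp add: integral_circle_power)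
qed

text \<open>
  A real polynomial in the coordinates of the plane is a trigonometric polynomial on the circle,
  written here as \<open>cnj x ^ N\<close> times a complex polynomial, so that products need no bookkeeping of
  exponents. With this, Stone--Weierstrass gives density of trigonometric polynomials.
\<close>

lemma real_polynomial_function_on_circle:
  assumes "real_polynomial_function (g :: complex \<Rightarrow> real)"
  shows "\<exists>N q. degree q \<le> 2 * N \<and> (\<forall>x\<in>sphere 0 1. of_real (g x) = cnj x ^ N * poly q x)"
  using assms
proof (induction rule: real_polynomial_function.induct)
  case (linear g)
  \<comment> \<open>A real-linear function on the plane is \<open>g x = 2 * Re (\<beta> * x)\<close> for this \<open>\<beta>\<close>.\<close>
  define \<beta> where "\<beta> = Complex (g 1 / 2) (- (g \<i>) / 2)"
  have "of_real (g x) = cnj x ^ 1 * poly [:cnj \<beta>, 0, \<beta>:] x" if x: "x \<in> sphere 0 1" for x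
  proof -
    have "x * cnj x = 1" using x by (simp add: complex_norm_square[symmetric])
    then have *: "cnj x * poly [:cnj \<beta>, 0, \<beta>:] x = \<beta> * x + cnj (\<beta> * x)"
      by (simp add: algebra_simps)
    have "x = Re x *\<^sub>R 1 + Im x *\<^sub>R \<i>"
      by (simp add: complex_eq_iff)
    then have "g x = g (Re x *\<^sub>R 1 + Im x *\<^sub>R \<i>)"
      by (rule arg_cong)
    also have "\<dots> = Re x * g 1 + Im x * g \<i>"
      using linear by (simp add: linear_simps)
    finally show ?thesis
      unfolding power_one_right * complex_add_cnj by (simp add: \<beta>_def)
  qed
  moreover have "degree [:cnj \<beta>, 0, \<beta>:] \<le> 2 * 1" by simp
  ultimately show ?case by blast
next
  case (const c)
  have "degree [:complex_of_real c:] \<le> 2 * 0 \<and>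
    (\<forall>x\<in>sphere 0 1. of_real c = cnj x ^ 0 * poly [:of_real c:] x)" by simp
  then show ?case by blast
next
  case (add f g)
  then obtain N q M r where qr: "degree q \<le> 2 * N" "degree r \<le> 2 * M"
     "\<And>x. x \<in> sphere 0 1 \<Longrightarrow> of_real (f x) = cnj x ^ N * poly q x"
     "\<And>x. x \<in> sphere 0 1 \<Longrightarrow> of_real (g x) = cnj x ^ M * poly r x"
    by blast
  have "degree (monom 1 M * q + monom 1 N * r) \<le> 2 * (N + M)"
    using qr(1,2) degree_mult_le[of "monom 1 M" q] degree_mult_le[of "monom 1 N" r]
    by (intro degree_add_le) (auto simp: degree_monom_eq)
  moreover have "of_real (f x + g x) = cnj x ^ (N + M) * poly (monom 1 M * q + monom 1 N * r) x"
    if x: "x \<in> sphere 0 1" for x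
  proof -
    have *: "x ^ k * cnj x ^ k = 1" for k using power_mult_cnj_power[of x k k] x by simp
    have "cnj x ^ (N + M) * poly (monom 1 M * q + monom 1 N * r) x =
      (x ^ M * cnj x ^ M) * (cnj x ^ N * poly q x) + (x ^ N * cnj x ^ N) * (cnj x ^ M * poly r x)"
      by (simp add: poly_monom power_add algebra_simps)
    then show ?thesis using qr(3,4)[OF x] by (simp add: *)
  qed
  ultimately show ?case by blast
next
  case (mult f g)
  then obtain N q M r where qr: "degree q \<le> 2 * N" "degree r \<le> 2 * M"
     "\<And>x. x \<in> sphere 0 1 \<Longrightarrow> of_real (f x) = cnj x ^ N * poly q x"
     "\<And>x. x \<in> sphere 0 1 \<Longrightarrow> of_real (g x) = cnj x ^ M * poly r x"
    by blast
  have "degree (q * r) \<le> degree q + degree r" by (rule degree_mult_le)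
  also have "\<dots> \<le> 2 * (N + M)" using qr(1,2) by simp
  finally have "degree (q * r) \<le> 2 * (N + M)" .
  moreover have "of_real (f x * g x) = cnj x ^ (N + M) * poly (q * r) x"
    if x: "x \<in> sphere 0 1" for x
    using qr(3,4)[OF x] by (simp add: power_add)
  ultimately show ?case by blast
qed

text \<open>
  The functions \<open>cnj x ^ N * x ^ k\<close> are orthogonal, so the orthogonal projection is the best
  approximation. The first claim is Bessel's inequality.
\<close>

lemma trig_best_approximation:
  fixes f :: "complex \<Rightarrow> real" and a :: "nat \<Rightarrow> complex" and N :: nat
  assumes f: "continuous_on (sphere 0 1) f"
  defines "C \<equiv> \<lambda>k. \<integral>x. of_real (f x) * (x ^ N * cnj x ^ k) \<partial>arclength"
  shows "(\<Sum>k\<le>M. (cmod (C k))\<^sup>2) / (2 * pi) \<le> (\<integral>x. (f x)\<^sup>2 \<partial>arclength)"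
    and "(\<integral>x. (f x)\<^sup>2 \<partial>arclength) - (\<Sum>k\<le>M. (cmod (C k))\<^sup>2) / (2 * pi) \<le>
      (\<integral>x. (cmod (of_real (f x) - cnj x ^ N * (\<Sum>k\<le>M. a k * x ^ k)))\<^sup>2 \<partial>arclength)"
proof -
  define P where "P = (\<lambda>(c::nat\<Rightarrow>complex) x. cnj x ^ N * (\<Sum>k\<le>M. c k * x ^ k))"
  have contP: "continuous_on (sphere 0 1) (P c)" for c
    unfolding P_def by (intro continuous_intros)
  have PP: "(\<integral>x. P c x * cnj (P c x) \<partial>arclength) = of_real (2 * pi * (\<Sum>k\<le>M. (cmod (c k))\<^sup>2))" for c
  proof -
    have "(\<integral>x. P c x * cnj (P c x) \<partial>arclength) =
       (\<integral>x. (\<Sum>k\<le>M. \<Sum>j\<le>M. c k * cnj (c j) * (x ^ k * cnj x ^ j)) \<partial>arclength)"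
    proof (intro Bochner_Integration.integral_cong refl)
      fix x assume "x \<in> space arclength"
      then have *: "x ^ N * cnj x ^ N = 1" using power_mult_cnj_power[of x N N] by simp
      have "P c x * cnj (P c x) = (x ^ N * cnj x ^ N) * ((\<Sum>k\<le>M. c k * x ^ k) * (\<Sum>j\<le>M. cnj (c j) * cnj x ^ j))"
        by (simp add: P_def algebra_simps)
      then show "P c x * cnj (P c x) = (\<Sum>k\<le>M. \<Sum>j\<le>M. c k * cnj (c j) * (x ^ k * cnj x ^ j))"
        by (simp add: * sum_product algebra_simps)
    qed
    also have "\<dots> = (\<Sum>k\<le>M. \<Sum>j\<le>M. c k * cnj (c j) * (\<integral>x. x ^ k * cnj x ^ j \<partial>arclength))"
      by (simp add: continuous_integrable_arclength continuous_intros)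
    also have "\<dots> = (\<Sum>k\<le>M. c k * cnj (c k) * of_real (2 * pi))"
      by (simp add: integral_power_cnj_power if_distrib if_distribR sum.delta cong: if_cong)
    also have "\<dots> = of_real (2 * pi * (\<Sum>k\<le>M. (cmod (c k))\<^sup>2))"
      by (simp add: complex_norm_square[symmetric] sum_distrib_left mult.commute)
    finally show ?thesis .
  qed
  have fP: "(\<integral>x. of_real (f x) * cnj (P c x) \<partial>arclength) = (\<Sum>k\<le>M. cnj (c k) * C k)" for c
  proof -
    have "(\<integral>x. of_real (f x) * cnj (P c x) \<partial>arclength) =
      (\<integral>x. (\<Sum>k\<le>M. cnj (c k) * (of_real (f x) * (x ^ N * cnj x ^ k))) \<partial>arclength)"
      by (intro Bochner_Integration.integral_cong)
         (simp_all add: P_def sum_distrib_left algebra_simps)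
    also have "\<dots> = (\<Sum>k\<le>M. cnj (c k) * C k)"
      using f by (simp add: continuous_integrable_arclength continuous_intros C_def)
    finally show ?thesis .
  qed
  have main: "(\<integral>x. (cmod (of_real (f x) - P c x))\<^sup>2 \<partial>arclength) =
     (\<integral>x. (f x)\<^sup>2 \<partial>arclength) - (\<Sum>k\<le>M. (cmod (C k))\<^sup>2) / (2 * pi) +
      (\<Sum>k\<le>M. (cmod (C k - of_real (2 * pi) * c k))\<^sup>2) / (2 * pi)" for c
  proof -
    have "(\<integral>x. (cmod (of_real (f x) - P c x))\<^sup>2 \<partial>arclength) =
      (\<integral>x. (f x)\<^sup>2 - 2 * Re (of_real (f x) * cnj (P c x)) + Re (P c x * cnj (P c x)) \<partial>arclength)"
      by (intro Bochner_Integration.integral_cong refl)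
         (simp only: cmod_power2, simp add: power2_eq_square algebra_simps)
    also have "\<dots> = (\<integral>x. (f x)\<^sup>2 \<partial>arclength) - 2 * Re (\<integral>x. of_real (f x) * cnj (P c x) \<partial>arclength)
       + Re (\<integral>x. P c x * cnj (P c x) \<partial>arclength)"
    proof -
      have i: "integrable arclength (\<lambda>x. of_real (f x) * cnj (P c x))" "integrable arclength (\<lambda>x. P c x * cnj (P c x))"
        "integrable arclength (\<lambda>x. (f x)\<^sup>2)"
        using f contP[of c] by (auto intro!: continuous_integrable_arclength continuous_intros)
      show ?thesis
        by (simp only: integral_Re[OF i(1), symmetric] integral_Re[OF i(2), symmetric]
              Bochner_Integration.integral_add Bochner_Integration.integral_diff i integrable_Re integrable_mult_right
              Bochner_Integration.integrable_diff Bochner_Integration.integral_mult_right)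
    qed
    also have "\<dots> = (\<integral>x. (f x)\<^sup>2 \<partial>arclength) - 2 * Re (\<Sum>k\<le>M. cnj (c k) * C k) + 2 * pi * (\<Sum>k\<le>M. (cmod (c k))\<^sup>2)"
      by (simp only: fP PP Re_complex_of_real)
    also have "\<dots> = (\<integral>x. (f x)\<^sup>2 \<partial>arclength) +
      (\<Sum>k\<le>M. - 2 * Re (cnj (c k) * C k) + 2 * pi * (cmod (c k))\<^sup>2)"
      by (simp add: sum.distrib sum_distrib_left sum_negf sum_subtractf)
    also have "(\<Sum>k\<le>M. - 2 * Re (cnj (c k) * C k) + 2 * pi * (cmod (c k))\<^sup>2) =
      (\<Sum>k\<le>M. (cmod (C k - of_real (2 * pi) * c k))\<^sup>2 / (2 * pi) - (cmod (C k))\<^sup>2 / (2 * pi))"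
      by (intro sum.cong refl)
         (simp only: cmod_power2, simp add: power2_eq_square field_simps)
    finally show ?thesis
      by (simp add: sum_subtractf sum_divide_distrib)
  qed
  have "0 \<le> (\<integral>x. (cmod (of_real (f x) - P (\<lambda>k. C k / of_real (2*pi)) x))\<^sup>2 \<partial>arclength)"
    by (intro integral_nonneg_AE) simp
  then show "(\<Sum>k\<le>M. (cmod (C k))\<^sup>2) / (2 * pi) \<le> (\<integral>x. (f x)\<^sup>2 \<partial>arclength)"
    by (simp add: main)
  show "(\<integral>x. (f x)\<^sup>2 \<partial>arclength) - (\<Sum>k\<le>M. (cmod (C k))\<^sup>2) / (2 * pi) \<le>
      (\<integral>x. (cmod (of_real (f x) - cnj x ^ N * (\<Sum>k\<le>M. a k * x ^ k)))\<^sup>2 \<partial>arclength)"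
    using main[of a] by (simp add: P_def sum_nonneg)
qed

text \<open>
  The share of \<open>\<integral> f\<^sup>2\<close> that belongs to the modes \<open>n\<close> and \<open>- n\<close> together; hence the factor \<open>2\<close>.
\<close>

definition parseval_weight :: "(complex \<Rightarrow> real) \<Rightarrow> nat \<Rightarrow> real" where
  "parseval_weight f n = (if n = 0 then 1 else 2) * (cmod (fourier_coeff f n))\<^sup>2 / (2 * pi)"

lemma parseval_weight_nonneg [simp]: "0 \<le> parseval_weight f n"
  by (simp add: parseval_weight_def)

lemma parseval_weight_partial_sum:
  fixes f :: "complex \<Rightarrow> real"
  assumes f: "continuous_on (sphere 0 1) f"
  shows "(\<Sum>k\<le>2 * N. (cmod (\<integral>x. of_real (f x) * (x ^ N * cnj x ^ k) \<partial>arclength))\<^sup>2) / (2 * pi)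
    = (\<Sum>n\<le>N. parseval_weight f n)"
proof -
  let ?c = "\<lambda>k. (cmod (\<integral>x. of_real (f x) * (x ^ N * cnj x ^ k) \<partial>arclength))\<^sup>2"
  let ?d = "\<lambda>k. (cmod (fourier_coeff f k))\<^sup>2"
  have low: "?c k = ?d (N - k)" if "k \<le> N" for k
  proof -
    have "(\<integral>x. of_real (f x) * (x ^ N * cnj x ^ k) \<partial>arclength) = fourier_coeff f (N - k)"
      unfolding fourier_coeff_def using power_mult_cnj_power[OF _ that]
      by (intro Bochner_Integration.integral_cong) auto
    then show ?thesis by simp
  qed
  have high: "?c (N + j) = ?d j" for j
  proof -
    have "(\<integral>x. of_real (f x) * (x ^ N * cnj x ^ (N + j)) \<partial>arclength) =
      (\<integral>x. cnj (of_real (f x) * x ^ j) \<partial>arclength)"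
      using power_mult_cnj_power[of _ N N]
      by (intro Bochner_Integration.integral_cong) (auto simp: power_add mult.assoc[symmetric])
    also have "\<dots> = cnj (fourier_coeff f j)" unfolding fourier_coeff_def
      by (rule Bochner_Integration.integral_cnj)
    finally show ?thesis by simp
  qed
  have "(\<Sum>k\<le>2 * N. ?c k) = (\<Sum>k<N. ?c k) + (\<Sum>j\<le>N. ?c (N + j))"
  proof -
    have "(\<Sum>j\<le>N. ?c (N + j)) = (\<Sum>k\<in>{N..2*N}. ?c k)"
      by (rule sum.reindex_bij_witness[of _ "\<lambda>k. k - N" "\<lambda>j. N + j"]) auto
    moreover have "{..2*N} = {..<N} \<union> {N..2*N}" by auto
    ultimately show ?thesis by (simp add: sum.union_disjoint ivl_disj_int)
  qed
  also have "(\<Sum>k<N. ?c k) = (\<Sum>n\<in>{1..N}. ?d n)"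
    by (rule sum.reindex_bij_witness[of _ "\<lambda>n. N - n" "\<lambda>k. N - k"]) (auto simp: low)
  also have "(\<Sum>j\<le>N. ?c (N + j)) = (\<Sum>n\<le>N. ?d n)" by (simp add: high)
  also have "(\<Sum>n\<le>N. ?d n) = ?d 0 + (\<Sum>n\<in>{1..N}. ?d n)"
    by (simp add: sum.atLeast_Suc_atMost atMost_atLeast0)
  also have "(\<Sum>n\<in>{1..N}. ?d n) + (?d 0 + (\<Sum>n\<in>{1..N}. ?d n)) =
    (\<Sum>n\<le>N. (if n = 0 then 1 else 2) * ?d n)"
  proof -
    have "(\<Sum>n\<le>N. (if n = 0 then 1 else 2) * ?d n) = ?d 0 + (\<Sum>n\<in>{1..N}. (if n = 0 then 1 else 2) * ?d n)"
      by (simp add: sum.atLeast_Suc_atMost atMost_atLeast0)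
    also have "(\<Sum>n\<in>{1..N}. (if n = 0 then 1 else 2) * ?d n) = (\<Sum>n\<in>{1..N}. 2 * ?d n)"
      by (intro sum.cong) auto
    finally show ?thesis by (simp add: sum_distrib_left[symmetric])
  qed
  finally show ?thesis
    by (simp add: parseval_weight_def sum_divide_distrib)
qed

text \<open>
  Bessel's inequality bounds the partial sums, and a uniform approximation by trigonometric
  polynomials shows that nothing is lost in the limit.
\<close>

lemma parseval_circle:
  fixes f :: "complex \<Rightarrow> real"
  assumes f: "continuous_on (sphere 0 1) f"
  shows "parseval_weight f sums (\<integral>x. (f x)\<^sup>2 \<partial>arclength)"
proof -
  let ?I = "\<integral>x. (f x)\<^sup>2 \<partial>arclength"
  let ?S = "\<lambda>N. \<Sum>n\<le>N. parseval_weight f n"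
  have upper: "?S N \<le> ?I" for N
    using trig_best_approximation(1)[OF f, where N=N and M="2*N"]
    by (simp add: parseval_weight_partial_sum[OF f])
  have lower: "\<exists>N. ?I - e \<le> ?S N" if e: "e > 0" for e
  proof -
    define d where "d = sqrt (e / (2 * pi))"
    have d: "d > 0" "d\<^sup>2 * (2 * pi) = e" using e by (auto simp: d_def)
    obtain g where g: "real_polynomial_function g" "\<And>x. x \<in> sphere 0 1 \<Longrightarrow> \<bar>f x - g x\<bar> < d"
      using Stone_Weierstrass_real_polynomial_function[OF compact_sphere f d(1)] by blast
    obtain N q where q: "degree q \<le> 2 * N" "\<And>x. x \<in> sphere 0 1 \<Longrightarrow> of_real (g x) = cnj x ^ N * poly q x"
      using real_polynomial_function_on_circle[OF g(1)] by blast
    have qsum: "poly q x = (\<Sum>k\<le>2 * N. coeff q k * x ^ k)" for x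
    proof -
      have "poly q x = poly (\<Sum>k\<le>2 * N. monom (coeff q k) k) x"
        using poly_as_sum_of_monoms'[OF q(1)] by simp
      then show ?thesis by (simp add: poly_sum poly_monom)
    qed
    have "?I - ?S N \<le> (\<integral>x. (cmod (of_real (f x) - cnj x ^ N * (\<Sum>k\<le>2 * N. coeff q k * x ^ k)))\<^sup>2 \<partial>arclength)"
      using trig_best_approximation(2)[OF f, where N=N and M="2*N" and a="coeff q"]
      by (simp add: parseval_weight_partial_sum[OF f])
    also have "\<dots> = (\<integral>x. (f x - g x)\<^sup>2 \<partial>arclength)"
    proof (intro Bochner_Integration.integral_cong refl)
      fix x assume "x \<in> space arclength"
      then have "cnj x ^ N * (\<Sum>k\<le>2 * N. coeff q k * x ^ k) = of_real (g x)"
        using q(2) by (simp add: qsum)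
      then show "(cmod (of_real (f x) - cnj x ^ N * (\<Sum>k\<le>2 * N. coeff q k * x ^ k)))\<^sup>2 = (f x - g x)\<^sup>2"
        by (simp flip: of_real_diff)
    qed
    also have "\<dots> \<le> (\<integral>x. d\<^sup>2 \<partial>arclength)"
    proof (intro integral_mono)
      show "integrable arclength (\<lambda>x. (f x - g x)\<^sup>2)"
        using f continuous_on_polymonial_function[of g] g(1)
        by (intro continuous_integrable_arclength continuous_intros)
           (auto simp: real_polynomial_function_eq)
      fix x assume "x \<in> space arclength"
      then have "\<bar>f x - g x\<bar> \<le> \<bar>d\<bar>" using g(2)[of x] d by auto
      then show "(f x - g x)\<^sup>2 \<le> d\<^sup>2" by (simp only: abs_le_square_iff)
    qed simp
    also have "\<dots> = e" using d by (simp add: mult.commute)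
    finally have "?I - e \<le> ?S N" by simp
    then show ?thesis ..
  qed
  have mono: "?S N \<le> ?S M" if "N \<le> M" for N M
    using that by (intro sum_mono2) auto
  have "?S \<longlonglongrightarrow> ?I"
  proof (rule LIMSEQ_I)
    fix e :: real assume e: "e > 0"
    then obtain N where "?I - e / 2 \<le> ?S N" using lower[of "e/2"] by auto
    then have "norm (?S M - ?I) < e" if "M \<ge> N" for M
      using mono[OF that] upper[of M] e by simp
    then show "\<exists>N. \<forall>M\<ge>N. norm (?S M - ?I) < e" by blast
  qed
  then show ?thesis by (simp add: sums_def_le)
qed

text \<open>
  Rotation by \<open>\<omega>\<close> multiplies the \<open>n\<close>-th coefficient by \<open>cnj \<omega> ^ n\<close>, and
  \<open>(cmod (cnj \<omega> ^ n - 1))\<^sup>2 = 2 * (1 - Re (\<omega> ^ n))\<close>.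
\<close>

lemma parseval_circle_increment:
  fixes f :: "complex \<Rightarrow> real"
  assumes f: "continuous_on (sphere 0 1) f" and w: "norm \<omega> = 1"
  shows "(\<lambda>n. 2 * parseval_weight f n * (1 - Re (\<omega> ^ n))) sums (\<integral>y. (f (\<omega> * y) - f y)\<^sup>2 \<partial>arclength)"
proof -
  let ?D = "\<lambda>y. f (\<omega> * y) - f y"
  have cont: "continuous_on (sphere 0 1) (\<lambda>y. f (\<omega> * y))"
    using w by (intro continuous_on_compose2[OF f] continuous_intros) (auto simp: norm_mult)
  have "fourier_coeff ?D n = (cnj \<omega> ^ n - 1) * fourier_coeff f n" for n
  proof -
    have "(\<integral>y. of_real (f (\<omega> * y)) * y ^ n \<partial>arclength) =
       (\<integral>y. cnj \<omega> ^ n * (of_real (f (\<omega> * y)) * (\<omega> * y) ^ n) \<partial>arclength)"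
    proof (intro Bochner_Integration.integral_cong refl)
      fix y
      have "cnj \<omega> ^ n * (of_real (f (\<omega> * y)) * (\<omega> * y) ^ n) =
        (\<omega> ^ n * cnj \<omega> ^ n) * (of_real (f (\<omega> * y)) * y ^ n)"
        by (simp only: power_mult_distrib mult_ac)
      also have "\<dots> = of_real (f (\<omega> * y)) * y ^ n"
        using power_mult_cnj_power[OF w, of n n] by simp
      finally show "of_real (f (\<omega> * y)) * y ^ n = cnj \<omega> ^ n * (of_real (f (\<omega> * y)) * (\<omega> * y) ^ n)" ..
    qed
    also have "\<dots> = cnj \<omega> ^ n * (\<integral>y. of_real (f (\<omega> * y)) * (\<omega> * y) ^ n \<partial>arclength)"
      by simp
    also have "(\<integral>y. of_real (f (\<omega> * y)) * (\<omega> * y) ^ n \<partial>arclength) = fourier_coeff f n"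
      unfolding fourier_coeff_def using f w
      by (intro integral_arclength_rotate continuous_borel_measurable_arclength continuous_intros)
    finally have *: "(\<integral>y. of_real (f (\<omega> * y)) * y ^ n \<partial>arclength) = cnj \<omega> ^ n * fourier_coeff f n" .
    have "fourier_coeff ?D n = (\<integral>y. of_real (f (\<omega> * y)) * y ^ n \<partial>arclength) - fourier_coeff f n"
      unfolding fourier_coeff_def using f cont
      by (subst Bochner_Integration.integral_diff[symmetric])
         (auto intro!: continuous_integrable_arclength continuous_intros simp: algebra_simps)
    then show ?thesis unfolding * by (simp add: algebra_simps)
  qed
  moreover have "(cmod (cnj \<omega> ^ n - 1))\<^sup>2 = 2 * (1 - Re (\<omega> ^ n))" for n
  proof -
    have "(cmod (\<omega> ^ n))\<^sup>2 = 1" using w by (simp add: norm_power)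
    moreover have "(cmod (cnj z - 1))\<^sup>2 = 2 * (1 - Re z)" if "(cmod z)\<^sup>2 = 1" for z
      using that unfolding cmod_power2 by (simp add: power2_eq_square algebra_simps)
    ultimately show ?thesis by (simp flip: complex_cnj_power)
  qed
  ultimately have "parseval_weight ?D = (\<lambda>n. 2 * parseval_weight f n * (1 - Re (\<omega> ^ n)))"
    by (simp add: parseval_weight_def norm_mult power_mult_distrib fun_eq_iff)
  moreover have "parseval_weight ?D sums (\<integral>y. (?D y)\<^sup>2 \<partial>arclength)"
    using f cont by (intro parseval_circle continuous_intros)
  ultimately show ?thesis by simp
qed

section \<open>Lower bounds for powers of chords\<close>

text \<open>
  Taylor's formula of order two with the Lagrange remainder. The lower bounds for \<open>\<bar>r\<bar> powr p\<close> below
  come from bounds on this remainder.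
\<close>

lemma powr_taylor_one:
  fixes a x :: real
  assumes "x > 0"
  shows "\<exists>\<xi>>0. min 1 x \<le> \<xi> \<and> \<xi> \<le> max 1 x \<and>
    x powr a = 1 + a * (x - 1) + a * (a - 1) / 2 * \<xi> powr (a - 2) * (x - 1)\<^sup>2"
proof (cases "x = 1")
  case True then show ?thesis by (intro exI[of _ 1]) auto
next
  case False
  define diff :: "nat \<Rightarrow> real \<Rightarrow> real" where
    "diff = (\<lambda>m t. if m = 0 then t powr a else if m = 1 then a * t powr (a - 1)
       else a * (a - 1) * t powr (a - 2))"
  have der: "\<forall>m t. m < 2 \<and> min 1 x \<le> t \<and> t \<le> max 1 x \<longrightarrow> DERIV (diff m) t :> diff (Suc m) t"
  proof (intro allI impI)
    fix m t assume mt: "m < (2::nat) \<and> min 1 x \<le> t \<and> t \<le> max 1 x"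
    then have t: "t > 0" using assms by auto
    from mt consider "m = 0" | "m = 1" by linarith
    then show "DERIV (diff m) t :> diff (Suc m) t"
    proof cases
      case 1
      then show ?thesis using t
        by (auto simp: diff_def intro!: derivative_eq_intros)
    next
      case 2
      have "((\<lambda>t. a * t powr (a - 1)) has_real_derivative a * ((a - 1) * t powr (a - 1 - 1))) (at t)"
        using t by (intro DERIV_cmult has_real_derivative_powr)
      then show ?thesis using 2 by (simp add: diff_def mult.assoc)
    qed
  qed
  from Taylor[of 2 diff "\<lambda>t. t powr a" "min 1 x" "max 1 x" 1 x, OF _ _ der] False
  obtain t where t: "if x < 1 then x < t \<and> t < 1 else 1 < t \<and> t < x"
    and eq: "x powr a = (\<Sum>m<2. (diff m 1 / fact m) * (x - 1) ^ m) + (diff 2 t / fact 2) * (x - 1) ^ 2"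
    by (auto simp: diff_def)
  have "x powr a = 1 + a * (x - 1) + a * (a - 1) / 2 * t powr (a - 2) * (x - 1)\<^sup>2"
    using eq by (simp add: diff_def numeral_2_eq_2)
  then show ?thesis using t assms by (intro exI[of _ t]) (auto split: if_splits)
qed

lemma powr_bernoulli:
  fixes a x :: real
  assumes "a \<ge> 1" "x \<ge> 0"
  shows "1 + a * (x - 1) \<le> x powr a"
proof (cases "x = 0")
  case True then show ?thesis using assms by simp
next
  case False
  then obtain \<xi> where "x powr a = 1 + a * (x - 1) + a * (a - 1) / 2 * \<xi> powr (a - 2) * (x - 1)\<^sup>2"
    using powr_taylor_one[of x a] assms by auto
  moreover have "0 \<le> a * (a - 1) / 2 * \<xi> powr (a - 2) * (x - 1)\<^sup>2"
    using assms by simp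
  ultimately show ?thesis by linarith
qed

text \<open>
  Bernoulli's inequality for \<open>r\<^sup>2\<close> with exponent \<open>p / 2 \<ge> 1\<close>.
\<close>

lemma abs_powr_lower_superquadratic:
  fixes p r :: real
  assumes "p \<ge> 2"
  shows "1 + p * (r - 1) + p / 2 * (r - 1)\<^sup>2 \<le> \<bar>r\<bar> powr p"
proof -
  have "\<bar>r\<bar> powr p = (r\<^sup>2) powr (p / 2)"
  proof (cases "r = 0")
    case False
    then have "(r\<^sup>2) powr (p / 2) = (\<bar>r\<bar> powr 2) powr (p / 2)" by simp
    then show ?thesis by (simp only: powr_powr) simp
  qed (use assms in auto)
  moreover have "1 + p / 2 * (r\<^sup>2 - 1) \<le> (r\<^sup>2) powr (p / 2)"
    using assms by (intro powr_bernoulli) auto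
  ultimately show ?thesis by (simp add: power2_eq_square algebra_simps)
qed

text \<open>
  For \<open>p < 2\<close> the second derivative of \<open>\<bar>r\<bar> powr p\<close> decays at infinity, so the constant depends on
  the range of \<open>r\<close>. For \<open>r > 0\<close> it comes from the Taylor remainder; for \<open>r \<le> 0\<close> the crude bound
  \<open>(r - 1)\<^sup>2 \<le> 2 + 2 * r\<^sup>2\<close> suffices.
\<close>

lemma abs_powr_lower_subquadratic:
  fixes p r L :: real
  assumes p: "1 < p" "p \<le> 2" and L: "L \<ge> 1" "\<bar>r\<bar> \<le> L"
  shows "1 + p * (r - 1) + (p - 1) / 2 * L powr (p - 2) * (r - 1)\<^sup>2 \<le> \<bar>r\<bar> powr p"
proof -
  have Lp: "0 < L powr (p - 2)" "L powr (p - 2) \<le> 1"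
    using L p powr_mono[of "p - 2" 0 L] by auto
  show ?thesis
  proof (cases "r > 0")
    case True
    then obtain \<xi> where x: "\<xi> > 0" "\<xi> \<le> max 1 r"
      and eq: "r powr p = 1 + p * (r - 1) + p * (p - 1) / 2 * \<xi> powr (p - 2) * (r - 1)\<^sup>2"
      using powr_taylor_one[of r p] by auto
    have "L powr (p - 2) \<le> \<xi> powr (p - 2)"
      using x L p by (intro powr_mono2') auto
    moreover have "(p - 1) / 2 \<le> p * (p - 1) / 2"
      using mult_right_mono[of 1 p "(p - 1) / 2"] p by (simp only: mult_1 times_divide_eq_right) simp
    ultimately have "(p - 1) / 2 * L powr (p - 2) \<le> p * (p - 1) / 2 * \<xi> powr (p - 2)"
      using p Lp by (intro mult_mono) auto
    then have "(p - 1) / 2 * L powr (p - 2) * (r - 1)\<^sup>2 \<le> p * (p - 1) / 2 * \<xi> powr (p - 2) * (r - 1)\<^sup>2"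
      by (intro mult_right_mono) auto
    then show ?thesis using eq True by simp
  next
    case False
    define y where "y = - r"
    have y: "y \<ge> 0" "y \<le> L" "r = - y" using False L by (auto simp: y_def)
    let ?l = "L powr (p - 2)"
    have sq: "?l * y\<^sup>2 \<le> y powr p"
    proof (cases "y = 0")
      case False
      then have "?l * y\<^sup>2 \<le> y powr (p - 2) * y powr 2"
        using y p L by (intro mult_mono powr_mono2') auto
      also have "\<dots> = y powr p" by (simp flip: powr_add)
      finally show ?thesis .
    qed (use p in simp)
    have "2 * y \<le> 1 + y\<^sup>2"
      using zero_le_power2[of "1 - y"] by (simp add: power2_eq_square algebra_simps)
    then have "(p - 1) / 2 * ?l * (r - 1)\<^sup>2 \<le> (p - 1) / 2 * ?l * (2 + 2 * y\<^sup>2)"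
      using p Lp y(3) by (intro mult_left_mono) (auto simp: power2_eq_square algebra_simps)
    also have "\<dots> = (p - 1) * ?l + (p - 1) * (?l * y\<^sup>2)"
      by (simp add: field_simps)
    also have "\<dots> \<le> (p - 1) * 1 + 1 * (?l * y\<^sup>2)"
      using p Lp by (intro add_mono mult_mono) auto
    also have "\<dots> \<le> p - 1 + y powr p" using sq by simp
    also have "\<dots> \<le> p - 1 + p * y + \<bar>r\<bar> powr p" using y p by simp
    finally show ?thesis using y by (simp add: algebra_simps)
  qed
qed

text \<open>
  The intermediate point in Taylor's formula is close to one, so its remainder has almost the full
  constant \<open>p * (p - 1) / 2\<close>.
\<close>

lemma abs_powr_lower_near_one:
  fixes p \<sigma> :: real
  assumes p: "1 < p" and "\<sigma> > 0"
  shows "\<exists>\<tau>>0. \<forall>r. \<bar>r - 1\<bar> \<le> \<tau> \<longrightarrow>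
    1 + p * (r - 1) + (p * (p - 1) / 2 - \<sigma>) * (r - 1)\<^sup>2 \<le> \<bar>r\<bar> powr p"
proof -
  have "isCont (\<lambda>x. p * (p - 1) / 2 * x powr (p - 2)) (1::real)"
    by (intro continuous_intros) auto
  then obtain d where d: "d > 0" and
    dd: "\<And>x::real. \<bar>x - 1\<bar> < d \<Longrightarrow> \<bar>p * (p - 1) / 2 * x powr (p - 2) - p * (p - 1) / 2\<bar> < \<sigma>"
    using \<open>\<sigma> > 0\<close> unfolding continuous_at_eps_delta by (auto simp: dist_real_def)
  define \<tau> where "\<tau> = min (d / 2) (1 / 2)"
  have "1 + p * (r - 1) + (p * (p - 1) / 2 - \<sigma>) * (r - 1)\<^sup>2 \<le> \<bar>r\<bar> powr p" if r: "\<bar>r - 1\<bar> \<le> \<tau>" for r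
  proof -
    have r0: "r > 0" using r unfolding \<tau>_def by linarith
    obtain \<xi> where x: "min 1 r \<le> \<xi>" "\<xi> \<le> max 1 r"
      and eq: "r powr p = 1 + p * (r - 1) + p * (p - 1) / 2 * \<xi> powr (p - 2) * (r - 1)\<^sup>2"
      using powr_taylor_one[OF r0, of p] by auto
    have "\<bar>\<xi> - 1\<bar> \<le> \<bar>r - 1\<bar>" using x by (cases "r \<le> 1") auto
    then have "\<bar>\<xi> - 1\<bar> < d" using r d unfolding \<tau>_def by linarith
    then have "p * (p - 1) / 2 - \<sigma> \<le> p * (p - 1) / 2 * \<xi> powr (p - 2)"
      using dd[of \<xi>] by linarith
    then have "(p * (p - 1) / 2 - \<sigma>) * (r - 1)\<^sup>2 \<le> p * (p - 1) / 2 * \<xi> powr (p - 2) * (r - 1)\<^sup>2"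
      by (intro mult_right_mono) auto
    then show ?thesis using eq r0 by simp
  qed
  moreover have "\<tau> > 0" using d by (simp add: \<tau>_def)
  ultimately show ?thesis by blast
qed

lemma sin_ge_cubic:
  fixes x :: real
  assumes "0 \<le> x"
  shows "x - x ^ 3 / 6 \<le> sin x"
proof -
  define G :: "real \<Rightarrow> real" where "G = (\<lambda>x. sin x - (x - x ^ 3 / 6))"
  have "G 0 \<le> G x"
  proof (rule DERIV_nonneg_imp_nondecreasing[of 0 x G])
    fix y :: real
    have "(G has_real_derivative cos y - (1 - y\<^sup>2 / 2)) (at y)"
      unfolding G_def by (auto intro!: derivative_eq_intros)
    moreover have "(\<bar>sin (y / 2)\<bar>)\<^sup>2 \<le> (\<bar>y / 2\<bar>)\<^sup>2"
      using abs_sin_x_le_abs_x[of "y / 2"] by (intro power_mono) auto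
    then have "(sin (y / 2))\<^sup>2 \<le> y\<^sup>2 / 4" by (simp add: power_divide)
    then have "0 \<le> cos y - (1 - y\<^sup>2 / 2)"
      using cos_double_sin[of "y / 2"] by simp
    ultimately show "\<exists>z. (G has_real_derivative z) (at y) \<and> 0 \<le> z" by blast
  qed (use assms in auto)
  then show ?thesis by (simp add: G_def)
qed

lemma sin_half_cubic_bound:
  fixes g :: real
  shows "\<bar>2 * sin (g / 2) - g\<bar> \<le> \<bar>g\<bar> ^ 3 / 24"
proof -
  have pos: "\<bar>2 * sin (g / 2) - g\<bar> \<le> g ^ 3 / 24" if g: "0 \<le> g" for g :: real
    using sin_ge_cubic[of "g / 2"] sin_x_le_x[of "g / 2"] g by (simp add: power_divide abs_if)
  show ?thesis
    using pos[of g] pos[of "- g"] by (cases "0 \<le> g") auto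
qed

text \<open>
  The expansion of the energy density, as a lower bound. Here \<open>s\<close> and \<open>t\<close> are the signed chords
  before and after the perturbation, and \<open>W\<close> is the constant of the convexity inequality that holds
  for their ratio. The chord \<open>t\<close> is \<open>s\<close> plus \<open>cos (h / 2) * g\<close> plus terms of order \<open>g\<^sup>2\<close>: the factor
  \<open>(cos (h / 2))\<^sup>2 = 1 - s\<^sup>2 / 4\<close> and the second-order term \<open>- s * g\<^sup>2 / 8\<close> together produce the term with
  \<open>p\<^sup>2 / 8\<close>, and everything of third order costs at most \<open>2 * \<gamma>\<close>.
\<close>

lemma chord_energy_increment:
  fixes p h g W \<gamma> :: real
  defines "s \<equiv> 2 * sin (h / 2)" and "t \<equiv> 2 * sin ((h + g) / 2)"
  assumes p: "1 < p" "p < 3" and s: "s \<noteq> 0" and g: "\<bar>g\<bar> \<le> \<gamma>" and \<gamma>: "\<gamma> \<le> 1"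
    and W: "0 \<le> W" "W \<le> p * (p - 1) / 2"
    and conv: "1 + p * (t / s - 1) + W * (t / s - 1)\<^sup>2 \<le> \<bar>t / s\<bar> powr p"
  shows "\<bar>s\<bar> powr p + p * \<bar>s\<bar> powr (p - 2) * s * cos (h / 2) * g + (W - 2 * \<gamma>) * \<bar>s\<bar> powr (p - 2) * g\<^sup>2
    \<le> \<bar>t\<bar> powr p + p\<^sup>2 / 8 * \<bar>s\<bar> powr p * g\<^sup>2"
proof -
  define Y where "Y = \<bar>s\<bar> powr (p - 2)"
  have Y: "Y > 0" using s by (simp add: Y_def)
  have sp: "\<bar>s\<bar> powr p = Y * s\<^sup>2"
  proof -
    have "Y * s\<^sup>2 = \<bar>s\<bar> powr (p - 2) * \<bar>s\<bar> powr 2" using s by (simp add: Y_def)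
    also have "\<dots> = \<bar>s\<bar> powr p" by (subst powr_add[symmetric]) simp
    finally show ?thesis by simp
  qed
  define d c e k where "d = t - s" and "c = cos (h / 2)" and "e = 2 * sin (g / 2) - g"
    and "k = 1 - cos (g / 2)"
  have g1: "\<bar>g\<bar> \<le> 1" using g \<gamma> by linarith
  have c2: "c\<^sup>2 = 1 - s\<^sup>2 / 4"
    using cos_squared_eq[of "h / 2"] by (simp add: c_def s_def power_mult_distrib)
  have c1: "\<bar>c\<bar> \<le> 1" by (simp add: c_def)
  have s2: "\<bar>s\<bar> \<le> 2" using abs_sin_le_one[of "h/2"] by (simp add: s_def abs_mult)
  have e: "\<bar>e\<bar> \<le> \<bar>g\<bar> * g\<^sup>2 / 24"
    using sin_half_cubic_bound[of g] by (simp add: e_def power3_eq_cube power2_eq_square mult.assoc)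
  have k: "0 \<le> k" "k \<le> g\<^sup>2 / 8"
  proof -
    show "0 \<le> k" by (simp add: k_def)
    have "(\<bar>sin (g / 4)\<bar>)\<^sup>2 \<le> (\<bar>g / 4\<bar>)\<^sup>2"
      using abs_sin_x_le_abs_x[of "g / 4"] by (intro power_mono) auto
    then have "2 * (sin (g / 4))\<^sup>2 \<le> g\<^sup>2 / 8" by (simp add: power_divide)
    then show "k \<le> g\<^sup>2 / 8" using cos_double_sin[of "g / 4"] by (simp add: k_def)
  qed
  have d: "d = c * g + (c * e - s * k)"
  proof -
    have "t = 2 * (sin (h / 2) * cos (g / 2) + cos (h / 2) * sin (g / 2))"
      unfolding t_def add_divide_distrib sin_add by simp
    then show ?thesis by (simp add: d_def c_def e_def k_def s_def algebra_simps)
  qed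
  have ce: "\<bar>c * e\<bar> \<le> \<bar>g\<bar> * g\<^sup>2 / 24"
    using mult_mono[OF c1 e] by (simp add: abs_mult)
  have sk: "\<bar>s * k\<bar> \<le> g\<^sup>2 / 4"
    using mult_mono[OF s2 k(2)] k(1) by (simp add: abs_mult)
  have gg: "\<bar>g\<bar> * g\<^sup>2 \<le> \<gamma> * g\<^sup>2" using g by (intro mult_right_mono) auto
  have first: "p * s * d \<ge> p * s * c * g - \<gamma> * g\<^sup>2 / 4 - p * s\<^sup>2 * g\<^sup>2 / 8"
  proof -
    have "\<bar>p * (s * (c * e))\<bar> \<le> 3 * (2 * (\<gamma> * g\<^sup>2 / 24))"
      unfolding abs_mult[of p] abs_mult[of s] using p s2 ce gg
      by (intro mult_mono) (auto intro: order_trans)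
    moreover have "p * s\<^sup>2 * k \<le> p * s\<^sup>2 * (g\<^sup>2 / 8)"
      using p k by (intro mult_left_mono) auto
    moreover have "p * s * d = p * s * c * g + p * (s * (c * e)) - p * s\<^sup>2 * k"
      by (simp add: d algebra_simps power2_eq_square)
    ultimately show ?thesis by simp
  qed
  have W3: "W \<le> 3"
  proof -
    have "p * (p - 1) \<le> 3 * 2" using p by (intro mult_mono) auto
    then show ?thesis using W by simp
  qed
  have second: "W * d\<^sup>2 \<ge> W * g\<^sup>2 - p * (p - 1) / 8 * s\<^sup>2 * g\<^sup>2 - 7 / 4 * \<gamma> * g\<^sup>2"
  proof -
    define r where "r = c * e - s * k"
    have "\<bar>r\<bar> \<le> g\<^sup>2 * (7 / 24)"
    proof -
      have "\<bar>g\<bar> * g\<^sup>2 \<le> 1 * g\<^sup>2" using g1 by (intro mult_right_mono) auto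
      then show ?thesis unfolding r_def using ce sk by linarith
    qed
    then have "\<bar>c * g * r\<bar> \<le> \<gamma> * (g\<^sup>2 * (7 / 24))"
      unfolding abs_mult using c1 g
      by (intro mult_mono) (auto intro: order_trans[OF mult_left_le_one_le])
    then have "W * \<bar>c * g * r\<bar> \<le> 3 * (\<gamma> * (g\<^sup>2 * (7 / 24)))"
      using W W3 by (intro mult_mono) auto
    then have 1: "W * (2 * (c * g * r)) \<ge> - (7 / 4 * \<gamma> * g\<^sup>2)"
    proof -
      have "\<bar>W * (c * g * r)\<bar> \<le> 7 / 8 * \<gamma> * g\<^sup>2"
        using \<open>W * \<bar>c * g * r\<bar> \<le> _\<close> W by (simp add: abs_mult)
      then show ?thesis by linarith
    qed
    have "d = c * g + r" by (simp add: d r_def)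
    then have "d\<^sup>2 = c\<^sup>2 * g\<^sup>2 + 2 * (c * g * r) + r\<^sup>2"
      by (simp add: power2_eq_square algebra_simps)
    then have "W * d\<^sup>2 \<ge> W * (c\<^sup>2 * g\<^sup>2 + 2 * (c * g * r))"
      using W by (intro mult_left_mono) auto
    moreover have "W * (c\<^sup>2 * g\<^sup>2 + 2 * (c * g * r)) = W * g\<^sup>2 - W * (s\<^sup>2 * g\<^sup>2 / 4) + W * (2 * (c * g * r))"
      by (simp add: c2 algebra_simps)
    moreover have "W * (s\<^sup>2 * g\<^sup>2 / 4) \<le> p * (p - 1) / 2 * (s\<^sup>2 * g\<^sup>2 / 4)"
      using W by (intro mult_right_mono) auto
    moreover have "p * (p - 1) / 2 * (s\<^sup>2 * g\<^sup>2 / 4) = p * (p - 1) / 8 * s\<^sup>2 * g\<^sup>2"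
      by simp
    ultimately show ?thesis using 1 by linarith
  qed
  have "Y * (s\<^sup>2 + p * s * d + W * d\<^sup>2) \<le> \<bar>t\<bar> powr p"
  proof -
    have ts: "t / s - 1 = d / s" using s by (simp add: d_def field_simps)
    have "\<bar>s\<bar> powr p * (1 + p * (t / s - 1) + W * (t / s - 1)\<^sup>2) \<le> \<bar>s\<bar> powr p * \<bar>t / s\<bar> powr p"
      using conv by (intro mult_left_mono) auto
    also have "\<dots> = \<bar>t\<bar> powr p"
      using s by (simp add: powr_mult[symmetric] abs_divide)
    also have "\<bar>s\<bar> powr p * (1 + p * (t / s - 1) + W * (t / s - 1)\<^sup>2) = Y * (s\<^sup>2 + p * s * d + W * d\<^sup>2)"
      unfolding sp ts using s by (simp add: field_simps power2_eq_square)
    finally show ?thesis .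
  qed
  moreover have "Y * (s\<^sup>2 + p * s * c * g + (W - 2 * \<gamma>) * g\<^sup>2 - p\<^sup>2 / 8 * s\<^sup>2 * g\<^sup>2) \<le> Y * (s\<^sup>2 + p * s * d + W * d\<^sup>2)"
  proof (rule mult_left_mono)
    have "p\<^sup>2 / 8 * s\<^sup>2 * g\<^sup>2 = p * (p - 1) / 8 * s\<^sup>2 * g\<^sup>2 + p * s\<^sup>2 * g\<^sup>2 / 8"
      by (simp add: field_simps power2_eq_square)
    moreover have "(W - 2 * \<gamma>) * g\<^sup>2 = W * g\<^sup>2 - 2 * (\<gamma> * g\<^sup>2)"
      by (simp add: algebra_simps)
    moreover have "7 / 4 * \<gamma> * g\<^sup>2 = 7 / 4 * (\<gamma> * g\<^sup>2)" by simp
    ultimately show "s\<^sup>2 + p * s * c * g + (W - 2 * \<gamma>) * g\<^sup>2 - p\<^sup>2 / 8 * s\<^sup>2 * g\<^sup>2 \<le> s\<^sup>2 + p * s * d + W * d\<^sup>2"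
      using first second by linarith
  qed (use Y in simp)
  ultimately show ?thesis
    unfolding sp Y_def[symmetric] c_def[symmetric] by (simp add: algebra_simps)
qed

section \<open>Moments of the chord length\<close>

lemma norm_power_minus_one_le:
  assumes "norm (\<omega>::complex) = 1"
  shows "norm (\<omega> ^ n - 1) \<le> n * norm (\<omega> - 1)"
  using norm_power_diff[of \<omega> 1 n] assms by simp

lemma one_minus_Re_eq:
  assumes "norm (\<omega>::complex) = 1"
  shows "1 - Re \<omega> = (norm (\<omega> - 1))\<^sup>2 / 2"
proof -
  have "(Re \<omega>)\<^sup>2 + (Im \<omega>)\<^sup>2 = 1" using assms by (simp add: cmod_def)
  then show ?thesis unfolding cmod_power2 by (simp add: power2_eq_square algebra_simps)
qed

lemma norm_cis_minus_one: "cmod (cis h - 1) = \<bar>2 * sin (h / 2)\<bar>"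
proof -
  have "(cmod (cis h - 1))\<^sup>2 = (2 * sin (h / 2))\<^sup>2"
    using one_minus_Re_eq[of "cis h"] cos_double_sin[of "h / 2"] by (simp add: power_mult_distrib)
  then show ?thesis by (metis power2_eq_iff_nonneg abs_ge_zero norm_ge_zero power2_abs)
qed

text \<open>
  The last bound is what makes the chord moments finite: \<open>1 - Re (\<omega> ^ n)\<close> vanishes to second order
  at \<open>\<omega> = 1\<close>.
\<close>

lemma one_minus_Re_power_bounds:
  assumes "norm (\<omega>::complex) = 1"
  shows "0 \<le> 1 - Re (\<omega> ^ n)" "1 - Re (\<omega> ^ n) \<le> 2" "1 - Re (\<omega> ^ n) \<le> (real n)\<^sup>2 / 2 * (norm (\<omega> - 1))\<^sup>2"
proof -
  have n: "norm (\<omega> ^ n) = 1" using assms by (simp add: norm_power)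
  show "0 \<le> 1 - Re (\<omega> ^ n)" "1 - Re (\<omega> ^ n) \<le> 2"
    using abs_Re_le_cmod[of "\<omega> ^ n"] n by linarith+
  have "(norm (\<omega> ^ n - 1))\<^sup>2 \<le> (n * norm (\<omega> - 1))\<^sup>2"
    by (intro power_mono norm_power_minus_one_le assms) simp
  then show "1 - Re (\<omega> ^ n) \<le> (real n)\<^sup>2 / 2 * (norm (\<omega> - 1))\<^sup>2"
    using one_minus_Re_eq[OF n] by (simp add: power_mult_distrib)
qed

lemma powr_minus_two_mult_square: "0 \<le> (x::real) \<Longrightarrow> x powr (a - 2) * x\<^sup>2 = x powr a"
proof (cases "x = 0")
  case False
  assume "0 \<le> x"
  then have "x powr (a - 2) * x\<^sup>2 = x powr (a - 2) * x powr 2" using False by simp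
  also have "\<dots> = x powr a" by (simp flip: powr_add)
  finally show ?thesis .
qed simp

lemma nn_integral_powr_finite:
  fixes a :: real
  assumes a: "-1 < a"
  shows "(\<integral>\<^sup>+x. ennreal (x powr a * indicator {0..2 * pi} x) \<partial>lborel) < \<infinity>"
proof -
  have "((\<lambda>x. x powr a) has_integral ((2*pi) powr (a+1) / (a+1) - 0 powr (a+1) / (a+1))) {0..2*pi}"
  proof (rule fundamental_theorem_of_calculus_interior)
    show "continuous_on {0..2 * pi} (\<lambda>x. x powr (a + 1) / (a + 1))"
      using a by (intro continuous_intros continuous_on_powr') auto
    fix x assume "x \<in> {0<..<2 * pi}"
    then have "((\<lambda>x. x powr (a + 1) / (a + 1)) has_real_derivative (a + 1) * x powr (a + 1 - 1) / (a + 1)) (at x)"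
      by (intro DERIV_cdivide has_real_derivative_powr) auto
    then show "((\<lambda>x. x powr (a + 1) / (a + 1)) has_vector_derivative x powr a) (at x)"
      using a by (simp add: has_real_derivative_iff_has_vector_derivative)
  qed simp
  then have "((\<lambda>x. if x \<in> {0..2*pi} then x powr a else 0) has_integral ((2*pi) powr (a+1) / (a+1) - 0 powr (a+1) / (a+1))) UNIV"
    by (subst has_integral_restrict_UNIV)
  then have "((\<lambda>x. x powr a * indicator {0..2 * pi} x) has_integral ((2*pi) powr (a+1) / (a+1) - 0 powr (a+1) / (a+1))) UNIV"
    by (rule has_integral_eq[rotated]) (simp add: indicator_def)
  from nn_integral_has_integral_lborel[OF _ _ this] show ?thesis by simp
qed

lemma chord_lower_bound:
  fixes \<theta> :: real
  assumes "0 \<le> \<theta>" "\<theta> \<le> pi"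
  shows "\<theta> / 2 \<le> \<bar>2 * sin (\<theta> / 2)\<bar>"
proof -
  define x where "x = \<theta> / 2"
  have x: "0 \<le> x" "x \<le> 1.6" using assms pi_less_4 pi_approx by (auto simp: x_def)
  have "x\<^sup>2 \<le> 1.6\<^sup>2" using x by (intro power_mono) auto
  then have "x * x\<^sup>2 \<le> x * 3" using x by (intro mult_left_mono) (auto simp: power2_eq_square)
  then have "x / 2 \<le> x - x ^ 3 / 6" by (simp add: power3_eq_cube power2_eq_square)
  also have "\<dots> \<le> sin x" using x by (intro sin_ge_cubic)
  finally show ?thesis by (simp add: x_def)
qed

text \<open>
  In the angle \<open>\<theta>\<close> the chord is at least \<open>\<theta> / 2\<close> on the first half of the circle and at least
  \<open>(2 * pi - \<theta>) / 2\<close> on the second half.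
\<close>

lemma integrable_chord_powr:
  assumes a: "-1 < a"
  shows "integrable arclength (\<lambda>\<omega>. norm (\<omega> - 1) powr a)"
proof (rule integrableI_nonneg)
  show m: "(\<lambda>\<omega>. norm (\<omega> - 1) powr a) \<in> borel_measurable arclength"
    by (intro borel_measurable_arclengthI) measurable
  have bound: "\<bar>2 * sin (\<theta> / 2)\<bar> powr a \<le> 2 powr \<bar>a\<bar> + (2 powr \<bar>a\<bar> * \<theta> powr a + 2 powr \<bar>a\<bar> * (2*pi - \<theta>) powr a)"
    if th: "0 \<le> \<theta>" "\<theta> < 2 * pi" for \<theta> :: real
  proof (cases "a \<ge> 0 \<or> \<theta> = 0")
    case True
    then show ?thesis
    proof
      assume a0: "a \<ge> 0"
      have "\<bar>2 * sin (\<theta> / 2)\<bar> \<le> 2" using abs_sin_le_one[of "\<theta>/2"] by (simp add: abs_mult)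
      then have "\<bar>2 * sin (\<theta> / 2)\<bar> powr a \<le> 2 powr a"
        using a0 by (intro powr_mono2) auto
      then show ?thesis using a0 by (simp add: add.assoc[symmetric] add_increasing2)
    qed (auto intro!: add_nonneg_nonneg)
  next
    case False
    then have a0: "a < 0" "0 < \<theta>" using th by auto
    have key: "(x / 2) powr a = 2 powr \<bar>a\<bar> * x powr a" if "x > 0" for x :: real
      using that a0 by (simp add: powr_divide powr_minus field_simps)
    show ?thesis
    proof (cases "\<theta> \<le> pi")
      case True
      have "\<bar>2 * sin (\<theta> / 2)\<bar> powr a \<le> (\<theta> / 2) powr a"
        using chord_lower_bound[of \<theta>] True a0 by (intro powr_mono2') auto
      then show ?thesis using key[of \<theta>] a0 by (simp add: add_increasing add_increasing2)
    next
      case False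
      have "sin ((2 * pi - \<theta>) / 2) = sin (\<theta> / 2)"
        by (simp add: diff_divide_distrib sin_diff)
      then have "\<bar>2 * sin (\<theta> / 2)\<bar> powr a \<le> ((2 * pi - \<theta>) / 2) powr a"
        using chord_lower_bound[of "2 * pi - \<theta>"] False a0 th by (intro powr_mono2') auto
      then show ?thesis using key[of "2 * pi - \<theta>"] a0 th by (simp add: add_increasing add_increasing2)
    qed
  qed
  let ?c = "2 powr \<bar>a\<bar>"
  let ?G = "\<lambda>x::real. ennreal (x powr a * indicator {0..2 * pi} x)"
  have refl: "(\<integral>\<^sup>+x. ?G (2 * pi - x) \<partial>lborel) = (\<integral>\<^sup>+x. ?G x \<partial>lborel)"
    using nn_integral_real_affine[of ?G "-1" "2*pi"] by (simp add: algebra_simps)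
  have "(\<integral>\<^sup>+\<omega>. ennreal (norm (\<omega> - 1) powr a) \<partial>arclength) =
    (\<integral>\<^sup>+\<theta>. ennreal (\<bar>2 * sin (\<theta> / 2)\<bar> powr a) * indicator {0..<2 * pi} \<theta> \<partial>lborel)"
    using m by (subst nn_integral_arclength) (auto simp: norm_cis_minus_one)
  also have "\<dots> \<le> (\<integral>\<^sup>+\<theta>. ennreal ?c * indicator {0..2*pi} \<theta> + (?c * ?G \<theta> + ?c * ?G (2*pi - \<theta>)) \<partial>lborel)"
  proof (rule nn_integral_mono)
    fix \<theta> :: real
    show "ennreal (\<bar>2 * sin (\<theta> / 2)\<bar> powr a) * indicator {0..<2 * pi} \<theta> \<le> ennreal ?c * indicator {0..2*pi} \<theta> + (?c * ?G \<theta> + ?c * ?G (2*pi - \<theta>))"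
    proof (cases "0 \<le> \<theta> \<and> \<theta> < 2 * pi")
      case True
      then have i: "indicator {0..<2*pi} \<theta> = (1::ennreal)" "indicator {0..2*pi} \<theta> = (1::ennreal)"
        "indicator {0..2*pi} \<theta> = (1::real)" "indicator {0..2*pi} (2 * pi - \<theta>) = (1::real)"
        by auto
      show ?thesis
        using bound[of \<theta>] True
        by (simp only: i mult_1_right ennreal_mult'[symmetric] ennreal_plus[symmetric] powr_ge_zero
             add_nonneg_nonneg mult_nonneg_nonneg ennreal_leI)
    qed (auto simp: indicator_def)
  qed
  also have "\<dots> = ?c * (2 * pi) + (?c * (\<integral>\<^sup>+x. ?G x \<partial>lborel) + ?c * (\<integral>\<^sup>+x. ?G (2 * pi - x) \<partial>lborel))"
    by (simp add: nn_integral_add nn_integral_cmult nn_integral_cmult_indicator ennreal_mult)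
  also have "\<dots> < \<infinity>"
    unfolding refl using nn_integral_powr_finite[OF a]
    by (simp add: ennreal_mult_eq_top_iff ennreal_add_less_top less_top[symmetric])
  finally show "(\<integral>\<^sup>+\<omega>. ennreal (norm (\<omega> - 1) powr a) \<partial>arclength) < \<infinity>" .
qed simp

lemma integral_arclength_eq_HK:
  fixes f :: "complex \<Rightarrow> real"
  assumes "integrable arclength f"
  shows "(\<integral>x. f x \<partial>arclength) = integral {0..2*pi} (\<lambda>\<theta>. f (cis \<theta>))"
proof -
  have f: "f \<in> borel_measurable (restrict_space borel (sphere 0 1))"
    using assms measurable_cong_sets[OF sets_arclength refl] by blast
  have 1: "integrable (restrict_space lborel {0..<2 * pi}) (\<lambda>\<theta>. f (cis \<theta>))"
    using assms f unfolding arclength_def by (simp add: integrable_distr_eq[OF cis_measurable_circle])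
  then have 2: "set_integrable lborel {0..<2 * pi} (\<lambda>\<theta>. f (cis \<theta>))"
    by (simp add: set_integrable_def integrable_restrict_space)
  have "(\<integral>x. f x \<partial>arclength) = (\<integral>\<theta>. f (cis \<theta>) \<partial>restrict_space lborel {0..<2 * pi})"
    unfolding arclength_def by (rule integral_distr[OF cis_measurable_circle f])
  also have "\<dots> = (LINT \<theta>:{0..<2*pi}|lborel. f (cis \<theta>))"
    by (simp add: set_lebesgue_integral_def integral_restrict_space)
  also have "\<dots> = integral {0..<2*pi} (\<lambda>\<theta>. f (cis \<theta>))"
    by (rule set_borel_integral_eq_integral(2)[OF 2])
  also have "\<dots> = integral {0..2*pi} (\<lambda>\<theta>. f (cis \<theta>))"
    by (rule integral_spike_set) (auto intro!: negligible_subset[OF negligible_sing[of "2*pi"]])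
  finally show ?thesis .
qed

text \<open>
  The Fourier multiplier of the quadratic form with kernel \<open>norm (\<omega> - 1) powr a\<close>. For \<open>a = p - 4\<close> it
  is comparable to \<open>n powr (3 - p)\<close>, the multiplier of the seminorm of order \<open>(3 - p) / 2\<close>.
\<close>

definition chord_moment :: "real \<Rightarrow> nat \<Rightarrow> real" where
  "chord_moment a n = (\<integral>\<omega>. norm (\<omega> - 1) powr a * (1 - Re (\<omega> ^ n)) \<partial>arclength)"

lemma integrable_chord_bounded:
  fixes f :: "complex \<Rightarrow> real"
  assumes "-1 < a" "f \<in> borel_measurable borel"
    "\<And>\<omega>. norm \<omega> = 1 \<Longrightarrow> \<bar>f \<omega>\<bar> \<le> C * norm (\<omega> - 1) powr a"
  shows "integrable arclength f"
  by (rule Bochner_Integration.integrable_bound[OF integrable_mult_right[OF integrable_chord_powr[OF assms(1)], of C]])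
     (use assms in \<open>auto intro!: borel_measurable_arclengthI order_trans[OF assms(3)]\<close>)

lemma integrable_chord_moment:
  assumes "-3 < a"
  shows "integrable arclength (\<lambda>\<omega>. norm (\<omega> - 1) powr a * (1 - Re (\<omega> ^ n)))"
proof (rule integrable_chord_bounded[of "a + 2" _ "(real n)\<^sup>2 / 2"])
  fix \<omega> :: complex assume w: "norm \<omega> = 1"
  have "norm (\<omega> - 1) powr a * (1 - Re (\<omega> ^ n)) \<le> norm (\<omega> - 1) powr a * ((real n)\<^sup>2 / 2 * (norm (\<omega> - 1))\<^sup>2)"
    by (intro mult_left_mono one_minus_Re_power_bounds w) simp
  also have "\<dots> = (real n)\<^sup>2 / 2 * norm (\<omega> - 1) powr (a + 2)"
    using powr_minus_two_mult_square[of "norm (\<omega> - 1)" "a + 2"] by simp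
  finally show "\<bar>norm (\<omega> - 1) powr a * (1 - Re (\<omega> ^ n))\<bar> \<le> (real n)\<^sup>2 / 2 * norm (\<omega> - 1) powr (a + 2)"
    using one_minus_Re_power_bounds(1)[OF w, of n] by (simp add: abs_mult)
qed (use assms in \<open>simp, measurable\<close>)

text \<open>
  The Dirichlet kernel splits off the factor \<open>2 * sin (h / 2)\<close>. With it, the primitive used in the next
  lemma is continuous on the closed interval even for a negative exponent.
\<close>

lemma sin_nat_mult_eq_sum:
  "sin (real n * h) = 2 * sin (h / 2) * (\<Sum>k<n. cos ((real k + 1 / 2) * h))"
proof (induction n)
  case (Suc n)
  have "sin (real (Suc n) * h) - sin (real n * h) = 2 * sin (h / 2) * cos ((real n + 1 / 2) * h)"
    by (simp add: sin_diff_sin) (simp add: algebra_simps add_divide_distrib)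
  with Suc show ?case by (simp add: algebra_simps)
qed simp

text \<open>
  In the angle \<open>h\<close> the integrand is the derivative of \<open>S powr b * sin (n * h)\<close>, which vanishes at
  both ends of the period. For negative \<open>b\<close> this uses \<open>b > -1\<close>.
\<close>

lemma chord_integration_by_parts:
  fixes b :: real and n :: nat
  assumes b: "-1 < b"
  defines "m \<equiv> \<lambda>\<omega>::complex. n * (norm (\<omega> - 1) powr b * Re (\<omega> ^ n)) + b * (norm (\<omega> - 1) powr (b - 2) * (Im (\<omega> ^ n) * Im \<omega>))"
  shows "integrable arclength (\<lambda>\<omega>. norm (\<omega> - 1) powr b * Re (\<omega> ^ n))"
    and "integrable arclength (\<lambda>\<omega>. norm (\<omega> - 1) powr (b - 2) * (Im (\<omega> ^ n) * Im \<omega>))"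
    and "(\<integral>\<omega>. m \<omega> \<partial>arclength) = 0"
proof -
  show i1: "integrable arclength (\<lambda>\<omega>. norm (\<omega> - 1) powr b * Re (\<omega> ^ n))"
  proof (rule integrable_chord_bounded[of b _ 1])
    fix \<omega> :: complex assume w: "norm \<omega> = 1"
    then have "\<bar>Re (\<omega> ^ n)\<bar> \<le> 1" using abs_Re_le_cmod[of "\<omega> ^ n"] by (simp add: norm_power)
    then have "norm (\<omega> - 1) powr b * \<bar>Re (\<omega> ^ n)\<bar> \<le> norm (\<omega> - 1) powr b * 1"
      by (intro mult_left_mono) auto
    then show "\<bar>norm (\<omega> - 1) powr b * Re (\<omega> ^ n)\<bar> \<le> 1 * norm (\<omega> - 1) powr b"
      by (simp add: abs_mult)
  qed (use b in measurable)
  show i2: "integrable arclength (\<lambda>\<omega>. norm (\<omega> - 1) powr (b - 2) * (Im (\<omega> ^ n) * Im \<omega>))"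
  proof (rule integrable_chord_bounded[of b _ n])
    fix \<omega> :: complex assume w: "norm \<omega> = 1"
    have "\<bar>Im \<omega>\<bar> \<le> norm (\<omega> - 1)" using abs_Im_le_cmod[of "\<omega> - 1"] by simp
    moreover have "\<bar>Im (\<omega> ^ n)\<bar> \<le> n * norm (\<omega> - 1)"
      using abs_Im_le_cmod[of "\<omega> ^ n - 1"] norm_power_minus_one_le[OF w, of n] by simp
    ultimately have "\<bar>Im (\<omega> ^ n)\<bar> * \<bar>Im \<omega>\<bar> \<le> (n * norm (\<omega> - 1)) * norm (\<omega> - 1)"
      by (intro mult_mono) auto
    then have "norm (\<omega> - 1) powr (b - 2) * (\<bar>Im (\<omega> ^ n)\<bar> * \<bar>Im \<omega>\<bar>) \<le>
      norm (\<omega> - 1) powr (b - 2) * (n * (norm (\<omega> - 1))\<^sup>2)"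
      by (intro mult_left_mono) (auto simp: power2_eq_square mult.assoc)
    also have "\<dots> = n * (norm (\<omega> - 1) powr (b - 2) * (norm (\<omega> - 1))\<^sup>2)"
      by simp
    also have "\<dots> = n * norm (\<omega> - 1) powr b"
      by (subst powr_minus_two_mult_square) auto
    finally show "\<bar>norm (\<omega> - 1) powr (b - 2) * (Im (\<omega> ^ n) * Im \<omega>)\<bar> \<le> n * norm (\<omega> - 1) powr b"
      by (simp add: abs_mult)
  qed (use b in measurable)
  have im: "integrable arclength m" unfolding m_def using i1 i2 by simp
  define \<Psi> where "\<Psi> = (\<lambda>h. \<bar>2 * sin (h / 2)\<bar> powr (b + 1) * (\<Sum>k<n. cos ((real k + 1 / 2) * h)))"
  have "((\<lambda>\<theta>. m (cis \<theta>)) has_integral (\<Psi> (2 * pi) - \<Psi> 0)) {0..2 * pi}"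
  proof (rule fundamental_theorem_of_calculus_interior)
    show "continuous_on {0..2 * pi} \<Psi>"
      unfolding \<Psi>_def using b by (intro continuous_intros continuous_on_powr') auto
    fix x :: real assume x: "x \<in> {0<..<2 * pi}"
    have pos: "sin (y / 2) > 0" if "y \<in> {0<..<2*pi}" for y :: real
      using that by (intro sin_gt_zero) auto
    let ?\<phi> = "\<lambda>h. (2 * sin (h / 2)) powr b * sin (real n * h)"
    let ?s = "2 * sin (x / 2)"
    have s: "?s > 0" using pos[OF x] by simp
    have "(?\<phi> has_real_derivative
      ?s powr b * (cos (real n * x) * real n) + b * ?s powr (b - 1) * cos (x / 2) * sin (real n * x)) (at x)"
      using s by (auto intro!: derivative_eq_intros simp: powr_diff field_simps)
    also have "?s powr b * (cos (real n * x) * real n) + b * ?s powr (b - 1) * cos (x / 2) * sin (real n * x) = m (cis x)"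
    proof -
      have "Im (cis x) = ?s * cos (x / 2)" using sin_double[of "x / 2"] by simp
      moreover have "?s powr (b - 2) * ?s = ?s powr (b - 1)"
        using powr_mult_base[of ?s "b - 2"] s by (simp add: mult.commute)
      moreover have "?s powr (b - 2) * (sin (real n * x) * (?s * cos (x / 2))) = (?s powr (b - 2) * ?s) * cos (x / 2) * sin (real n * x)"
        by (simp only: mult_ac)
      ultimately have "?s powr (b - 2) * (sin (real n * x) * Im (cis x)) = ?s powr (b - 1) * cos (x / 2) * sin (real n * x)"
        by (simp only:)
      moreover have "m (cis x) = n * (?s powr b * cos (real n * x)) + b * (?s powr (b - 2) * (sin (real n * x) * Im (cis x)))"
        using s by (simp add: m_def norm_cis_minus_one Complex.DeMoivre)
      ultimately show ?thesis by (simp only: mult_ac)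
    qed
    finally have "(?\<phi> has_vector_derivative m (cis x)) (at x)"
      by (simp add: has_real_derivative_iff_has_vector_derivative)
    then show "(\<Psi> has_vector_derivative m (cis x)) (at x)"
    proof (rule has_vector_derivative_transform_within_open[where S = "{0<..<2*pi}"])
      fix y :: real assume y: "y \<in> {0<..<2*pi}"
      have "(2 * sin (y / 2)) powr b * (2 * sin (y / 2)) = (2 * sin (y / 2)) powr (b + 1)"
        using powr_mult_base[of "2 * sin (y / 2)" b] pos[OF y] by (simp add: mult.commute add.commute)
      then show "?\<phi> y = \<Psi> y"
        using pos[OF y] by (simp add: \<Psi>_def sin_nat_mult_eq_sum mult.assoc[symmetric])
    qed (use x in auto)
  qed simp
  moreover have "\<Psi> (2 * pi) - \<Psi> 0 = 0" using b by (simp add: \<Psi>_def)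
  ultimately have "integral {0..2*pi} (\<lambda>\<theta>. m (cis \<theta>)) = 0"
    by (simp add: integral_unique)
  then show "(\<integral>\<omega>. m \<omega> \<partial>arclength) = 0"
    by (simp add: integral_arclength_eq_HK[OF im])
qed

section \<open>Coercivity of the second variation\<close>

text \<open>
  Second and central differences of the moments of exponent \<open>p - 4\<close> are integrals against the kernel
  \<open>S powr (p - 2)\<close> and against \<open>sin (n * h) * sin h\<close>, because \<open>S\<^sup>2 = 2 - 2 * cos h\<close>. These are the two
  integrals that integration by parts relates.
\<close>

lemma chord_moment_relations:
  fixes p :: real and n :: nat
  assumes p: "1 < p"
  shows "chord_moment (p - 4) (Suc (Suc n)) + chord_moment (p - 4) n - 2 * chord_moment (p - 4) (Suc n)
      = (\<integral>\<omega>. norm (\<omega> - 1) powr (p - 2) * Re (\<omega> ^ Suc n) \<partial>arclength)"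
    and "chord_moment (p - 4) (Suc (Suc n)) - chord_moment (p - 4) n
      = 2 * (\<integral>\<omega>. norm (\<omega> - 1) powr (p - 4) * (Im (\<omega> ^ Suc n) * Im \<omega>) \<partial>arclength)"
    and "2 * chord_moment (p - 4) 1 = (\<integral>\<omega>. norm (\<omega> - 1) powr (p - 2) \<partial>arclength)"
proof -
  let ?S = "\<lambda>\<omega>::complex. norm (\<omega> - 1)"
  have int: "integrable arclength (\<lambda>\<omega>. ?S \<omega> powr (p - 4) * (1 - Re (\<omega> ^ k)))" for k
    using p by (intro integrable_chord_moment) simp
  have red: "?S \<omega> powr (p - 4) * (?S \<omega>)\<^sup>2 = ?S \<omega> powr (p - 2)" for \<omega>
    using powr_minus_two_mult_square[of "?S \<omega>" "p - 2"] by simp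
  have pw: "\<omega> * (\<omega> * \<omega> ^ n) = \<omega> ^ Suc n * \<omega>" "\<omega> ^ n = \<omega> ^ Suc n * cnj \<omega>" if "norm \<omega> = 1" for \<omega> :: complex
  proof -
    have "\<omega> * cnj \<omega> = 1" using that by (simp add: complex_norm_square[symmetric])
    then show "\<omega> ^ n = \<omega> ^ Suc n * cnj \<omega>" by simp
  qed simp
  have "chord_moment (p - 4) (Suc (Suc n)) + chord_moment (p - 4) n - 2 * chord_moment (p - 4) (Suc n) =
    (\<integral>\<omega>. ?S \<omega> powr (p - 4) * (1 - Re (\<omega> ^ Suc (Suc n))) + ?S \<omega> powr (p - 4) * (1 - Re (\<omega> ^ n))
       - 2 * (?S \<omega> powr (p - 4) * (1 - Re (\<omega> ^ Suc n))) \<partial>arclength)"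
    unfolding chord_moment_def
    by (simp only: Bochner_Integration.integral_add Bochner_Integration.integral_diff
       Bochner_Integration.integrable_add integrable_mult_right Bochner_Integration.integral_mult_right int)
  also have "\<dots> = (\<integral>\<omega>. ?S \<omega> powr (p - 2) * Re (\<omega> ^ Suc n) \<partial>arclength)"
  proof (intro Bochner_Integration.integral_cong refl)
    fix \<omega> :: complex assume "\<omega> \<in> space arclength"
    then have w: "norm \<omega> = 1" by simp
    have 1: "(?S \<omega>)\<^sup>2 = 2 - 2 * Re \<omega>" using one_minus_Re_eq[OF w] by simp
    have 2: "Re (z * \<omega>) + Re (z * cnj \<omega>) = 2 * Re \<omega> * Re z" for z by simp
    have gen: "(1 - A) + (1 - B) - 2 * (1 - C) = (2 - 2 * c) * C" if "A + B = 2 * c * C" for A B c C :: real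
      using that by (simp add: algebra_simps)
    have "Re (\<omega> ^ Suc (Suc n)) + Re (\<omega> ^ n) = 2 * Re \<omega> * Re (\<omega> ^ Suc n)"
      using 2[of "\<omega> ^ Suc n"] pw[OF w] by (metis power_Suc mult.assoc)
    then have "(1 - Re (\<omega> ^ Suc (Suc n))) + (1 - Re (\<omega> ^ n)) - 2 * (1 - Re (\<omega> ^ Suc n)) = (?S \<omega>)\<^sup>2 * Re (\<omega> ^ Suc n)"
      unfolding 1 by (rule gen)
    then have "?S \<omega> powr (p - 4) * ((1 - Re (\<omega> ^ Suc (Suc n))) + (1 - Re (\<omega> ^ n)) - 2 * (1 - Re (\<omega> ^ Suc n)))
      = (?S \<omega> powr (p - 4) * (?S \<omega>)\<^sup>2) * Re (\<omega> ^ Suc n)"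
      by (simp only: mult.assoc)
    then show "?S \<omega> powr (p - 4) * (1 - Re (\<omega> ^ Suc (Suc n))) + ?S \<omega> powr (p - 4) * (1 - Re (\<omega> ^ n))
       - 2 * (?S \<omega> powr (p - 4) * (1 - Re (\<omega> ^ Suc n))) = ?S \<omega> powr (p - 2) * Re (\<omega> ^ Suc n)"
      unfolding red by (simp only: algebra_simps)
  qed
  finally show "chord_moment (p - 4) (Suc (Suc n)) + chord_moment (p - 4) n - 2 * chord_moment (p - 4) (Suc n)
      = (\<integral>\<omega>. ?S \<omega> powr (p - 2) * Re (\<omega> ^ Suc n) \<partial>arclength)" .
  have "chord_moment (p - 4) (Suc (Suc n)) - chord_moment (p - 4) n =
    (\<integral>\<omega>. ?S \<omega> powr (p - 4) * (1 - Re (\<omega> ^ Suc (Suc n))) - ?S \<omega> powr (p - 4) * (1 - Re (\<omega> ^ n)) \<partial>arclength)"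
    unfolding chord_moment_def by (simp only: Bochner_Integration.integral_diff int)
  also have "\<dots> = (\<integral>\<omega>. 2 * (?S \<omega> powr (p - 4) * (Im (\<omega> ^ Suc n) * Im \<omega>)) \<partial>arclength)"
  proof (intro Bochner_Integration.integral_cong refl)
    fix \<omega> :: complex assume "\<omega> \<in> space arclength"
    then have w: "norm \<omega> = 1" by simp
    have 2: "Re (z * cnj \<omega>) - Re (z * \<omega>) = 2 * (Im z * Im \<omega>)" for z by simp
    have *: "Re (\<omega> ^ n) - Re (\<omega> ^ Suc (Suc n)) = 2 * (Im (\<omega> ^ Suc n) * Im \<omega>)"
      using 2[of "\<omega> ^ Suc n"] pw[OF w] by (metis power_Suc mult.assoc)
    have "?S \<omega> powr (p - 4) * (1 - Re (\<omega> ^ Suc (Suc n))) - ?S \<omega> powr (p - 4) * (1 - Re (\<omega> ^ n))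
      = ?S \<omega> powr (p - 4) * (Re (\<omega> ^ n) - Re (\<omega> ^ Suc (Suc n)))"
      by (simp only: algebra_simps)
    then show "?S \<omega> powr (p - 4) * (1 - Re (\<omega> ^ Suc (Suc n))) - ?S \<omega> powr (p - 4) * (1 - Re (\<omega> ^ n))
      = 2 * (?S \<omega> powr (p - 4) * (Im (\<omega> ^ Suc n) * Im \<omega>))"
      unfolding * by (simp only: mult_ac)
  qed
  finally show "chord_moment (p - 4) (Suc (Suc n)) - chord_moment (p - 4) n
      = 2 * (\<integral>\<omega>. ?S \<omega> powr (p - 4) * (Im (\<omega> ^ Suc n) * Im \<omega>) \<partial>arclength)"
    by simp
  have "2 * chord_moment (p - 4) 1 = (\<integral>\<omega>. 2 * (?S \<omega> powr (p - 4) * (1 - Re (\<omega> ^ 1))) \<partial>arclength)"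
    by (simp add: chord_moment_def)
  also have "\<dots> = (\<integral>\<omega>. ?S \<omega> powr (p - 2) \<partial>arclength)"
  proof (intro Bochner_Integration.integral_cong refl)
    fix \<omega> :: complex assume "\<omega> \<in> space arclength"
    then have e: "2 * (1 - Re \<omega>) = (?S \<omega>)\<^sup>2" using one_minus_Re_eq[of \<omega>] by simp
    have "2 * (?S \<omega> powr (p - 4) * (1 - Re (\<omega> ^ 1))) = ?S \<omega> powr (p - 4) * (2 * (1 - Re \<omega>))"
      by simp
    then show "2 * (?S \<omega> powr (p - 4) * (1 - Re (\<omega> ^ 1))) = ?S \<omega> powr (p - 2)"
      unfolding e red .
  qed
  finally show "2 * chord_moment (p - 4) 1 = (\<integral>\<omega>. ?S \<omega> powr (p - 2) \<partial>arclength)" .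
qed

lemma chord_moment_0 [simp]: "chord_moment a 0 = 0"
  by (simp add: chord_moment_def)

text \<open>
  A two-term recurrence for the increments. It determines all moments up to a common factor.
\<close>

lemma chord_moment_increment_recurrence:
  fixes p :: real and n :: nat
  assumes p: "1 < p"
  defines "a \<equiv> \<lambda>n. chord_moment (p - 4) (Suc n) - chord_moment (p - 4) n"
  shows "(2 * Suc n + (p - 2)) * a (Suc n) = (2 * Suc n - (p - 2)) * a n"
proof -
  have b: "-1 < p - 2" using p by simp
  have "Suc n * (\<integral>\<omega>. norm (\<omega> - 1) powr (p - 2) * Re (\<omega> ^ Suc n) \<partial>arclength)
    + (p - 2) * (\<integral>\<omega>. norm (\<omega> - 1) powr (p - 4) * (Im (\<omega> ^ Suc n) * Im \<omega>) \<partial>arclength) = 0"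
    using chord_integration_by_parts[OF b, of "Suc n"]
    by (simp only: Bochner_Integration.integral_add integrable_mult_right Bochner_Integration.integral_mult_right) simp
  then have "Suc n * (a (Suc n) - a n) + (p - 2) * ((a (Suc n) + a n) / 2) = 0"
    using chord_moment_relations(1,2)[OF p, of n] by (simp add: a_def)
  then show ?thesis by (simp add: field_simps)
qed

text \<open>
  Everything about the multipliers that follows from the recurrence alone. In the second claim the
  right-hand side is the multiplier of the second variation at \<open>n + 1\<close>. It vanishes for \<open>n = 0\<close>, and the
  step to \<open>n + 2\<close> adds \<open>p * (p - 1) * a (n + 1) * (1 + p * (p - 2) / (u * v))\<close>, where \<open>u * v \<ge> 6\<close>
  whenever \<open>p - 2\<close> is negative, while \<open>p * (p - 2) \<ge> -1\<close>. Hence the constant \<open>5 / 6\<close>.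
\<close>

lemma chord_moment_coercivity_algebra:
  fixes p :: real and a :: "nat \<Rightarrow> real"
  assumes p: "1 < p" "p < 3" and a0: "a 0 > 0"
    and rec: "\<And>n. (2 * Suc n + (p - 2)) * a (Suc n) = (2 * Suc n - (p - 2)) * a n"
  shows "a 0 / (2 * real n + 1) \<le> a n"
    and "5 / 6 * (p * (p - 1)) * (\<Sum>k\<in>{1..n}. a k) \<le>
      p * (p - 1) * (\<Sum>k\<le>n. a k) - p\<^sup>2 / 4 * (2 * a 0 + a n - a (Suc n))"
    and "a 0 \<le> 3 * a 1"
proof -
  have low: "a 0 / (2 * real n + 1) \<le> a n" for n
  proof (induction n)
    case (Suc n)
    have "0 \<le> a 0 / (2 * real n + 1)" using a0 by simp
    with Suc have an: "a n \<ge> 0" by linarith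
    have "(2 * real n + 1) * (2 * Suc n + (p - 2)) \<le> (2 * real n + 3) * (2 * Suc n - (p - 2))"
    proof -
      have "(2 * real n + 3) * (2 * Suc n - (p - 2)) - (2 * real n + 1) * (2 * Suc n + (p - 2)) = (4 * real n + 4) * (3 - p)"
        by (simp add: algebra_simps)
      moreover have "(4 * real n + 4) * (3 - p) \<ge> 0" using p by simp
      ultimately show ?thesis by linarith
    qed
    then have "(2 * real n + 1) * (2 * Suc n + (p - 2)) * a n \<le> (2 * real n + 3) * (2 * Suc n - (p - 2)) * a n"
      using an by (intro mult_right_mono)
    also have "\<dots> = (2 * Suc n + (p - 2)) * ((2 * real n + 3) * a (Suc n))"
      using rec[of n] by (simp add: mult_ac)
    finally have "(2 * Suc n + (p - 2)) * ((2 * real n + 1) * a n) \<le> (2 * Suc n + (p - 2)) * ((2 * real n + 3) * a (Suc n))"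
      by (simp add: mult_ac)
    then have "(2 * real n + 1) * a n \<le> (2 * real n + 3) * a (Suc n)"
      using p by (simp add: mult_le_cancel_left)
    moreover have "a 0 \<le> (2 * real n + 1) * a n" using Suc by (simp add: field_simps)
    ultimately show ?case by (simp add: field_simps)
  qed simp
  then show "a 0 / (2 * real n + 1) \<le> a n" .
  show "a 0 \<le> 3 * a 1" using low[of 1] by simp
  have pos: "a n > 0" for n
  proof -
    have "0 < a 0 / (2 * real n + 1)" using a0 by simp
    with low[of n] show ?thesis by linarith
  qed
  show "5 / 6 * (p * (p - 1)) * (\<Sum>k\<in>{1..n}. a k) \<le>
      p * (p - 1) * (\<Sum>k\<le>n. a k) - p\<^sup>2 / 4 * (2 * a 0 + a n - a (Suc n))"
  proof (induction n)
    case 0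
    have a1: "p * a 1 = (4 - p) * a 0" using rec[of 0] by simp
    have "p\<^sup>2 / 4 * (2 * a 0 + a 0 - a 1) = p / 4 * (3 * p * a 0 - p * a 1)"
      by (simp add: power2_eq_square algebra_simps)
    also have "\<dots> = p * (p - 1) * a 0"
      unfolding a1 by (simp add: algebra_simps)
    finally have "p\<^sup>2 / 4 * (2 * a 0 + a 0 - a 1) = p * (p - 1) * a 0" .
    then show ?case by simp
  next
    case (Suc n)
    define x m where "x = a (Suc n)" and "m = real n"
    define u v where "u = 2 * m + 2 - (p - 2)" and "v = 2 * m + 4 + (p - 2)"
    have uv: "u > 0" "v > 0" "u \<ge> 1" "v \<ge> 3" using p by (auto simp: u_def v_def m_def)
    have "a n * u = x * (u + 2 * (p - 2))"
      using rec[of n] by (simp add: x_def u_def m_def algebra_simps)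
    then have an: "a n = x + 2 * (p - 2) * x / u"
      using uv by (simp add: field_simps)
    have "a (Suc (Suc n)) * v = x * (v - 2 * (p - 2))"
      using rec[of "Suc n"] by (simp add: x_def v_def m_def algebra_simps)
    then have asn: "a (Suc (Suc n)) = x - 2 * (p - 2) * x / v"
      using uv by (simp add: field_simps)
    have "2 * x - a n - a (Suc (Suc n)) = 2 * (p - 2) * x * (u - v) / (u * v)"
      unfolding an asn using uv(1,2) by (simp add: field_simps)
    also have "u - v = - 2 * (p - 1)" by (simp add: u_def v_def)
    finally have e: "2 * x - a n - a (Suc (Suc n)) = 2 * (p - 2) * x * (- 2 * (p - 1)) / (u * v)" .
    have "p\<^sup>2 / 4 * (2 * x - a n - a (Suc (Suc n))) = - (p * (p - 1) * x * (p * (p - 2) / (u * v)))"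
      unfolding e using uv(1,2) by (simp add: power2_eq_square field_simps)
    then have "p * (p - 1) * x - p\<^sup>2 / 4 * (2 * x - a n - a (Suc (Suc n))) =
      p * (p - 1) * x * (1 + p * (p - 2) / (u * v))"
      by (simp only: distrib_left mult_1_right)
    moreover have "5 / 6 \<le> 1 + p * (p - 2) / (u * v)"
    proof (cases "p \<ge> 2")
      case True then show ?thesis using p uv by (simp add: add_increasing2)
    next
      case False
      have "u * v \<ge> 2 * 3" using False uv by (intro mult_mono) (auto simp: u_def m_def)
      moreover have "p * (p - 2) \<ge> -1"
        using zero_le_power2[of "p - 1"] by (simp add: power2_eq_square algebra_simps)
      ultimately have "- (u * v) / 6 \<le> p * (p - 2)" by simp
      then show ?thesis using uv by (simp add: field_simps)
    qed
    then have "p * (p - 1) * x * (5 / 6) \<le> p * (p - 1) * x * (1 + p * (p - 2) / (u * v))"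
      using p pos[of "Suc n"] by (intro mult_left_mono) (auto simp: x_def)
    ultimately have "5 / 6 * (p * (p - 1)) * x \<le> p * (p - 1) * x - p\<^sup>2 / 4 * (2 * x - a n - a (Suc (Suc n)))"
      by simp
    moreover have "K * X * (T + x) \<le> X * (T' + x) - Y * (2 * c + x - d)"
      if "K * X * T \<le> X * T' - Y * (2 * c + e - x)" "K * X * x \<le> X * x - Y * (2 * x - e - d)"
      for K X Y T T' c d e :: real
      using that by (simp add: algebra_simps)
    ultimately have "5 / 6 * (p * (p - 1)) * ((\<Sum>k\<in>{1..n}. a k) + x) \<le>
       p * (p - 1) * ((\<Sum>k\<le>n. a k) + x) - p\<^sup>2 / 4 * (2 * a 0 + x - a (Suc (Suc n)))"
      using Suc unfolding x_def by blast
    then show ?case by (simp add: x_def)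
  qed
qed

text \<open>
  The second variation controls the \<open>H\<close>-seminorm on all modes \<open>n \<ge> 2\<close>, with an explicit constant. That
  the moments grow without bound is the divergence of the harmonic series, since the increments are
  at least a multiple of \<open>1 / (2 * n + 1)\<close>.
\<close>

lemma chord_moment_coercive:
  fixes p :: real and n :: nat
  assumes p: "1 < p" "p < 3" and n: "2 \<le> n"
  shows "5 / 24 * (p * (p - 1)) * chord_moment (p - 4) n \<le>
    p * (p - 1) * chord_moment (p - 4) n - p\<^sup>2 / 4 * chord_moment (p - 2) n"
    and "chord_moment (p - 4) 1 \<le> chord_moment (p - 4) n"
    and "chord_moment (p - 4) 1 > 0"
    and "\<exists>N. \<forall>n\<ge>N. B \<le> chord_moment (p - 4) n"
proof -
  let ?I = "chord_moment (p - 4)"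
  define a where "a = (\<lambda>n. ?I (Suc n) - ?I n)"
  have I: "?I n = (\<Sum>k<n. a k)" for n
    unfolding a_def by (simp add: sum_lessThan_telescope)
  have S: "integrable arclength (\<lambda>\<omega>. norm (\<omega> - 1) powr (p - 2))"
    using p by (intro integrable_chord_powr) simp
  have I1: "2 * ?I 1 = (\<integral>\<omega>. norm (\<omega> - 1) powr (p - 2) \<partial>arclength)"
    by (rule chord_moment_relations(3)[OF p(1)])
  show pos: "?I 1 > 0"
  proof -
    have iw: "integrable arclength (\<lambda>\<omega>. \<omega> :: complex)"
      by (intro continuous_integrable_arclength continuous_intros)
    \<comment> \<open>Compare with \<open>S\<^sup>2 / 8 = (1 - Re \<omega>) / 4\<close>, whose integral is known.\<close>
    have "(\<integral>\<omega>. 1 / 4 * (1 - Re \<omega>) \<partial>arclength) = 1 / 4 * (2 * pi - Re (\<integral>\<omega>. \<omega> \<partial>arclength))"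
      using iw by simp
    also have "\<dots> = pi / 2" using integral_circle_power[of 1] by simp
    finally have "pi / 2 = (\<integral>\<omega>. 1 / 4 * (1 - Re \<omega>) \<partial>arclength)" ..
    also have "\<dots> \<le> (\<integral>\<omega>. norm (\<omega> - 1) powr (p - 2) \<partial>arclength)"
    proof (intro integral_mono S)
      show "integrable arclength (\<lambda>\<omega>. 1 / 4 * (1 - Re \<omega>))" using iw by simp
      fix \<omega> :: complex assume "\<omega> \<in> space arclength"
      then have w: "norm \<omega> = 1" by simp
      let ?s = "norm (\<omega> - 1)"
      have s2: "?s \<le> 2" using norm_triangle_ineq4[of \<omega> 1] w by simp
      show "1 / 4 * (1 - Re \<omega>) \<le> ?s powr (p - 2)"
      proof (cases "?s = 0")
        case True
        then show ?thesis using one_minus_Re_eq[OF w] by simp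
      next
        case False
        have "1 / 8 = 2 powr (-3 :: real)" by (simp add: powr_minus)
        also have "\<dots> \<le> 2 powr (p - 4)" using p by (intro powr_mono) auto
        also have "\<dots> \<le> ?s powr (p - 4)" using p s2 False by (intro powr_mono2') auto
        finally have "1 / 8 * ?s\<^sup>2 \<le> ?s powr (p - 4) * ?s\<^sup>2" by (intro mult_right_mono) auto
        then show ?thesis
          using powr_minus_two_mult_square[of ?s "p - 2"] one_minus_Re_eq[OF w] by simp
      qed
    qed
    finally show ?thesis using I1 pi_gt_zero by linarith
  qed
  have a0: "a 0 > 0" using pos by (simp add: a_def)
  have rec: "(2 * Suc n + (p - 2)) * a (Suc n) = (2 * Suc n - (p - 2)) * a n" for n
    unfolding a_def by (rule chord_moment_increment_recurrence[OF p(1)])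
  note alg = chord_moment_coercivity_algebra[OF p a0 rec]
  have apos: "a n > 0" for n
  proof -
    have "0 < a 0 / (2 * real n + 1)" using a0 by simp
    with alg(1)[of n] show ?thesis by linarith
  qed
  obtain m where m: "n = Suc m" "1 \<le> m" using n by (cases n) auto
  have J: "chord_moment (p - 2) n = 2 * a 0 + a m - a (Suc m)"
  proof -
    have "chord_moment (p - 2) n = (\<integral>\<omega>. norm (\<omega> - 1) powr (p - 2) - norm (\<omega> - 1) powr (p - 2) * Re (\<omega> ^ n) \<partial>arclength)"
      by (simp add: chord_moment_def algebra_simps)
    also have "\<dots> = 2 * ?I 1 - (\<integral>\<omega>. norm (\<omega> - 1) powr (p - 2) * Re (\<omega> ^ n) \<partial>arclength)"
      using chord_integration_by_parts(1)[of "p - 2" n] p S I1 by simp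
    finally show ?thesis
      using chord_moment_relations(1)[OF p(1), of m] by (simp add: m a_def)
  qed
  have s1: "(\<Sum>k\<le>m. a k) = a 0 + (\<Sum>k\<in>{1..m}. a k)"
    by (simp add: sum.atLeast_Suc_atMost atMost_atLeast0)
  have "a 1 \<le> (\<Sum>k\<in>{1..m}. a k)"
    using m apos by (intro member_le_sum) (auto intro: less_imp_le)
  then have "?I n \<le> 4 * (\<Sum>k\<in>{1..m}. a k)"
    using alg(3) s1 by (simp add: I m lessThan_Suc_atMost)
  then have "5 / 24 * (p * (p - 1)) * ?I n \<le> 5 / 24 * (p * (p - 1)) * (4 * (\<Sum>k\<in>{1..m}. a k))"
    using p by (intro mult_left_mono) auto
  also have "\<dots> = 5 / 6 * (p * (p - 1)) * (\<Sum>k\<in>{1..m}. a k)" by simp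
  also have "\<dots> \<le> p * (p - 1) * ?I n - p\<^sup>2 / 4 * chord_moment (p - 2) n"
    unfolding J using alg(2)[of m] by (simp add: I m lessThan_Suc_atMost)
  finally show "5 / 24 * (p * (p - 1)) * ?I n \<le> p * (p - 1) * ?I n - p\<^sup>2 / 4 * chord_moment (p - 2) n" .
  have mono: "?I k \<le> ?I l" if "k \<le> l" for k l
    unfolding I using that apos by (intro sum_mono2) (auto intro: less_imp_le)
  show "?I 1 \<le> ?I n" using n by (intro mono) simp
  show "\<exists>N. \<forall>n\<ge>N. B \<le> ?I n"
  proof (rule ccontr)
    assume "\<not> ?thesis"
    then have bd: "?I n \<le> B" for n
      using mono by (meson linear order_trans less_imp_le not_le)
    have "summable a"
      using apos bd by (intro summableI_nonneg_bounded[of _ B]) (auto simp: I less_imp_le)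
    then have "summable (\<lambda>n. a 0 / 2 * (1 / real (Suc n)))"
    proof (rule summable_comparison_test'[where N = 0])
      fix n
      have "a 0 / 2 * (1 / real (Suc n)) \<le> a 0 / (2 * n + 1)"
        using a0 by (simp add: field_simps)
      also have "\<dots> \<le> a n" using alg(1)[of n] by (simp add: add.commute)
      finally show "norm (a 0 / 2 * (1 / real (Suc n))) \<le> a n"
        using a0 by simp
    qed
    then have "summable (\<lambda>n. 1 / real (Suc n))"
      using a0 by (subst (asm) summable_cmult_iff) auto
    then have "summable (\<lambda>n. 1 / real n)"
      by (subst (asm) summable_Suc_iff)
    then show False using not_summable_harmonic[where 'a = real] by (simp add: inverse_eq_divide)
  qed
qed

text \<open>
  The weight \<open>w\<close> is the coefficient of \<open>S powr (p - 4) * g\<^sup>2\<close> that the pointwise expansion provides: a small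
  constant near the diagonal and almost the full one elsewhere. Coercivity survives. For \<open>n \<ge> N\<close> the small
  constant alone is enough, because the moments of exponent \<open>p - 4\<close> are unbounded in \<open>n\<close> and those of
  exponent \<open>p - 2\<close> are bounded. For \<open>n < N\<close> the part of the moment that comes from \<open>S < \<eta>\<close> is
  of order \<open>\<eta> powr ((p - 1) / 2)\<close>, uniformly in such \<open>n\<close>, and \<open>\<eta>\<close> is chosen to make it negligible.
\<close>

lemma truncated_multiplier_coercive:
  fixes p \<kappa> :: real
  assumes p: "1 < p" "p < 3" and k: "0 < \<kappa>" "\<kappa> \<le> (p - 1) / 2"
  defines "w \<equiv> \<lambda>\<eta> \<omega>::complex. if norm (\<omega> - 1) < \<eta> then \<kappa> / 2 else p * (p - 1) / 2 - \<kappa> / 16"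
  shows "\<exists>\<eta>>0. \<forall>n\<ge>2. \<kappa> / 16 * chord_moment (p - 4) n + p\<^sup>2 / 8 * chord_moment (p - 2) n \<le>
    (\<integral>\<omega>. w \<eta> \<omega> * (norm (\<omega> - 1) powr (p - 4) * (1 - Re (\<omega> ^ n))) \<partial>arclength)"
proof -
  let ?I = "chord_moment (p - 4)" and ?J = "chord_moment (p - 2)"
  let ?X = "\<lambda>n \<omega>::complex. norm (\<omega> - 1) powr (p - 4) * (1 - Re (\<omega> ^ n))"
  define A where "A = p * (p - 1) / 2 - \<kappa> / 16"
  have pp: "p - 1 \<le> p * (p - 1)" using p mult_right_mono[of 1 p "p - 1"] by simp
  have A: "\<kappa> / 2 \<le> A" "0 < A"
  proof -
    define Q where "Q = p * (p - 1)"
    have "p - 1 \<le> Q" "A = Q / 2 - \<kappa> / 16" using pp by (auto simp: Q_def A_def)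
    then show "\<kappa> / 2 \<le> A" "0 < A" using k by auto
  qed
  have w: "\<kappa> / 2 \<le> w \<eta> \<omega>" "w \<eta> \<omega> \<le> A" for \<eta> \<omega>
    using A by (auto simp: w_def A_def)
  have iX: "integrable arclength (?X n)" for n
    using p by (intro integrable_chord_moment) simp
  have X0: "0 \<le> ?X n \<omega>" if "norm \<omega> = 1" for n \<omega>
    using one_minus_Re_power_bounds(1)[OF that] by simp
  have wm: "w \<eta> \<in> borel_measurable borel" for \<eta> unfolding w_def by measurable
  have iw: "integrable arclength (\<lambda>\<omega>. w \<eta> \<omega> * ?X n \<omega>)" for \<eta> n
  proof (rule Bochner_Integration.integrable_bound[OF integrable_mult_right[OF iX[of n], of A]])
    show "(\<lambda>\<omega>. w \<eta> \<omega> * ?X n \<omega>) \<in> borel_measurable arclength"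
    proof (intro borel_measurable_arclengthI borel_measurable_times wm)
      show "(\<lambda>\<omega>::complex. norm (\<omega> - 1) powr (p - 4)) \<in> borel_measurable borel" by measurable
      show "(\<lambda>\<omega>::complex. 1 - Re (\<omega> ^ n)) \<in> borel_measurable borel" by measurable
    qed
    show "AE \<omega> in arclength. norm (w \<eta> \<omega> * ?X n \<omega>) \<le> norm (A * ?X n \<omega>)"
    proof (rule AE_I2)
      fix \<omega> :: complex assume "\<omega> \<in> space arclength"
      then have "0 \<le> ?X n \<omega>" by (intro X0) simp
      moreover have "\<bar>w \<eta> \<omega>\<bar> \<le> \<bar>A\<bar>" using w[of \<eta> \<omega>] k by auto
      ultimately show "norm (w \<eta> \<omega> * ?X n \<omega>) \<le> norm (A * ?X n \<omega>)"
        unfolding norm_mult by (intro mult_right_mono) auto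
    qed
  qed
  have J2: "?J n \<le> 4 * ?I 1" for n
  proof -
    have "?J n \<le> (\<integral>\<omega>. 2 * norm (\<omega> - 1) powr (p - 2) \<partial>arclength)"
      unfolding chord_moment_def
    proof (intro integral_mono integrable_mult_right integrable_chord_powr)
      show "integrable arclength (\<lambda>\<omega>. norm (\<omega> - 1) powr (p - 2) * (1 - Re (\<omega> ^ n)))"
        using p by (intro integrable_chord_moment) simp
      fix \<omega> :: complex assume "\<omega> \<in> space arclength"
      then show "norm (\<omega> - 1) powr (p - 2) * (1 - Re (\<omega> ^ n)) \<le> 2 * norm (\<omega> - 1) powr (p - 2)"
        using one_minus_Re_power_bounds(2)[of \<omega> n] by (simp add: mult.commute mult_right_mono)
    qed (use p in simp)
    also have "\<dots> = 4 * ?I 1" using chord_moment_relations(3)[OF p(1)] by simp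
    finally show ?thesis .
  qed
  note coer = chord_moment_coercive[OF p]
  have I1: "?I 1 > 0" by (rule coer(3)[of 2]) simp
  \<comment> \<open>From \<open>N\<close> on, \<open>\<kappa> / 2 - \<kappa> / 16\<close> times the moment of exponent \<open>p - 4\<close> exceeds the bound for the other one.\<close>
  obtain N where N: "\<And>n. n \<ge> N \<Longrightarrow> 8 / (7 * \<kappa>) * (p\<^sup>2 * ?I 1) \<le> ?I n"
    using coer(4)[of 2 "8 / (7 * \<kappa>) * (p\<^sup>2 * ?I 1)"] by auto
  define M where "M = (\<integral>\<omega>. norm (\<omega> - 1) powr ((p - 3) / 2) \<partial>arclength)"
  have M0: "M \<ge> 0" unfolding M_def by (intro integral_nonneg_AE) simp
  have iM: "integrable arclength (\<lambda>\<omega>. norm (\<omega> - 1) powr ((p - 3) / 2))"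
    using p by (intro integrable_chord_powr) simp
  define \<zeta> where "\<zeta> = (p - 1) * ?I 1 / 24"
  have z: "\<zeta> > 0" using I1 p by (simp add: \<zeta>_def)
  define C where "C = A * ((real N)\<^sup>2 / 2) * M + 1"
  have C: "C > 0" using A M0 by (simp add: C_def add_nonneg_pos)
  \<comment> \<open>The mass near the diagonal is at most \<open>C * \<eta> powr ((p - 1) / 2)\<close> for \<open>n < N\<close>, to be made equal to \<open>\<zeta>\<close>.\<close>
  define \<eta> where "\<eta> = (\<zeta> / C) powr (2 / (p - 1))"
  have \<eta>: "\<eta> > 0" "\<eta> powr ((p - 1) / 2) = \<zeta> / C"
  proof -
    show "\<eta> > 0" using z C by (simp add: \<eta>_def)
    have "2 / (p - 1) * ((p - 1) / 2) = 1" using p by simp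
    then show "\<eta> powr ((p - 1) / 2) = \<zeta> / C"
      using z C by (simp only: \<eta>_def powr_powr) simp
  qed
  have "\<kappa> / 16 * ?I n + p\<^sup>2 / 8 * ?J n \<le> (\<integral>\<omega>. w \<eta> \<omega> * ?X n \<omega> \<partial>arclength)" if n: "n \<ge> 2" for n
  proof (cases "n \<ge> N")
    case True
    have "\<kappa> / 16 * ?I n + p\<^sup>2 / 8 * ?J n \<le> \<kappa> / 16 * ?I n + p\<^sup>2 / 8 * (4 * ?I 1)"
      using J2[of n] by (intro add_left_mono mult_left_mono) auto
    also have "\<dots> \<le> \<kappa> / 2 * ?I n"
      using N[OF True] k by (simp add: field_simps)
    also have "\<dots> = (\<integral>\<omega>. \<kappa> / 2 * ?X n \<omega> \<partial>arclength)"
      by (simp add: chord_moment_def)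
    also have "\<dots> \<le> (\<integral>\<omega>. w \<eta> \<omega> * ?X n \<omega> \<partial>arclength)"
      by (intro integral_mono integrable_mult_right iX iw mult_right_mono w X0) auto
    finally show ?thesis .
  next
    case False
    have pw: "A * ?X n \<omega> - A * ((real n)\<^sup>2 / 2) * \<eta> powr ((p - 1) / 2) * norm (\<omega> - 1) powr ((p - 3) / 2) \<le> w \<eta> \<omega> * ?X n \<omega>"
      if om: "norm \<omega> = 1" for \<omega> :: complex
    proof (cases "norm (\<omega> - 1) < \<eta>")
      case True
      let ?s = "norm (\<omega> - 1)"
      have "?X n \<omega> \<le> ?s powr (p - 4) * ((real n)\<^sup>2 / 2 * ?s\<^sup>2)"
        by (intro mult_left_mono one_minus_Re_power_bounds om) simp
      also have "\<dots> = (real n)\<^sup>2 / 2 * ?s powr (p - 2)"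
        using powr_minus_two_mult_square[of ?s "p - 2"] by simp
      also have "?s powr (p - 2) = ?s powr ((p - 1) / 2) * ?s powr ((p - 3) / 2)"
      proof -
        have "(p - 1) / 2 + (p - 3) / 2 = p - 2" by (simp add: add_divide_distrib[symmetric])
        then show ?thesis by (simp only: powr_add[symmetric])
      qed
      also have "\<dots> \<le> \<eta> powr ((p - 1) / 2) * ?s powr ((p - 3) / 2)"
        using True p by (intro mult_right_mono powr_mono2) auto
      finally have "?X n \<omega> \<le> (real n)\<^sup>2 / 2 * (\<eta> powr ((p - 1) / 2) * ?s powr ((p - 3) / 2))"
        by (simp add: mult_left_mono)
      then have "A * ?X n \<omega> \<le> A * ((real n)\<^sup>2 / 2 * (\<eta> powr ((p - 1) / 2) * ?s powr ((p - 3) / 2)))"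
        using A by (intro mult_left_mono) auto
      moreover have "0 \<le> w \<eta> \<omega> * ?X n \<omega>"
      proof (rule mult_nonneg_nonneg[OF _ X0[OF om]])
        show "0 \<le> w \<eta> \<omega>" using w(1)[of \<eta> \<omega>] k by linarith
      qed
      ultimately show ?thesis by (simp add: mult_ac)
    next
      case False
      have "0 \<le> A * ((real n)\<^sup>2 / 2) * \<eta> powr ((p - 1) / 2) * norm (\<omega> - 1) powr ((p - 3) / 2)"
        using A by simp
      moreover have "w \<eta> \<omega> = A" using False by (simp add: w_def A_def)
      ultimately show ?thesis by simp
    qed
    have "A * ((real n)\<^sup>2 / 2) * \<eta> powr ((p - 1) / 2) * M \<le> \<zeta>"
    proof -
      have "A * ((real n)\<^sup>2 / 2) * M \<le> A * ((real N)\<^sup>2 / 2) * M"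
        using A M0 False by (intro mult_right_mono mult_left_mono divide_right_mono power_mono) auto
      also have "\<dots> \<le> C" by (simp add: C_def)
      finally have "A * ((real n)\<^sup>2 / 2) * M * (\<zeta> / C) \<le> C * (\<zeta> / C)"
        using z C by (intro mult_right_mono) auto
      then show ?thesis using C by (simp add: \<eta>(2) mult_ac)
    qed
    moreover have "A * ?I n - A * ((real n)\<^sup>2 / 2) * \<eta> powr ((p - 1) / 2) * M =
      (\<integral>\<omega>. A * ?X n \<omega> - A * ((real n)\<^sup>2 / 2) * \<eta> powr ((p - 1) / 2) * norm (\<omega> - 1) powr ((p - 3) / 2) \<partial>arclength)"
      using iX[of n] iM by (simp add: chord_moment_def M_def)
    moreover have "\<dots> \<le> (\<integral>\<omega>. w \<eta> \<omega> * ?X n \<omega> \<partial>arclength)"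
      using iX[of n] iM by (intro integral_mono iw pw) auto
    ultimately have low: "A * ?I n - \<zeta> \<le> (\<integral>\<omega>. w \<eta> \<omega> * ?X n \<omega> \<partial>arclength)" by linarith
    define Z V U where "Z = p * (p - 1) * ?I n" and "V = p\<^sup>2 * ?J n" and "U = (p - 1) * ?I n"
    have I0: "0 \<le> ?I n" using coer(2)[OF n] I1 by linarith
    have "U \<le> Z"
      unfolding U_def Z_def using pp I0 by (rule mult_right_mono)
    moreover have "5 / 24 * Z \<le> Z - V / 4"
      using coer(1)[OF n] by (simp add: Z_def V_def)
    moreover have "\<zeta> \<le> U / 24"
      using coer(2)[OF n] p by (simp add: \<zeta>_def U_def mult_left_mono divide_right_mono)
    moreover have "\<kappa> / 8 * ?I n \<le> U / 16"
      using mult_right_mono[OF k(2) I0] by (simp add: U_def)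
    moreover have "A * ?I n = Z / 2 - \<kappa> / 16 * ?I n"
      by (simp add: A_def Z_def left_diff_distrib)
    moreover have "p\<^sup>2 / 8 * ?J n = V / 8" by (simp add: V_def)
    ultimately show ?thesis using low by linarith
  qed
  then show ?thesis using \<eta>(1) by blast
qed

section \<open>The energy gap for balanced perturbations\<close>

text \<open>
  The chord between two points of the perturbed circle depends on the lifts of both points only through
  the angle between them.
\<close>

lemma circle_lift_chord:
  assumes "norm y = 1"
  shows "dist ((cis h * y) * cis a) (y * cis b) = \<bar>2 * sin ((h + (a - b)) / 2)\<bar>"
proof -
  have "(cis h * y) * cis a - y * cis b = y * cis b * (cis (h + (a - b)) - 1)"
    by (simp add: cis_mult cis_divide[symmetric] algebra_simps flip: cis_mult)
  then show ?thesis
    using assms by (simp add: dist_norm norm_mult norm_cis_minus_one)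
qed

lemma dist_rotate:
  assumes "norm (y::complex) = 1"
  shows "dist (\<omega> * y) y = norm (\<omega> - 1)"
  using norm_mult[of "\<omega> - 1" y] assms by (simp add: dist_norm left_diff_distrib)

lemma abs_sin_diff_le: "\<bar>sin x - sin y\<bar> \<le> \<bar>x - (y::real)\<bar>"
proof -
  have "\<bar>sin x - sin y\<bar> = 2 * \<bar>sin ((x - y) / 2)\<bar> * \<bar>cos ((x + y) / 2)\<bar>"
    by (simp add: sin_diff_sin abs_mult)
  also have "\<dots> \<le> 2 * \<bar>sin ((x - y) / 2)\<bar> * 1"
    by (intro mult_left_mono) auto
  also have "\<dots> \<le> 2 * \<bar>(x - y) / 2\<bar>"
    using abs_sin_x_le_abs_x[of "(x - y) / 2"] by simp
  finally show ?thesis by simp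
qed

lemma continuous_on_circle_rotate:
  assumes "continuous_on (sphere 0 1) f" "norm (\<omega>::complex) = 1"
  shows "continuous_on (sphere 0 1) (\<lambda>y. f (\<omega> * y))"
  using assms(2) by (intro continuous_on_compose2[OF assms(1)] continuous_intros) (auto simp: norm_mult)

text \<open>
  For fixed \<open>\<omega>\<close> the term linear in \<open>g\<close> has integral zero, as rotation preserves the integral of \<open>f\<close>.
  Integrating over \<open>y\<close> before \<open>\<omega>\<close> removes this term without any integrability in \<open>\<omega>\<close>.
\<close>

lemma chord_energy_increment_integrated:
  fixes f :: "complex \<Rightarrow> real"
  assumes p: "1 < p" "p < 3"
    and f: "continuous_on (sphere 0 1) f" "\<And>x. x \<in> sphere 0 1 \<Longrightarrow> \<bar>f x\<bar> \<le> \<gamma> / 2" and \<gamma>: "\<gamma> \<le> 1"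
    and om: "norm \<omega> = 1" "\<omega> \<noteq> 1"
    and W: "0 \<le> W" "W \<le> p * (p - 1) / 2"
    and lip: "p < 2 \<Longrightarrow> (\<And>x y. x \<in> sphere 0 1 \<Longrightarrow> y \<in> sphere 0 1 \<Longrightarrow>
       dist (x * cis (f x)) (y * cis (f y)) \<le> L * dist x y)"
    and conv: "\<And>r. \<bar>r - 1\<bar> * norm (\<omega> - 1) \<le> \<gamma> \<Longrightarrow> (p < 2 \<Longrightarrow> \<bar>r\<bar> \<le> L) \<Longrightarrow>
      1 + p * (r - 1) + W * (r - 1)\<^sup>2 \<le> \<bar>r\<bar> powr p"
  shows "2 * pi * norm (\<omega> - 1) powr p + (W - 2 * \<gamma>) * norm (\<omega> - 1) powr (p - 2) * (\<integral>y. (f (\<omega> * y) - f y)\<^sup>2 \<partial>arclength)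
    \<le> (\<integral>y. dist ((\<omega> * y) * cis (f (\<omega> * y))) (y * cis (f y)) powr p \<partial>arclength)
      + p\<^sup>2 / 8 * norm (\<omega> - 1) powr p * (\<integral>y. (f (\<omega> * y) - f y)\<^sup>2 \<partial>arclength)"
proof -
  obtain h where h: "\<omega> = cis h"
    by (rule that[OF cis_Arg2pi_unit[OF om(1), symmetric]])
  define s where "s = 2 * sin (h / 2)"
  have S: "norm (\<omega> - 1) = \<bar>s\<bar>" by (simp add: h norm_cis_minus_one s_def)
  have s0: "s \<noteq> 0" using om(2) S by auto
  define c where "c = p * \<bar>s\<bar> powr (p - 2) * s * cos (h / 2)"
  let ?g = "\<lambda>y. f (\<omega> * y) - f y"
  let ?d = "\<lambda>y. dist ((\<omega> * y) * cis (f (\<omega> * y))) (y * cis (f y))"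
  have cw: "continuous_on (sphere 0 1) (\<lambda>y. f (\<omega> * y))"
    by (rule continuous_on_circle_rotate[OF f(1) om(1)])
  have ig: "integrable arclength ?g" "integrable arclength (\<lambda>y. (?g y)\<^sup>2)"
    using f(1) cw by (auto intro!: continuous_integrable_arclength continuous_intros)
  have icis: "continuous_on (sphere 0 1) (\<lambda>y. cis (f y))" "continuous_on (sphere 0 1) (\<lambda>y. cis (f (\<omega> * y)))"
    by (intro continuous_on_cis f(1) cw)+
  have id: "integrable arclength (\<lambda>y. ?d y powr p)"
  proof (intro continuous_integrable_arclength continuous_on_powr' continuous_on_const)
    show "continuous_on (sphere 0 1) ?d"
      by (intro continuous_on_dist continuous_on_mult continuous_on_id continuous_on_const icis)
  qed (use p in simp)
  have ig0: "(\<integral>y. ?g y \<partial>arclength) = 0"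
  proof -
    have "integrable arclength f" "integrable arclength (\<lambda>y. f (\<omega> * y))"
      using f(1) cw by (auto intro!: continuous_integrable_arclength)
    then show ?thesis
      using integral_arclength_rotate[OF continuous_borel_measurable_arclength[OF f(1)] om(1)] by simp
  qed
  have pw: "\<bar>s\<bar> powr p + c * ?g y + (W - 2 * \<gamma>) * \<bar>s\<bar> powr (p - 2) * (?g y)\<^sup>2
     \<le> ?d y powr p + p\<^sup>2 / 8 * \<bar>s\<bar> powr p * (?g y)\<^sup>2" if y: "y \<in> sphere 0 1" for y
  proof -
    define t where "t = 2 * sin ((h + ?g y) / 2)"
    have d: "?d y = \<bar>t\<bar>" using circle_lift_chord[of y h "f (\<omega> * y)" "f y"] y by (simp add: h t_def)
    have wy: "\<omega> * y \<in> sphere 0 1" using y om by (simp add: norm_mult)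
    have gg: "\<bar>?g y\<bar> \<le> \<gamma>" using f(2)[OF y] f(2)[OF wy] by linarith
    have ts: "\<bar>t - s\<bar> \<le> \<bar>?g y\<bar>"
    proof -
      have "t - s = 2 * (sin ((h + ?g y) / 2) - sin (h / 2))" by (simp add: t_def s_def)
      moreover have "(h + ?g y) / 2 - h / 2 = ?g y / 2" by (simp add: add_divide_distrib)
      ultimately show ?thesis
        using abs_sin_diff_le[of "(h + ?g y) / 2" "h / 2"] by (simp only: abs_mult abs_divide) simp
    qed
    have "1 + p * (t / s - 1) + W * (t / s - 1)\<^sup>2 \<le> \<bar>t / s\<bar> powr p"
    proof (rule conv)
      have "t / s - 1 = (t - s) / s" using s0 by (simp add: field_simps)
      then show "\<bar>t / s - 1\<bar> * norm (\<omega> - 1) \<le> \<gamma>"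
        using ts gg s0 by (simp add: S abs_divide)
      assume "p < 2"
      from lip[OF this wy y] have "\<bar>t\<bar> \<le> L * \<bar>s\<bar>"
        using d S dist_rotate[of y \<omega>] y by simp
      then show "\<bar>t / s\<bar> \<le> L" using s0 by (simp add: abs_divide field_simps)
    qed
    then show ?thesis
      using chord_energy_increment[of p h "?g y" \<gamma> W] p s0 gg \<gamma> W
      by (simp add: d c_def s_def t_def)
  qed
  have "(\<integral>y. \<bar>s\<bar> powr p + c * ?g y + (W - 2 * \<gamma>) * \<bar>s\<bar> powr (p - 2) * (?g y)\<^sup>2 \<partial>arclength)
     \<le> (\<integral>y. ?d y powr p + p\<^sup>2 / 8 * \<bar>s\<bar> powr p * (?g y)\<^sup>2 \<partial>arclength)"
  proof (rule integral_mono)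
    show "integrable arclength (\<lambda>y. \<bar>s\<bar> powr p + c * ?g y + (W - 2 * \<gamma>) * \<bar>s\<bar> powr (p - 2) * (?g y)\<^sup>2)"
      by (intro Bochner_Integration.integrable_add integrable_mult_right ig arclength.integrable_const)
    show "integrable arclength (\<lambda>y. ?d y powr p + p\<^sup>2 / 8 * \<bar>s\<bar> powr p * (?g y)\<^sup>2)"
      by (intro Bochner_Integration.integrable_add integrable_mult_right ig id)
  qed (use pw in simp)
  also have "(\<integral>y. \<bar>s\<bar> powr p + c * ?g y + (W - 2 * \<gamma>) * \<bar>s\<bar> powr (p - 2) * (?g y)\<^sup>2 \<partial>arclength)
    = 2 * pi * \<bar>s\<bar> powr p + (W - 2 * \<gamma>) * \<bar>s\<bar> powr (p - 2) * (\<integral>y. (?g y)\<^sup>2 \<partial>arclength)"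
  proof -
    have "(\<integral>y. \<bar>s\<bar> powr p + c * ?g y + (W - 2 * \<gamma>) * \<bar>s\<bar> powr (p - 2) * (?g y)\<^sup>2 \<partial>arclength)
      = (\<integral>y. \<bar>s\<bar> powr p \<partial>arclength) + c * (\<integral>y. ?g y \<partial>arclength)
        + (W - 2 * \<gamma>) * \<bar>s\<bar> powr (p - 2) * (\<integral>y. (?g y)\<^sup>2 \<partial>arclength)"
      by (simp only: Bochner_Integration.integral_add Bochner_Integration.integrable_add
         Bochner_Integration.integral_mult_right integrable_mult_right ig arclength.integrable_const)
    then show ?thesis by (simp only: ig0) simp
  qed
  also have "(\<integral>y. ?d y powr p + p\<^sup>2 / 8 * \<bar>s\<bar> powr p * (?g y)\<^sup>2 \<partial>arclength) =
     (\<integral>y. ?d y powr p \<partial>arclength) + p\<^sup>2 / 8 * \<bar>s\<bar> powr p * (\<integral>y. (?g y)\<^sup>2 \<partial>arclength)"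
    by (simp only: Bochner_Integration.integral_add integrable_mult_right Bochner_Integration.integral_mult_right ig id)
  finally show ?thesis by (simp only: S)
qed

definition increment_energy :: "(complex \<Rightarrow> real) \<Rightarrow> complex \<Rightarrow> ennreal" where
  "increment_energy f \<omega> = (\<integral>\<^sup>+ y. ennreal ((f (\<omega> * y) - f y)\<^sup>2) \<partial>arclength)"

lemma increment_energy_eq:
  fixes f :: "complex \<Rightarrow> real"
  assumes f: "continuous_on (sphere 0 1) f" and w: "norm \<omega> = 1"
  shows "increment_energy f \<omega> = ennreal (\<integral>y. (f (\<omega> * y) - f y)\<^sup>2 \<partial>arclength)"
  unfolding increment_energy_def
  using f continuous_on_circle_rotate[OF f w]
  by (intro nn_integral_eq_integral continuous_integrable_arclength continuous_intros) auto

lemma circle_pair_measurable: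
  assumes "f \<in> borel_measurable arclength"
  shows "(\<lambda>(\<omega>, y). f (\<omega> * y)) \<in> borel_measurable (arclength \<Otimes>\<^sub>M arclength)"
  using measurable_compose[OF circle_mult_measurable assms] by (simp add: case_prod_unfold)

lemma increment_energy_measurable:
  assumes f: "continuous_on (sphere 0 1) f"
  shows "increment_energy f \<in> borel_measurable arclength"
proof -
  have [measurable]: "f \<in> borel_measurable arclength"
    by (rule continuous_borel_measurable_arclength[OF f])
  note [measurable] = circle_pair_measurable[OF this]
  have "(\<lambda>\<omega>. \<integral>\<^sup>+ y. (\<lambda>(\<omega>, y). ennreal (((\<lambda>(\<omega>, y). f (\<omega> * y)) (\<omega>, y) - f y)\<^sup>2)) (\<omega>, y) \<partial>arclength) \<in> borel_measurable arclength"
    by measurable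
  then show ?thesis unfolding increment_energy_def by simp
qed

text \<open>
  A rotation-invariant quadratic form is diagonal in Fourier modes. The identity holds in the extended
  nonnegative reals, whether its two sides are finite or not.
\<close>

lemma weighted_increment_energy_series:
  fixes f :: "complex \<Rightarrow> real" and k :: "complex \<Rightarrow> real"
  assumes f: "continuous_on (sphere 0 1) f"
    and k: "k \<in> borel_measurable arclength" "\<And>\<omega>. 0 \<le> k \<omega>"
  shows "(\<integral>\<^sup>+ \<omega>. ennreal (k \<omega>) * increment_energy f \<omega> \<partial>arclength) =
    (\<Sum>n. ennreal (2 * parseval_weight f n) * (\<integral>\<^sup>+ \<omega>. ennreal (k \<omega> * (1 - Re (\<omega> ^ n))) \<partial>arclength))"
proof -
  have m: "(\<lambda>\<omega>. ennreal (k \<omega> * (1 - Re (\<omega> ^ n)))) \<in> borel_measurable arclength" for n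
  proof -
    have "(\<lambda>\<omega>::complex. 1 - Re (\<omega> ^ n)) \<in> borel_measurable arclength"
      by (intro continuous_borel_measurable_arclength continuous_intros)
    with k(1) show ?thesis by measurable
  qed
  have "(\<integral>\<^sup>+ \<omega>. ennreal (k \<omega>) * increment_energy f \<omega> \<partial>arclength) =
    (\<integral>\<^sup>+ \<omega>. (\<Sum>n. ennreal (2 * parseval_weight f n) * ennreal (k \<omega> * (1 - Re (\<omega> ^ n)))) \<partial>arclength)"
  proof (rule nn_integral_cong)
    fix \<omega> :: complex assume "\<omega> \<in> space arclength"
    then have w: "norm \<omega> = 1" by simp
    have r: "0 \<le> 1 - Re (\<omega> ^ n)" for n by (rule one_minus_Re_power_bounds(1)[OF w])
    have s: "(\<lambda>n. 2 * parseval_weight f n * (1 - Re (\<omega> ^ n))) sums (\<integral>y. (f (\<omega> * y) - f y)\<^sup>2 \<partial>arclength)"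
      by (rule parseval_circle_increment[OF f w])
    have "increment_energy f \<omega> = (\<Sum>n. ennreal (2 * parseval_weight f n * (1 - Re (\<omega> ^ n))))"
      unfolding increment_energy_eq[OF f w] using s r
      by (subst suminf_ennreal2) (auto simp: sums_iff)
    then have "ennreal (k \<omega>) * increment_energy f \<omega> =
      (\<Sum>n. ennreal (k \<omega>) * ennreal (2 * parseval_weight f n * (1 - Re (\<omega> ^ n))))"
      by simp
    also have "\<dots> = (\<Sum>n. ennreal (2 * parseval_weight f n) * ennreal (k \<omega> * (1 - Re (\<omega> ^ n))))"
      using k(2) r by (intro suminf_cong) (simp add: ennreal_mult[symmetric] mult_ac)
    finally show "ennreal (k \<omega>) * increment_energy f \<omega> =
      (\<Sum>n. ennreal (2 * parseval_weight f n) * ennreal (k \<omega> * (1 - Re (\<omega> ^ n))))" .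
  qed
  also have "\<dots> = (\<Sum>n. \<integral>\<^sup>+ \<omega>. ennreal (2 * parseval_weight f n) * ennreal (k \<omega> * (1 - Re (\<omega> ^ n))) \<partial>arclength)"
  proof (rule nn_integral_suminf)
    note [measurable] = m
    show "(\<lambda>\<omega>. ennreal (2 * parseval_weight f n) * ennreal (k \<omega> * (1 - Re (\<omega> ^ n)))) \<in> borel_measurable arclength" for n
      by measurable
  qed
  also have "\<dots> = (\<Sum>n. ennreal (2 * parseval_weight f n) * (\<integral>\<^sup>+ \<omega>. ennreal (k \<omega> * (1 - Re (\<omega> ^ n))) \<partial>arclength))"
    using m by (intro suminf_cong nn_integral_cmult)
  finally show ?thesis .
qed

text \<open>
  The multiplier inequality summed against the Fourier weights of \<open>f\<close>; the modes on which it fails do not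
  occur in \<open>f\<close>.
\<close>

lemma invariant_form_coercive:
  fixes f :: "complex \<Rightarrow> real" and w :: "complex \<Rightarrow> real" and p \<kappa> :: real
  assumes f: "continuous_on (sphere 0 1) f" and modes: "fourier_coeff f 0 = 0" "fourier_coeff f 1 = 0"
    and wm: "w \<in> borel_measurable arclength" and w0: "\<And>\<omega>. 0 \<le> w \<omega>"
    and p: "1 < p" and \<kappa>: "0 \<le> \<kappa>"
    and mult: "\<And>n. n \<ge> 2 \<Longrightarrow> \<kappa> / 16 * chord_moment (p - 4) n + p\<^sup>2 / 8 * chord_moment (p - 2) n \<le>
      (\<integral>\<omega>. w \<omega> * (norm (\<omega> - 1) powr (p - 4) * (1 - Re (\<omega> ^ n))) \<partial>arclength)"
  shows "ennreal (\<kappa> / 16) * (\<integral>\<^sup>+ \<omega>. ennreal (norm (\<omega> - 1) powr (p - 4)) * increment_energy f \<omega> \<partial>arclength)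
      + (\<integral>\<^sup>+ \<omega>. ennreal (p\<^sup>2 / 8 * norm (\<omega> - 1) powr (p - 2)) * increment_energy f \<omega> \<partial>arclength)
    \<le> (\<integral>\<^sup>+ \<omega>. ennreal (w \<omega> * norm (\<omega> - 1) powr (p - 4)) * increment_energy f \<omega> \<partial>arclength)"
    (is "ennreal (\<kappa> / 16) * ?D + ?B \<le> _")
proof -
  have Sm: "(\<lambda>\<omega>::complex. norm (\<omega> - 1) powr a) \<in> borel_measurable arclength" for a
    by (intro borel_measurable_arclengthI) measurable
  have wgt: "parseval_weight f 0 = 0" "parseval_weight f 1 = 0"
    using modes by (auto simp: parseval_weight_def)
  let ?A = "\<lambda>n. ennreal (2 * parseval_weight f n)"
  let ?N = "\<lambda>k n. \<integral>\<^sup>+ \<omega>. ennreal (k \<omega> * (1 - Re (\<omega> ^ n))) \<partial>arclength"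
  have moment: "?N (\<lambda>\<omega>. c * norm (\<omega> - 1) powr a) n = ennreal (c * chord_moment a n)" if "-3 < a" "0 \<le> c" for a c n
  proof -
    have "?N (\<lambda>\<omega>. c * norm (\<omega> - 1) powr a) n = (\<integral>\<^sup>+ \<omega>. ennreal (c * (norm (\<omega> - 1) powr a * (1 - Re (\<omega> ^ n)))) \<partial>arclength)"
      by (simp only: mult.assoc)
    also have "\<dots> = ennreal (\<integral>\<omega>. c * (norm (\<omega> - 1) powr a * (1 - Re (\<omega> ^ n))) \<partial>arclength)"
      using that one_minus_Re_power_bounds(1)
      by (intro nn_integral_eq_integral integrable_mult_right integrable_chord_moment AE_I2) auto
    finally show ?thesis by (simp add: chord_moment_def)
  qed
  \<comment> \<open>An integral never exceeds the nonnegative one: if it diverges, its value is zero by convention.\<close>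
  have moment_w: "ennreal (\<integral>\<omega>. w \<omega> * (norm (\<omega> - 1) powr (p - 4) * (1 - Re (\<omega> ^ n))) \<partial>arclength) \<le> ?N (\<lambda>\<omega>. w \<omega> * norm (\<omega> - 1) powr (p - 4)) n" for n
  proof -
    let ?g = "\<lambda>\<omega>. w \<omega> * (norm (\<omega> - 1) powr (p - 4) * (1 - Re (\<omega> ^ n)))"
    have "AE \<omega> in arclength. 0 \<le> ?g \<omega>"
      using w0 one_minus_Re_power_bounds(1) by (intro AE_I2) auto
    then have "ennreal (\<integral>\<omega>. ?g \<omega> \<partial>arclength) \<le> (\<integral>\<^sup>+ \<omega>. ennreal (?g \<omega>) \<partial>arclength)"
      by (cases "integrable arclength ?g")
         (simp_all add: nn_integral_eq_integral not_integrable_integral_eq)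
    then show ?thesis by (simp only: mult.assoc)
  qed
  have termwise: "?A n * (ennreal (\<kappa> / 16) * ?N (\<lambda>\<omega>. 1 * norm (\<omega> - 1) powr (p - 4)) n + ?N (\<lambda>\<omega>. p\<^sup>2 / 8 * norm (\<omega> - 1) powr (p - 2)) n)
    \<le> ?A n * ?N (\<lambda>\<omega>. w \<omega> * norm (\<omega> - 1) powr (p - 4)) n" for n
  proof (cases "n \<ge> 2")
    case True
    have m0: "0 \<le> chord_moment a n" for a
      unfolding chord_moment_def using one_minus_Re_power_bounds(1)
      by (intro integral_nonneg_AE AE_I2) auto
    have N4: "?N (\<lambda>\<omega>. 1 * norm (\<omega> - 1) powr (p - 4)) n = ennreal (1 * chord_moment (p - 4) n)"
      by (rule moment) (use p in auto)
    have N2: "?N (\<lambda>\<omega>. p\<^sup>2 / 8 * norm (\<omega> - 1) powr (p - 2)) n = ennreal (p\<^sup>2 / 8 * chord_moment (p - 2) n)"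
      by (rule moment) (use p in auto)
    have "ennreal (\<kappa> / 16) * ?N (\<lambda>\<omega>. 1 * norm (\<omega> - 1) powr (p - 4)) n + ?N (\<lambda>\<omega>. p\<^sup>2 / 8 * norm (\<omega> - 1) powr (p - 2)) n
      = ennreal (\<kappa> / 16 * chord_moment (p - 4) n + p\<^sup>2 / 8 * chord_moment (p - 2) n)"
      unfolding N4 N2 using \<kappa> m0 by (subst ennreal_mult'[symmetric], simp, subst ennreal_plus[symmetric]) auto
    also have "\<dots> \<le> ennreal (\<integral>\<omega>. w \<omega> * (norm (\<omega> - 1) powr (p - 4) * (1 - Re (\<omega> ^ n))) \<partial>arclength)"
      by (intro ennreal_leI mult True)
    also note moment_w
    finally show ?thesis by (intro mult_left_mono) auto
  next
    case False
    then have "n = 0 \<or> n = 1" by auto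
    then show ?thesis using wgt by auto
  qed
  have D: "?D = (\<Sum>n. ?A n * ?N (\<lambda>\<omega>. 1 * norm (\<omega> - 1) powr (p - 4)) n)"
    using weighted_increment_energy_series[OF f, of "\<lambda>\<omega>. 1 * norm (\<omega> - 1) powr (p - 4)"] Sm[of "p - 4"] by simp
  have B: "?B = (\<Sum>n. ?A n * ?N (\<lambda>\<omega>. p\<^sup>2 / 8 * norm (\<omega> - 1) powr (p - 2)) n)"
    by (rule weighted_increment_energy_series[OF f borel_measurable_times[OF borel_measurable_const Sm]]) simp
  have "ennreal (\<kappa> / 16) * ?D + ?B =
    (\<Sum>n. ?A n * (ennreal (\<kappa> / 16) * ?N (\<lambda>\<omega>. 1 * norm (\<omega> - 1) powr (p - 4)) n + ?N (\<lambda>\<omega>. p\<^sup>2 / 8 * norm (\<omega> - 1) powr (p - 2)) n))"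
    unfolding D B ennreal_suminf_cmult[symmetric]
    by (subst suminf_add) (simp_all only: summableI distrib_left mult.left_commute)
  also have "\<dots> \<le> (\<Sum>n. ?A n * ?N (\<lambda>\<omega>. w \<omega> * norm (\<omega> - 1) powr (p - 4)) n)"
    by (intro suminf_le termwise summableI)
  also have "\<dots> = (\<integral>\<^sup>+ \<omega>. ennreal (w \<omega> * norm (\<omega> - 1) powr (p - 4)) * increment_energy f \<omega> \<partial>arclength)"
    by (rule weighted_increment_energy_series[OF f borel_measurable_times[OF wm Sm], symmetric])
       (use w0 in simp)
  finally show ?thesis .
qed

text \<open>
  The square of the seminorm of order \<open>(3 - p) / 2\<close>.
\<close>

definition fractional_energy :: "real \<Rightarrow> (complex \<Rightarrow> real) \<Rightarrow> ennreal" where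
  "fractional_energy p f = (\<integral>\<^sup>+ (x, y). ennreal (dist x y powr (p - 4) * (f x - f y)\<^sup>2)
     \<partial>(arclength \<Otimes>\<^sub>M arclength))"

lemma fractional_energy_rotate:
  fixes f :: "complex \<Rightarrow> real"
  assumes f: "continuous_on (sphere 0 1) f"
  shows "fractional_energy p f =
    (\<integral>\<^sup>+ \<omega>. ennreal (norm (\<omega> - 1) powr (p - 4)) * increment_energy f \<omega> \<partial>arclength)"
proof -
  have [measurable]: "f \<in> borel_measurable arclength"
    by (rule continuous_borel_measurable_arclength[OF f])
  have "fractional_energy p f =
    (\<integral>\<^sup>+ \<omega>. \<integral>\<^sup>+ y. ennreal (dist (\<omega> * y) y powr (p - 4) * (f (\<omega> * y) - f y)\<^sup>2) \<partial>arclength \<partial>arclength)"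
    unfolding fractional_energy_def by (rule nn_integral_circle_pair_rotate) measurable
  also have "\<dots> = (\<integral>\<^sup>+ \<omega>. ennreal (norm (\<omega> - 1) powr (p - 4)) * increment_energy f \<omega> \<partial>arclength)"
  proof (rule nn_integral_cong, goal_cases)
    case (1 \<omega>)
    then have w: "norm \<omega> = 1" by simp
    have m: "(\<lambda>y. ennreal ((f (\<omega> * y) - f y)\<^sup>2)) \<in> borel_measurable arclength"
      using continuous_borel_measurable_arclength[OF continuous_on_circle_rotate[OF f w]] by measurable
    have "(\<integral>\<^sup>+ y. ennreal (dist (\<omega> * y) y powr (p - 4) * (f (\<omega> * y) - f y)\<^sup>2) \<partial>arclength) =
      (\<integral>\<^sup>+ y. ennreal (norm (\<omega> - 1) powr (p - 4)) * ennreal ((f (\<omega> * y) - f y)\<^sup>2) \<partial>arclength)"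
      by (intro nn_integral_cong) (simp add: dist_rotate ennreal_mult)
    then show ?case
      unfolding increment_energy_def using nn_integral_cmult[OF m] by simp
  qed
  finally show ?thesis .
qed

lemma energy_rotate:
  assumes v: "continuous_on (sphere 0 1) v" and s: "0 < s"
  shows "energy s v = (\<integral>\<^sup>+ \<omega>. ennreal ((\<integral>y. dist (v (\<omega> * y)) (v y) powr (1 / s) \<partial>arclength) / (norm (\<omega> - 1))\<^sup>2) \<partial>arclength)"
proof -
  have [measurable]: "v \<in> borel_measurable arclength"
    by (rule continuous_borel_measurable_arclength[OF v])
  have "energy s v = (\<integral>\<^sup>+ \<omega>. \<integral>\<^sup>+ y. ennreal (dist (v (\<omega> * y)) (v y) powr (1 / s) / (dist (\<omega> * y) y)\<^sup>2) \<partial>arclength \<partial>arclength)"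
    unfolding energy_def by (rule nn_integral_circle_pair_rotate) measurable
  also have "\<dots> = (\<integral>\<^sup>+ \<omega>. ennreal ((\<integral>y. dist (v (\<omega> * y)) (v y) powr (1 / s) \<partial>arclength) / (norm (\<omega> - 1))\<^sup>2) \<partial>arclength)"
  proof (rule nn_integral_cong, goal_cases)
    case (1 \<omega>)
    then have w: "norm \<omega> = 1" by simp
    have "continuous_on (sphere 0 1) (\<lambda>y. dist (v (\<omega> * y)) (v y) powr (1 / s))"
      using v continuous_on_circle_rotate[OF v w] s by (intro continuous_on_powr' continuous_intros) auto
    then have i: "integrable arclength (\<lambda>y. dist (v (\<omega> * y)) (v y) powr (1 / s))"
      by (rule continuous_integrable_arclength)
    have "(\<integral>\<^sup>+ y. ennreal (dist (v (\<omega> * y)) (v y) powr (1 / s) / (dist (\<omega> * y) y)\<^sup>2) \<partial>arclength) =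
      (\<integral>\<^sup>+ y. ennreal (dist (v (\<omega> * y)) (v y) powr (1 / s) / (norm (\<omega> - 1))\<^sup>2) \<partial>arclength)"
      by (intro nn_integral_cong) (simp add: dist_rotate)
    also have "\<dots> = ennreal (\<integral>y. dist (v (\<omega> * y)) (v y) powr (1 / s) / (norm (\<omega> - 1))\<^sup>2 \<partial>arclength)"
      using i by (intro nn_integral_eq_integral integrable_divide_zero) auto
    finally show ?case by simp
  qed
  finally show ?thesis .
qed

lemma energy_id:
  assumes s: "0 < s"
  shows "energy s id = (\<integral>\<^sup>+ \<omega>. ennreal (2 * pi * norm (\<omega> - 1) powr (1 / s - 2)) \<partial>arclength)"
proof -
  have "energy s id = (\<integral>\<^sup>+ \<omega>. ennreal ((\<integral>y. dist (\<omega> * y) y powr (1 / s) \<partial>arclength) / (norm (\<omega> - 1))\<^sup>2) \<partial>arclength)"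
    using energy_rotate[OF continuous_on_id s] by (simp add: id_def)
  also have "\<dots> = (\<integral>\<^sup>+ \<omega>. ennreal (2 * pi * norm (\<omega> - 1) powr (1 / s - 2)) \<partial>arclength)"
  proof (rule nn_integral_cong, goal_cases)
    case (1 \<omega>)
    have "(\<integral>y. dist (\<omega> * y) y powr (1 / s) \<partial>arclength) = (\<integral>y. norm (\<omega> - 1) powr (1 / s) \<partial>arclength)"
      by (intro Bochner_Integration.integral_cong) (simp_all add: dist_rotate)
    also have "\<dots> = 2 * pi * (norm (\<omega> - 1) powr (1 / s - 2) * (norm (\<omega> - 1))\<^sup>2)"
      by (subst powr_minus_two_mult_square) auto
    finally show ?case by (cases "\<omega> = 1") simp_all
  qed
  finally show ?thesis .
qed

lemma energy_id_finite:
  assumes s: "0 < s" "s < 1"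
  shows "energy s id < \<infinity>"
proof -
  have "integrable arclength (\<lambda>\<omega>. 2 * pi * norm (\<omega> - 1) powr (1 / s - 2))"
    using s by (intro integrable_mult_right integrable_chord_powr) (simp add: field_simps)
  then show ?thesis
    unfolding energy_id[OF s(1)] by (subst nn_integral_eq_integral) auto
qed

text \<open>
  The estimate \<open>(2 - p) * ln (2 * \<Lambda> / (2 - p)) \<le> 2 * \<Lambda>\<close>, which is \<open>ln y \<le> y\<close>, uniformly in \<open>p\<close>. It
  shows why a Lipschitz bound may blow up like \<open>1 / (2 - p)\<close>.
\<close>

lemma lipschitz_exponent_bound:
  fixes p \<Lambda> :: real
  assumes "p < 2" "0 < \<Lambda>"
  defines "L \<equiv> max 1 (2 * \<Lambda> / (2 - p))"
  shows "exp (- 2 * \<Lambda>) \<le> L powr (p - 2)"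
proof -
  have L: "L \<ge> 1" by (simp add: L_def)
  have "(2 - p) * ln L \<le> 2 * \<Lambda>"
  proof (cases "L = 1")
    case False
    then have "L = 2 * \<Lambda> / (2 - p)" by (auto simp: L_def max_def)
    moreover have "ln L \<le> L" using L ln_bound[of L] by simp
    ultimately have "(2 - p) * ln L \<le> (2 - p) * (2 * \<Lambda> / (2 - p))"
      using assms by (intro mult_left_mono) auto
    then show ?thesis using assms(1) by simp
  qed (use assms in simp)
  then have "- 2 * \<Lambda> \<le> (p - 2) * ln L" by (simp add: algebra_simps)
  then show ?thesis using L by (simp add: powr_def)
qed

text \<open>
  The theorem for perturbations \<open>f\<close> without the modes \<open>0\<close> and \<open>\<plusminus>1\<close>. The pointwise lower bound is used with
  the constant \<open>\<kappa>\<close> where \<open>S < \<eta>\<close> and with almost the full constant elsewhere, where \<open>\<bar>f\<bar> \<le> \<gamma> / 2\<close> keeps the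
  ratio of the chords within \<open>\<tau>\<close> of one. The negative part of the second variation is carried to the other
  side as the finite quantity \<open>B\<close> and cancelled at the end, so that only nonnegative integrals occur.
\<close>

lemma balanced_energy_gap:
  fixes p \<Lambda> :: real
  assumes p: "1 < p" "p < 3" and \<Lambda>: "0 < \<Lambda>"
  defines "\<kappa> \<equiv> (p - 1) / 2 * exp (- 2 * \<Lambda>)"
  shows "\<exists>\<rho>>0. \<forall>f. continuous_on (sphere 0 1) f \<and> (\<forall>x\<in>sphere 0 1. \<bar>f x\<bar> \<le> \<rho>) \<and>
    fourier_coeff f 0 = 0 \<and> fourier_coeff f 1 = 0 \<and>
    (p < 2 \<longrightarrow> (\<forall>x\<in>sphere 0 1. \<forall>y\<in>sphere 0 1.
      dist (x * cis (f x)) (y * cis (f y)) \<le> 2 * \<Lambda> / (2 - p) * dist x y)) \<longrightarrow>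
    energy (1 / p) id + ennreal (\<kappa> / 16) * fractional_energy p f
    \<le> energy (1 / p) (\<lambda>x. x * cis (f x))"
proof -
  have \<kappa>: "0 < \<kappa>" "\<kappa> \<le> (p - 1) / 2"
    using p \<Lambda> mult_left_mono[of "exp (- 2 * \<Lambda>)" 1 "(p - 1) / 2"] by (auto simp: \<kappa>_def)
  have pp: "p - 1 \<le> p * (p - 1)" using p mult_right_mono[of 1 p "p - 1"] by simp
  define L where "L = max 1 (2 * \<Lambda> / (2 - p))"
  define w where "w = (\<lambda>\<eta> \<omega>::complex. if norm (\<omega> - 1) < \<eta> then \<kappa> / 2 else p * (p - 1) / 2 - \<kappa> / 16)"
  obtain \<eta> where \<eta>: "\<eta> > 0" and mult: "\<And>n. n \<ge> 2 \<Longrightarrow> \<kappa> / 16 * chord_moment (p - 4) n + p\<^sup>2 / 8 * chord_moment (p - 2) n \<le>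
    (\<integral>\<omega>. w \<eta> \<omega> * (norm (\<omega> - 1) powr (p - 4) * (1 - Re (\<omega> ^ n))) \<partial>arclength)"
    using truncated_multiplier_coercive[OF p \<kappa>] unfolding w_def by blast
  obtain \<tau> where \<tau>: "\<tau> > 0" and near: "\<And>r. \<bar>r - 1\<bar> \<le> \<tau> \<Longrightarrow>
    1 + p * (r - 1) + (p * (p - 1) / 2 - \<kappa> / 32) * (r - 1)\<^sup>2 \<le> \<bar>r\<bar> powr p"
    using abs_powr_lower_near_one[OF p(1), of "\<kappa> / 32"] \<kappa> by auto
  \<comment> \<open>The loss \<open>2 * \<gamma>\<close> has to fit between \<open>\<kappa> / 2\<close> and \<open>\<kappa>\<close> near the diagonal, between \<open>\<kappa> / 32\<close> and \<open>\<kappa> / 16\<close> elsewhere.\<close>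
  define \<gamma> where "\<gamma> = min (\<kappa> / 64) (\<tau> * \<eta>)"
  have \<gamma>: "0 < \<gamma>" "\<gamma> \<le> \<kappa> / 64" "\<gamma> \<le> \<tau> * \<eta>" "\<gamma> \<le> 1"
    using \<kappa> \<tau> \<eta> p by (auto simp: \<gamma>_def min_def)
  have half: "\<kappa> \<le> p * (p - 1) / 2" "0 \<le> p * (p - 1) / 2 - \<kappa> / 16" "0 \<le> p * (p - 1) / 2 - \<kappa> / 32"
  proof -
    define Q where "Q = p * (p - 1)"
    have "p - 1 \<le> Q" using pp by (simp add: Q_def)
    then have "\<kappa> \<le> Q / 2" "0 \<le> Q / 2 - \<kappa> / 16" "0 \<le> Q / 2 - \<kappa> / 32" using \<kappa> by auto
    then show "\<kappa> \<le> p * (p - 1) / 2" "0 \<le> p * (p - 1) / 2 - \<kappa> / 16" "0 \<le> p * (p - 1) / 2 - \<kappa> / 32"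
      by (simp_all only: Q_def)
  qed
  have w0: "0 \<le> w \<eta> \<omega>" for \<omega> using half \<kappa> by (simp add: w_def)
  have wm: "w \<eta> \<in> borel_measurable arclength"
    unfolding w_def by (intro borel_measurable_arclengthI) measurable
  have Sm: "(\<lambda>\<omega>::complex. norm (\<omega> - 1) powr a) \<in> borel_measurable arclength" for a
    by (intro borel_measurable_arclengthI) measurable
  have "energy (1 / p) id + ennreal (\<kappa> / 16) * fractional_energy p f
    \<le> energy (1 / p) (\<lambda>x. x * cis (f x))"
    if f: "continuous_on (sphere 0 1) f" and fb: "\<And>x. x \<in> sphere 0 1 \<Longrightarrow> \<bar>f x\<bar> \<le> \<gamma> / 2"
      and f0: "fourier_coeff f 0 = 0" and f1: "fourier_coeff f 1 = 0"
      and lip: "p < 2 \<Longrightarrow> (\<And>x y. x \<in> sphere 0 1 \<Longrightarrow> y \<in> sphere 0 1 \<Longrightarrow>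
        dist (x * cis (f x)) (y * cis (f y)) \<le> 2 * \<Lambda> / (2 - p) * dist x y)" for f
  proof -
    let ?S = "\<lambda>\<omega>::complex. norm (\<omega> - 1)"
    let ?G = "\<lambda>\<omega>. \<integral>y. (f (\<omega> * y) - f y)\<^sup>2 \<partial>arclength"
    let ?T = "\<lambda>\<omega>. \<integral>y. dist ((\<omega> * y) * cis (f (\<omega> * y))) (y * cis (f y)) powr p \<partial>arclength"
    define v where "v = (\<lambda>x. x * cis (f x))"
    have vc: "continuous_on (sphere 0 1) v"
      unfolding v_def by (intro continuous_on_mult continuous_on_id continuous_on_cis f)
    have lip': "dist (x * cis (f x)) (y * cis (f y)) \<le> L * dist x y"
      if "p < 2" "x \<in> sphere 0 1" "y \<in> sphere 0 1" for x y
      using lip[OF that] mult_right_mono[of "2 * \<Lambda> / (2 - p)" L "dist x y"] by (simp add: L_def)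
    have G0: "0 \<le> ?G \<omega>" for \<omega> by (intro integral_nonneg_AE) simp
    have conv_near: "1 + p * (r - 1) + \<kappa> * (r - 1)\<^sup>2 \<le> \<bar>r\<bar> powr p" if r: "p < 2 \<Longrightarrow> \<bar>r\<bar> \<le> L" for r
    proof (cases "p < 2")
      case True
      have "\<kappa> \<le> (p - 1) / 2 * L powr (p - 2)"
        unfolding \<kappa>_def L_def using p lipschitz_exponent_bound[OF True \<Lambda>] by (intro mult_left_mono) auto
      then have "\<kappa> * (r - 1)\<^sup>2 \<le> (p - 1) / 2 * L powr (p - 2) * (r - 1)\<^sup>2"
        by (intro mult_right_mono) auto
      then show ?thesis
        using abs_powr_lower_subquadratic[of p L r] p True r[OF True] by (simp add: L_def)
    next
      case False
      have "\<kappa> * (r - 1)\<^sup>2 \<le> p / 2 * (r - 1)\<^sup>2"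
        using \<kappa> by (intro mult_right_mono) auto
      then show ?thesis using abs_powr_lower_superquadratic[of p r] False by simp
    qed
    have real_ineq: "2 * pi * ?S \<omega> powr p + w \<eta> \<omega> * ?S \<omega> powr (p - 2) * ?G \<omega>
      \<le> ?T \<omega> + p\<^sup>2 / 8 * ?S \<omega> powr p * ?G \<omega>" if om: "norm \<omega> = 1" "\<omega> \<noteq> 1" for \<omega>
    proof -
      have ineq: "2 * pi * ?S \<omega> powr p + (W - 2 * \<gamma>) * ?S \<omega> powr (p - 2) * ?G \<omega>
        \<le> ?T \<omega> + p\<^sup>2 / 8 * ?S \<omega> powr p * ?G \<omega>"
        if "0 \<le> W" "W \<le> p * (p - 1) / 2" "\<And>r. \<bar>r - 1\<bar> * ?S \<omega> \<le> \<gamma> \<Longrightarrow> (p < 2 \<Longrightarrow> \<bar>r\<bar> \<le> L) \<Longrightarrow>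
          1 + p * (r - 1) + W * (r - 1)\<^sup>2 \<le> \<bar>r\<bar> powr p" for W
        by (rule chord_energy_increment_integrated[OF p f fb \<gamma>(4) om that(1,2) lip' that(3)])
      have "\<exists>W. w \<eta> \<omega> \<le> W - 2 * \<gamma> \<and> 0 \<le> W \<and> W \<le> p * (p - 1) / 2 \<and> (\<forall>r. \<bar>r - 1\<bar> * ?S \<omega> \<le> \<gamma> \<longrightarrow>
        (p < 2 \<longrightarrow> \<bar>r\<bar> \<le> L) \<longrightarrow> 1 + p * (r - 1) + W * (r - 1)\<^sup>2 \<le> \<bar>r\<bar> powr p)"
      proof (cases "?S \<omega> < \<eta>")
        case True
        then show ?thesis
          using \<kappa> \<gamma> half conv_near by (intro exI[of _ \<kappa>]) (auto simp: w_def)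
      next
        case False
        have "\<bar>r - 1\<bar> \<le> \<tau>" if "\<bar>r - 1\<bar> * ?S \<omega> \<le> \<gamma>" for r
        proof -
          have "\<bar>r - 1\<bar> * \<eta> \<le> \<bar>r - 1\<bar> * ?S \<omega>"
            using False by (intro mult_left_mono) auto
          then have "\<bar>r - 1\<bar> * \<eta> \<le> \<tau> * \<eta>" using that \<gamma>(3) by linarith
          then show ?thesis using \<eta> by simp
        qed
        then show ?thesis
          using \<kappa> \<gamma> half near False by (intro exI[of _ "p * (p - 1) / 2 - \<kappa> / 32"]) (auto simp: w_def)
      qed
      then obtain W where W: "w \<eta> \<omega> \<le> W - 2 * \<gamma>"
        and "2 * pi * ?S \<omega> powr p + (W - 2 * \<gamma>) * ?S \<omega> powr (p - 2) * ?G \<omega>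
          \<le> ?T \<omega> + p\<^sup>2 / 8 * ?S \<omega> powr p * ?G \<omega>"
        using ineq by blast
      moreover have "w \<eta> \<omega> * ?S \<omega> powr (p - 2) * ?G \<omega> \<le> (W - 2 * \<gamma>) * ?S \<omega> powr (p - 2) * ?G \<omega>"
        using W G0 by (intro mult_right_mono) auto
      ultimately show ?thesis by linarith
    qed
    have pointwise: "ennreal (2 * pi * ?S \<omega> powr (p - 2)) + ennreal (w \<eta> \<omega> * ?S \<omega> powr (p - 4)) * increment_energy f \<omega>
      \<le> ennreal (?T \<omega> / (?S \<omega>)\<^sup>2) + ennreal (p\<^sup>2 / 8 * ?S \<omega> powr (p - 2)) * increment_energy f \<omega>"
      if "norm \<omega> = 1" for \<omega>
    proof (cases "\<omega> = 1")
      case False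
      then have S: "?S \<omega> > 0" by simp
      have red: "?S \<omega> powr p = ?S \<omega> powr (p - 2) * (?S \<omega>)\<^sup>2" "?S \<omega> powr (p - 2) = ?S \<omega> powr (p - 4) * (?S \<omega>)\<^sup>2"
        using powr_minus_two_mult_square[of "?S \<omega>" p] powr_minus_two_mult_square[of "?S \<omega>" "p - 2"] by simp_all
      have "(2 * pi * ?S \<omega> powr (p - 2) + w \<eta> \<omega> * ?S \<omega> powr (p - 4) * ?G \<omega>) * (?S \<omega>)\<^sup>2
        = 2 * pi * ?S \<omega> powr p + w \<eta> \<omega> * ?S \<omega> powr (p - 2) * ?G \<omega>"
        unfolding red(1) by (subst (3) red(2)) (simp only: distrib_left distrib_right mult_ac)
      also have "\<dots> \<le> ?T \<omega> + p\<^sup>2 / 8 * ?S \<omega> powr p * ?G \<omega>"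
        by (rule real_ineq[OF that False])
      also have "\<dots> = (?T \<omega> / (?S \<omega>)\<^sup>2 + p\<^sup>2 / 8 * ?S \<omega> powr (p - 2) * ?G \<omega>) * (?S \<omega>)\<^sup>2"
        unfolding red(1) using S by (simp add: distrib_right)
      finally have "2 * pi * ?S \<omega> powr (p - 2) + w \<eta> \<omega> * ?S \<omega> powr (p - 4) * ?G \<omega>
        \<le> ?T \<omega> / (?S \<omega>)\<^sup>2 + p\<^sup>2 / 8 * ?S \<omega> powr (p - 2) * ?G \<omega>"
        using S by (simp add: mult_le_cancel_right)
      moreover have "0 \<le> ?T \<omega>" by (intro integral_nonneg_AE) simp
      ultimately show ?thesis
        unfolding increment_energy_eq[OF f that]
        using w0[of \<omega>] G0[of \<omega>]
        by (simp add: ennreal_mult'[symmetric] ennreal_plus[symmetric] ennreal_leI del: ennreal_plus)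
    qed simp
    define B where "B = (\<integral>\<^sup>+ \<omega>. ennreal (p\<^sup>2 / 8 * ?S \<omega> powr (p - 2)) * increment_energy f \<omega> \<partial>arclength)"
    define D where "D = (\<integral>\<^sup>+ \<omega>. ennreal (?S \<omega> powr (p - 4)) * increment_energy f \<omega> \<partial>arclength)"
    note gm = increment_energy_measurable[OF f]
    have Ev: "energy (1 / p) v = (\<integral>\<^sup>+ \<omega>. ennreal (?T \<omega> / (?S \<omega>)\<^sup>2) \<partial>arclength)"
      using energy_rotate[OF vc, of "1 / p"] p by (simp add: v_def)
    have Ei: "energy (1 / p) id = (\<integral>\<^sup>+ \<omega>. ennreal (2 * pi * ?S \<omega> powr (p - 2)) \<partial>arclength)"
      using energy_id[of "1 / p"] p by simp
    have m1: "(\<lambda>\<omega>. ennreal (?T \<omega> / (?S \<omega>)\<^sup>2)) \<in> borel_measurable arclength"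
    proof -
      note [measurable] = continuous_borel_measurable_arclength[OF vc]
        circle_pair_measurable[OF continuous_borel_measurable_arclength[OF vc]]
      have "(\<lambda>(\<omega>, y). dist ((\<lambda>(\<omega>, y). v (\<omega> * y)) (\<omega>, y)) (v y) powr p) \<in> borel_measurable (arclength \<Otimes>\<^sub>M arclength)"
        by measurable
      then have "(\<lambda>\<omega>. \<integral>y. dist (v (\<omega> * y)) (v y) powr p \<partial>arclength) \<in> borel_measurable arclength"
        by (intro arclength.borel_measurable_lebesgue_integral) simp
      then have "?T \<in> borel_measurable arclength" by (simp add: v_def)
      moreover have "(\<lambda>\<omega>::complex. (?S \<omega>)\<^sup>2) \<in> borel_measurable arclength"
        by (intro borel_measurable_arclengthI) measurable
      ultimately show ?thesis by measurable
    qed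
    have m2: "(\<lambda>\<omega>. ennreal (2 * pi * ?S \<omega> powr (p - 2))) \<in> borel_measurable arclength"
      using Sm by measurable
    have m3: "(\<lambda>\<omega>. ennreal (p\<^sup>2 / 8 * ?S \<omega> powr (p - 2)) * increment_energy f \<omega>) \<in> borel_measurable arclength"
      using Sm gm by measurable
    have m4: "(\<lambda>\<omega>. ennreal (w \<eta> \<omega> * ?S \<omega> powr (p - 4)) * increment_energy f \<omega>) \<in> borel_measurable arclength"
      using Sm gm wm by measurable
    have upper: "energy (1 / p) id + (\<integral>\<^sup>+ \<omega>. ennreal (w \<eta> \<omega> * ?S \<omega> powr (p - 4)) * increment_energy f \<omega> \<partial>arclength)
      \<le> energy (1 / p) v + B"
    proof -
      have "(\<integral>\<^sup>+ \<omega>. ennreal (2 * pi * ?S \<omega> powr (p - 2)) + ennreal (w \<eta> \<omega> * ?S \<omega> powr (p - 4)) * increment_energy f \<omega> \<partial>arclength)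
        \<le> (\<integral>\<^sup>+ \<omega>. ennreal (?T \<omega> / (?S \<omega>)\<^sup>2) + ennreal (p\<^sup>2 / 8 * ?S \<omega> powr (p - 2)) * increment_energy f \<omega> \<partial>arclength)"
        by (intro nn_integral_mono pointwise) simp
      also have "\<dots> = energy (1 / p) v + B"
        unfolding Ev B_def by (rule nn_integral_add) (use m1 m3 in simp_all)
      also have "(\<integral>\<^sup>+ \<omega>. ennreal (2 * pi * ?S \<omega> powr (p - 2)) + ennreal (w \<eta> \<omega> * ?S \<omega> powr (p - 4)) * increment_energy f \<omega> \<partial>arclength)
        = energy (1 / p) id + (\<integral>\<^sup>+ \<omega>. ennreal (w \<eta> \<omega> * ?S \<omega> powr (p - 4)) * increment_energy f \<omega> \<partial>arclength)"
        unfolding Ei by (rule nn_integral_add) (use m2 m4 in simp_all)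
      finally show ?thesis .
    qed
    have lower: "ennreal (\<kappa> / 16) * D + B \<le> (\<integral>\<^sup>+ \<omega>. ennreal (w \<eta> \<omega> * ?S \<omega> powr (p - 4)) * increment_energy f \<omega> \<partial>arclength)"
      unfolding D_def B_def
      using \<kappa> by (intro invariant_form_coercive f f0 f1 wm w0 p mult) auto
    have Bfin: "B < \<infinity>"
    proof -
      have g1: "increment_energy f \<omega> \<le> ennreal (2 * pi)" if "norm \<omega> = 1" for \<omega>
      proof -
        have "increment_energy f \<omega> \<le> (\<integral>\<^sup>+ y. 1 \<partial>arclength)"
          unfolding increment_energy_def
        proof (rule nn_integral_mono)
          fix y :: complex assume "y \<in> space arclength"
          then have "\<bar>f y\<bar> \<le> \<gamma> / 2" "\<bar>f (\<omega> * y)\<bar> \<le> \<gamma> / 2"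
            using that fb[of y] fb[of "\<omega> * y"] by (auto simp: norm_mult)
          then have "\<bar>f (\<omega> * y) - f y\<bar> \<le> 1" using \<gamma>(4) by linarith
          then have "(f (\<omega> * y) - f y)\<^sup>2 \<le> 1" by (simp add: abs_square_le_1)
          then show "ennreal ((f (\<omega> * y) - f y)\<^sup>2) \<le> 1" by simp
        qed
        then show ?thesis by (simp add: emeasure_arclength_sphere)
      qed
      have "B \<le> (\<integral>\<^sup>+ \<omega>. ennreal (p\<^sup>2 / 8 * ?S \<omega> powr (p - 2)) * ennreal (2 * pi) \<partial>arclength)"
        unfolding B_def by (intro nn_integral_mono mult_left_mono g1) auto
      also have "\<dots> = (\<integral>\<^sup>+ \<omega>. ennreal (p\<^sup>2 / 8 * ?S \<omega> powr (p - 2)) \<partial>arclength) * ennreal (2 * pi)"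
        by (rule nn_integral_multc) (use Sm in measurable)
      also have "(\<integral>\<^sup>+ \<omega>. ennreal (p\<^sup>2 / 8 * ?S \<omega> powr (p - 2)) \<partial>arclength) = ennreal (\<integral>\<omega>. p\<^sup>2 / 8 * ?S \<omega> powr (p - 2) \<partial>arclength)"
        using p by (intro nn_integral_eq_integral integrable_mult_right integrable_chord_powr) auto
      finally show ?thesis
        by (rule le_less_trans) (simp add: ennreal_mult_eq_top_iff less_top[symmetric])
    qed
    have "energy (1 / p) id + (ennreal (\<kappa> / 16) * D + B) \<le> energy (1 / p) v + B"
      using order_trans[OF add_left_mono[OF lower] upper] .
    then have "B + (energy (1 / p) id + ennreal (\<kappa> / 16) * D) \<le> B + energy (1 / p) v"
      by (simp only: add_ac)
    then have "energy (1 / p) id + ennreal (\<kappa> / 16) * D \<le> energy (1 / p) v"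
      using Bfin unfolding ennreal_add_left_cancel_le by auto
    moreover have "fractional_energy p f = D"
      unfolding D_def by (rule fractional_energy_rotate[OF f])
    ultimately show ?thesis by (simp add: v_def)
  qed
  then show ?thesis using \<gamma>(1) by (intro exI[of _ "\<gamma> / 2"]) auto
qed

section \<open>Uniform closeness and Moebius balancing\<close>

text \<open>
  All points \<open>x0 * cis \<theta>\<close> with \<open>0 \<le> \<theta> \<le> r\<close> are within distance \<open>r\<close> of \<open>x0\<close>.
\<close>

lemma emeasure_arc_ge:
  assumes x0: "norm x0 = 1" and r: "0 < r" "r \<le> 1"
  shows "ennreal r \<le> emeasure arclength {x \<in> sphere 0 1. dist x x0 \<le> r}"
    and "{x \<in> sphere 0 1. dist x x0 \<le> r} \<in> sets arclength"
proof -
  have meas: "{x \<in> sphere 0 1. dist x y \<le> r} \<in> sets arclength" for y :: complex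
  proof -
    have "{x \<in> space arclength. dist x y \<le> r} \<in> sets arclength" by measurable
    then show ?thesis by simp
  qed
  then show "{x \<in> sphere 0 1. dist x x0 \<le> r} \<in> sets arclength" .
  define F :: "complex \<Rightarrow> ennreal" where "F = indicator {x \<in> sphere 0 1. dist x x0 \<le> r}"
  have Fm: "F \<in> borel_measurable arclength" unfolding F_def using meas[of x0] by simp
  have "(\<integral>\<^sup>+\<theta>. indicator {0..r} \<theta> \<partial>lborel) \<le> (\<integral>\<^sup>+\<theta>. F (x0 * cis \<theta>) * indicator {0..<2 * pi} \<theta> \<partial>lborel)"
  proof (rule nn_integral_mono)
    fix \<theta> :: real
    show "indicator {0..r} \<theta> \<le> F (x0 * cis \<theta>) * indicator {0..<2 * pi} \<theta>"
    proof (cases "\<theta> \<in> {0..r}")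
      case True
      then have "\<theta> < 2 * pi" using r pi_gt3 by simp
      have "dist (x0 * cis \<theta>) x0 = norm (cis \<theta> - 1)"
        using dist_rotate[OF x0, of "cis \<theta>"] by (simp add: mult.commute)
      also have "\<dots> \<le> 2 * \<bar>\<theta> / 2\<bar>"
        unfolding norm_cis_minus_one using abs_sin_x_le_abs_x[of "\<theta> / 2"] by (simp add: abs_mult)
      also have "\<dots> \<le> r" using True by simp
      finally have "F (x0 * cis \<theta>) = 1" using x0 by (simp add: F_def norm_mult)
      then show ?thesis using True \<open>\<theta> < 2 * pi\<close> by simp
    qed simp
  qed
  also have "\<dots> = (\<integral>\<^sup>+x. F (x0 * x) \<partial>arclength)"
    by (rule nn_integral_arclength[symmetric])
       (rule measurable_compose[OF rotation_measurable[OF x0] Fm])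
  also have "\<dots> = (\<integral>\<^sup>+x. F x \<partial>arclength)"
    by (rule nn_integral_arclength_rotate[OF Fm x0])
  also have "\<dots> = emeasure arclength {x \<in> sphere 0 1. dist x x0 \<le> r}"
    unfolding F_def using meas[of x0] by simp
  finally show "ennreal r \<le> emeasure arclength {x \<in> sphere 0 1. dist x x0 \<le> r}"
    using r by simp
qed

text \<open>
  Let \<open>w = u - id\<close>. If \<open>w\<close> takes values \<open>3 * k\<close> apart at two points, then, by the Hoelder bound, it
  takes values \<open>k\<close> apart on the product of two arcs of length at least \<open>r\<close>, and the seminorm has a lower
  bound that depends on \<open>k\<close> and \<open>r\<close> only. So a small seminorm forces \<open>w\<close> to be nearly a constant \<open>c\<close>. The
  seminorm does not see \<open>c\<close>, but \<open>u\<close> takes values on the unit circle, and at the point \<open>c / norm c\<close> this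
  makes \<open>c\<close> small.
\<close>

lemma sobolev_close_imp_uniformly_close:
  fixes \<Lambda> \<alpha> t \<rho> :: real
  assumes "\<Lambda> > 0" "\<alpha> > 0" "t > 0" "\<rho> > 0"
  shows "\<exists>\<delta>>0. \<forall>u. continuous_on (sphere 0 1) u \<and> (\<forall>x\<in>sphere 0 1. norm (u x) = 1) \<and>
    (\<forall>x\<in>sphere 0 1. \<forall>y\<in>sphere 0 1. dist (u x) (u y) \<le> \<Lambda> * dist x y powr \<alpha>) \<and>
    sobolev_seminorm t (1 / t) (\<lambda>z. u z - z) \<le> ennreal \<delta> \<longrightarrow>
    (\<forall>x\<in>sphere 0 1. norm (u x - x) \<le> \<rho>)"
proof -
  \<comment> \<open>Half of the \<open>6\<close> is for the oscillation of \<open>u - id\<close>, half for the constant it is close to.\<close>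
  define k where "k = \<rho> / 6"
  have k: "k > 0" using assms by (simp add: k_def)
  define r where "r = min 1 (min (k / 2) ((k / (2 * \<Lambda>)) powr (1 / \<alpha>)))"
  have r: "0 < r" "r \<le> 1" "r \<le> k / 2" "r powr \<alpha> \<le> k / (2 * \<Lambda>)"
  proof -
    show "0 < r" "r \<le> 1" "r \<le> k / 2" using k assms by (auto simp: r_def)
    have "r powr \<alpha> \<le> ((k / (2 * \<Lambda>)) powr (1 / \<alpha>)) powr \<alpha>"
      using assms \<open>0 < r\<close> by (intro powr_mono2) (auto simp: r_def)
    also have "\<dots> = k / (2 * \<Lambda>)" using assms k by (simp add: powr_powr)
    finally show "r powr \<alpha> \<le> k / (2 * \<Lambda>)" .
  qed
  \<comment> \<open>A lower bound for the double integral if two values of \<open>u - id\<close> are \<open>3 * k\<close> apart; \<open>4\<close> bounds \<open>(dist x y)\<^sup>2\<close>.\<close>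
  define m where "m = k powr (1 / t) / 4 * r\<^sup>2"
  have m: "m > 0" using k r by (simp add: m_def)
  define \<delta> where "\<delta> = m powr t / 2"
  have d: "\<delta> > 0" using m by (simp add: \<delta>_def)
  have "norm (u x - x) \<le> \<rho>" if uc: "continuous_on (sphere 0 1) u" and u1: "\<And>x. x \<in> sphere 0 1 \<Longrightarrow> norm (u x) = 1"
    and uh: "\<And>x y. x \<in> sphere 0 1 \<Longrightarrow> y \<in> sphere 0 1 \<Longrightarrow> dist (u x) (u y) \<le> \<Lambda> * dist x y powr \<alpha>"
    and us: "sobolev_seminorm t (1 / t) (\<lambda>z. u z - z) \<le> ennreal \<delta>" and x: "x \<in> sphere 0 1" for u x
  proof -
    define w where "w = (\<lambda>z. u z - z)"
    have modulus: "dist (w x) (w y) \<le> k" if xy: "x \<in> sphere 0 1" "y \<in> sphere 0 1" "dist x y \<le> r" for x y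
    proof -
      have "dist x y powr \<alpha> \<le> k / (2 * \<Lambda>)"
        using powr_mono2[of \<alpha> "dist x y" r] xy r assms by simp
      then have "\<Lambda> * dist x y powr \<alpha> \<le> k / 2"
        using assms by (simp add: field_simps)
      then have "dist (u x) (u y) \<le> k / 2" using uh[OF xy(1,2)] by linarith
      moreover have "dist (w x) (w y) \<le> dist (u x) (u y) + dist x y"
        using norm_triangle_ineq4[of "u x - u y" "x - y"] by (simp add: w_def dist_norm algebra_simps)
      ultimately show ?thesis using xy r by linarith
    qed
    have osc: "dist (w x) (w y) \<le> 3 * k" if xy: "x \<in> sphere 0 1" "y \<in> sphere 0 1" for x y
    proof (rule ccontr)
      assume far: "\<not> dist (w x) (w y) \<le> 3 * k"
      define A where "A = (\<lambda>x::complex. {z \<in> sphere 0 1. dist z x \<le> r})"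
      define X where "X = (\<integral>\<^sup>+ (x, y). ennreal (dist (w x) (w y) powr (1 / t) / dist x y powr 2) \<partial>(arclength \<Otimes>\<^sub>M arclength))"
      have A: "ennreal r \<le> emeasure arclength (A z)" "A z \<in> sets arclength" if "z \<in> sphere 0 1" for z
        using emeasure_arc_ge[of z r] r that by (simp_all add: A_def)
      have "ennreal m = ennreal (k powr (1 / t) / 4) * (ennreal r * ennreal r)"
        using r by (simp add: m_def ennreal_mult[symmetric] power2_eq_square)
      also have "\<dots> \<le> ennreal (k powr (1 / t) / 4) * (emeasure arclength (A x) * emeasure arclength (A y))"
        using A xy by (intro mult_mono) auto
      also have "\<dots> = ennreal (k powr (1 / t) / 4) * emeasure (arclength \<Otimes>\<^sub>M arclength) (A x \<times> A y)"
        using A xy by (simp add: arclength.emeasure_pair_measure_Times)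
      also have "\<dots> = (\<integral>\<^sup>+ z. ennreal (k powr (1 / t) / 4) * indicator (A x \<times> A y) z \<partial>(arclength \<Otimes>\<^sub>M arclength))"
        using A xy by (intro nn_integral_cmult_indicator[symmetric]) auto
      also have "\<dots> \<le> X"
        unfolding X_def
      proof (rule nn_integral_mono)
        fix z :: "complex \<times> complex"
        obtain x' y' where z: "z = (x', y')" by (cases z)
        show "ennreal (k powr (1 / t) / 4) * indicator (A x \<times> A y) z \<le>
          (case z of (x, y) \<Rightarrow> ennreal (dist (w x) (w y) powr (1 / t) / dist x y powr 2))"
        proof (cases "z \<in> A x \<times> A y")
          case True
          then have x'y': "x' \<in> sphere 0 1" "dist x' x \<le> r" "y' \<in> sphere 0 1" "dist y' y \<le> r"
            by (auto simp: z A_def)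
          have "dist (w x') (w x) \<le> k" "dist (w y') (w y) \<le> k"
            using x'y' xy by (auto intro: modulus)
          moreover have "dist (w x) (w y) \<le> dist (w x') (w x) + dist (w x') (w y') + dist (w y') (w y)"
            using dist_triangle[of "w x" "w y" "w x'"] dist_triangle[of "w x'" "w y" "w y'"] by (simp add: dist_commute)
          ultimately have kd: "k \<le> dist (w x') (w y')" using far by linarith
          then have ne: "dist x' y' > 0" using k by auto
          have d2: "dist x' y' \<le> 2"
            using x'y' norm_triangle_ineq4[of x' y'] by (simp add: dist_norm)
          have "dist x' y' powr 2 = (dist x' y')\<^sup>2" using ne by simp
          also have "\<dots> \<le> 2\<^sup>2" using d2 by (intro power_mono) auto
          finally have "dist x' y' powr 2 \<le> 4" by simp
          moreover have "k powr (1 / t) \<le> dist (w x') (w y') powr (1 / t)"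
            using kd k assms by (intro powr_mono2) auto
          ultimately have "k powr (1 / t) / 4 \<le> dist (w x') (w y') powr (1 / t) / dist x' y' powr 2"
            using ne by (intro frac_le) auto
          then show ?thesis using True by (simp add: z ennreal_leI)
        qed simp
      qed
      finally have mX: "ennreal m \<le> X" .
      have "sobolev_seminorm t (1 / t) w = ennreal_powr X t"
        using assms by (simp add: sobolev_seminorm_def X_def)
      then have le: "ennreal_powr X t \<le> ennreal \<delta>" using us by (simp add: w_def)
      show False
      proof (cases "X = \<infinity>")
        case True
        then show ?thesis using le by (simp add: ennreal_powr_def top_unique)
      next
        case False
        then have "m \<le> enn2real X"
          using mX m by (cases X) (auto simp: less_imp_le)
        then have "m powr t \<le> enn2real X powr t"
          using m assms by (intro powr_mono2) auto
        then have "2 * \<delta> \<le> enn2real X powr t" by (simp add: \<delta>_def)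
        moreover have "enn2real X powr t \<le> \<delta>"
          using le False d by (simp add: ennreal_powr_def)
        ultimately show False using d by simp
      qed
    qed
    define c where "c = w 1"
    have wc: "norm (w x - c) \<le> 3 * k" if "x \<in> sphere 0 1" for x
      using osc[OF that, of 1] by (simp add: c_def dist_norm)
    have "norm c \<le> 3 * k"
    proof (cases "c = 0")
      case False
      define e where "e = c / norm c"
      have e: "norm e = 1" "c = norm c * e" using False by (auto simp: e_def norm_divide)
      have "e + c = of_real (1 + norm c) * e"
        using arg_cong[OF e(2), of "\<lambda>z. e + z"] by (simp add: algebra_simps)
      then have "norm (e + c) = \<bar>1 + norm c\<bar> * norm e"
        by (simp only: norm_mult norm_of_real)
      then have "norm (e + c) = 1 + norm c"
        using e(1) by simp
      moreover have "norm (e + c) \<le> norm (u e) + norm (w e - c)"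
        using norm_triangle_ineq4[of "u e" "w e - c"] by (simp add: w_def algebra_simps)
      ultimately show ?thesis using u1[of e] wc[of e] e(1) by simp
    qed (use k in simp)
    then have "norm (w x) \<le> 6 * k"
      using wc[OF x] norm_triangle_ineq[of "w x - c" c] by simp
    then show ?thesis by (simp add: w_def k_def)
  qed
  then show ?thesis using d by blast
qed

text \<open>
  The quotient of \<open>u x\<close> and \<open>x\<close> stays in the right half-plane, where the principal logarithm is continuous.
\<close>

lemma circle_angle_function:
  fixes u :: "complex \<Rightarrow> complex"
  assumes u: "continuous_on (sphere 0 1) u" "\<And>x. x \<in> sphere 0 1 \<Longrightarrow> norm (u x) = 1"
    and close: "\<And>x. x \<in> sphere 0 1 \<Longrightarrow> norm (u x - x) \<le> \<rho>" and \<rho>: "\<rho> \<le> 1 / 2"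
  obtains f where "continuous_on (sphere 0 1) f" "\<And>x. x \<in> sphere 0 1 \<Longrightarrow> u x = x * cis (f x)"
    "\<And>x. x \<in> sphere 0 1 \<Longrightarrow> \<bar>f x\<bar> \<le> 2 * \<rho>"
proof -
  define z where "z = (\<lambda>x. u x * cnj x)"
  have z: "norm (z x) = 1" "norm (z x - 1) \<le> \<rho>" "u x = x * z x" if x: "x \<in> sphere 0 1" for x
  proof -
    have xx: "x * cnj x = 1" using x by (simp add: complex_norm_square[symmetric])
    show "norm (z x) = 1" using u(2)[OF x] x by (simp add: z_def norm_mult)
    have "z x - 1 = (u x - x) * cnj x" using xx by (simp add: z_def algebra_simps)
    then show "norm (z x - 1) \<le> \<rho>" using close[OF x] x by (simp add: norm_mult)
    show "u x = x * z x" using xx by (simp add: z_def)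
  qed
  have Re: "Re (z x) > 0" if "x \<in> sphere 0 1" for x
    using z(2)[OF that] \<rho> abs_Re_le_cmod[of "z x - 1"] by simp
  define f where "f = (\<lambda>x. Im (Ln (z x)))"
  show ?thesis
  proof (rule that[of f])
    show "continuous_on (sphere 0 1) f"
      unfolding f_def
    proof (intro continuous_on_Im continuous_on_Ln')
      show "continuous_on (sphere 0 1) z" unfolding z_def by (intro continuous_intros u(1))
      show "z x \<notin> \<real>\<^sub>\<le>\<^sub>0" if "x \<in> sphere 0 1" for x
        using Re[OF that] by (auto simp: complex_nonpos_Reals_iff)
    qed
    fix x :: complex assume x: "x \<in> sphere 0 1"
    have "z x \<noteq> 0" using z(1)[OF x] by auto
    then have "cis (f x) = z x"
      using exp_Ln[of "z x"] Re_Ln[of "z x"] z(1)[OF x] by (simp add: f_def exp_eq_polar)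
    then show "u x = x * cis (f x)" using z(3)[OF x] by simp
    have n: "norm (z x - 1) \<le> 1 / 2" using z(2)[OF x] \<rho> by simp
    have "norm (Ln (z x) - (z x - 1)) \<le> (norm (z x - 1))\<^sup>2 / (1 - norm (z x - 1))"
      using Ln_approx_linear[of "z x - 1"] n by simp
    also have "\<dots> \<le> norm (z x - 1)"
    proof -
      have "norm (z x - 1) * norm (z x - 1) \<le> norm (z x - 1) * (1 - norm (z x - 1))"
        using n by (intro mult_left_mono) auto
      then show ?thesis using n by (simp add: divide_le_eq power2_eq_square)
    qed
    finally have "norm (Ln (z x)) \<le> 2 * norm (z x - 1)"
      using norm_triangle_ineq[of "Ln (z x) - (z x - 1)" "z x - 1"] by simp
    then show "\<bar>f x\<bar> \<le> 2 * \<rho>"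
      using abs_Im_le_cmod[of "Ln (z x)"] z(2)[OF x] by (simp add: f_def)
  qed
qed

text \<open>
  The angle by which the Moebius map turns a point of the circle; see \<open>moebius_map_eq_cis\<close>.
\<close>

definition moebius_angle :: "complex \<Rightarrow> complex \<Rightarrow> real" where
  "moebius_angle b x = 2 * Im (Ln (1 + b * cnj x))"

lemma moebius_denominator:
  assumes "norm b < 1" "norm x = 1"
  shows "Re (1 + b * cnj x) > 0" "1 + cnj b * x \<noteq> 0"
proof -
  have n: "norm (b * cnj x) < 1" using assms by (simp add: norm_mult)
  then show "Re (1 + b * cnj x) > 0" using abs_Re_le_cmod[of "b * cnj x"] by simp
  then have "1 + b * cnj x \<noteq> 0" by (metis less_irrefl zero_complex.sel(1))
  then show "1 + cnj b * x \<noteq> 0" by (metis complex_cnj_add complex_cnj_cnj complex_cnj_mult complex_cnj_one complex_cnj_zero_iff)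
qed

text \<open>
  On the circle the Moebius map is \<open>x * w / cnj w\<close> with \<open>w = 1 + b * cnj x\<close>.
\<close>

lemma moebius_map_eq_cis:
  assumes b: "norm b < 1" and x: "norm x = 1"
  shows "moebius_map b x = x * cis (moebius_angle b x)"
proof -
  define w where "w = 1 + b * cnj x"
  have w0: "w \<noteq> 0" using moebius_denominator(1)[OF assms] unfolding w_def by (metis less_irrefl zero_complex.sel(1))
  have "cis (Im (Ln w)) = w / norm w"
    using exp_Ln[OF w0] Re_Ln[OF w0] w0 by (simp add: exp_eq_polar field_simps)
  then have "cis (2 * Im (Ln w)) = (w / norm w)\<^sup>2"
    using Complex.DeMoivre[of "Im (Ln w)" 2] by simp
  also have "\<dots> = w\<^sup>2 / (w * cnj w)" using complex_norm_square[of w] by (simp add: power_divide)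
  also have "\<dots> = w / cnj w" using w0 by (simp add: power2_eq_square)
  finally have "x * cis (moebius_angle b x) = x * w / cnj w"
    by (simp add: moebius_angle_def w_def)
  moreover have "x * cnj x = 1" using x by (simp add: complex_norm_square[symmetric])
  then have "x * w = x + b" by (simp add: w_def algebra_simps)
  moreover have "cnj w = 1 + cnj b * x" by (simp add: w_def)
  ultimately show ?thesis by (simp add: moebius_map_def)
qed

lemma norm_moebius_map: "norm b < 1 \<Longrightarrow> norm x = 1 \<Longrightarrow> norm (moebius_map b x) = 1"
  by (simp add: moebius_map_eq_cis norm_mult)

lemma moebius_angle_approx:
  assumes b: "norm b \<le> 1 / 2" and x: "norm x = 1"
  shows "\<bar>moebius_angle b x - 2 * Im (b * cnj x)\<bar> \<le> 4 * (norm b)\<^sup>2"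
proof -
  let ?w = "b * cnj x"
  have n: "norm ?w = norm b" using x by (simp add: norm_mult)
  have "norm (Ln (1 + ?w) - ?w) \<le> (norm b)\<^sup>2 / (1 - norm b)"
    using Ln_approx_linear[of ?w] n b by simp
  also have "\<dots> \<le> (norm b)\<^sup>2 / (1 / 2)" using b by (intro divide_left_mono) auto
  also have "\<dots> = 2 * (norm b)\<^sup>2" by simp
  finally have "\<bar>Im (Ln (1 + ?w) - ?w)\<bar> \<le> 2 * (norm b)\<^sup>2"
    using abs_Im_le_cmod[of "Ln (1 + ?w) - ?w"] by linarith
  then show ?thesis by (simp add: moebius_angle_def abs_if split: if_splits)
qed

lemma dist_moebius_map_le:
  assumes b: "norm b \<le> 1 / 3" and x: "norm x = 1" and y: "norm y = 1"
  shows "dist (moebius_map b x) (moebius_map b y) \<le> 2 * dist x y"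
proof -
  have low: "1 - norm b \<le> norm (1 + cnj b * z)" if "norm z = 1" for z
    using norm_triangle_ineq4[of "1 + cnj b * z" "cnj b * z"] that by (simp add: norm_mult)
  have nz: "1 + cnj b * x \<noteq> 0" "1 + cnj b * y \<noteq> 0"
    using moebius_denominator(2)[of b] assms by auto
  have "moebius_map b x - moebius_map b y = (1 - b * cnj b) * (x - y) / ((1 + cnj b * x) * (1 + cnj b * y))"
    using nz by (simp add: moebius_map_def diff_frac_eq) (simp add: algebra_simps)
  also have "1 - b * cnj b = of_real (1 - (norm b)\<^sup>2)"
    using complex_norm_square[of b] by simp
  finally have eq: "dist (moebius_map b x) (moebius_map b y) =
     \<bar>1 - (norm b)\<^sup>2\<bar> * dist x y / (norm (1 + cnj b * x) * norm (1 + cnj b * y))"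
    by (simp add: dist_norm norm_mult norm_divide del: of_real_diff)
  have b1: "1 - norm b > 0" using b by simp
  have "\<bar>1 - (norm b)\<^sup>2\<bar> = (1 - norm b) * (1 + norm b)"
    using b power_mono[of "norm b" 1 2] by (simp add: power2_eq_square algebra_simps)
  also have "\<dots> \<le> 2 * ((1 - norm b) * (1 - norm b))"
    using mult_left_mono[of "1 + norm b" "2 * (1 - norm b)" "1 - norm b"] b by simp
  also have "\<dots> \<le> 2 * (norm (1 + cnj b * x) * norm (1 + cnj b * y))"
    using low[OF x] low[OF y] b1 by (intro mult_left_mono mult_mono) auto
  finally have "\<bar>1 - (norm b)\<^sup>2\<bar> * dist x y \<le> 2 * (norm (1 + cnj b * x) * norm (1 + cnj b * y)) * dist x y"
    by (intro mult_right_mono) auto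
  then show ?thesis unfolding eq using nz by (simp add: divide_le_eq mult_ac)
qed

lemma continuous_on_moebius_angle:
  "continuous_on {(b, x). norm b < 1 \<and> norm x = 1} (\<lambda>(b, x). moebius_angle b x)"
  unfolding moebius_angle_def case_prod_unfold
proof (intro continuous_intros)
  fix z :: "complex \<times> complex" assume "z \<in> {z. norm (fst z) < 1 \<and> norm (snd z) = 1}"
  then show "1 + fst z * cnj (snd z) \<notin> \<real>\<^sub>\<le>\<^sub>0"
    using moebius_denominator(1)[of "fst z" "snd z"] by (auto simp: complex_nonpos_Reals_iff)
qed

lemma continuous_on_moebius_map:
  "continuous_on {(b, x). norm b < 1 \<and> norm x = 1} (\<lambda>(b, x). moebius_map b x)"
  unfolding moebius_map_def case_prod_unfold
  by (intro continuous_intros) (use moebius_denominator(2) in auto)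

text \<open>
  The angle function of \<open>x \<mapsto> moebius_map b x * cis (f0 (moebius_map b x))\<close> is
  \<open>F b = moebius_angle b + f0 \<circ> moebius_map b\<close>. Its first coefficient is \<open>- \<i> * 2 * pi * b\<close> up to an error of order
  \<open>(norm b)\<^sup>2\<close> and the size of \<open>f0\<close>. Solving for \<open>b\<close> is a fixed point problem for a continuous map \<open>T\<close> of a
  small ball into itself, and Brouwer's theorem applies. The mean is then removed by a rotation, which
  turns the vanishing first coefficient by a factor only.
\<close>

lemma moebius_balancing:
  fixes \<rho> :: real
  assumes "\<rho> > 0"
  shows "\<exists>\<kappa>>0. \<forall>f0. continuous_on (sphere 0 1) f0 \<and> (\<forall>x\<in>sphere 0 1. \<bar>f0 x\<bar> \<le> \<kappa>) \<longrightarrow>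
    (\<exists>a b f. norm a = 1 \<and> norm b \<le> \<rho> \<and> norm b \<le> 1 / 3 \<and>
      continuous_on (sphere 0 1) f \<and> (\<forall>x\<in>sphere 0 1. \<bar>f x\<bar> \<le> \<rho>) \<and>
      fourier_coeff f 0 = 0 \<and> fourier_coeff f 1 = 0 \<and>
      (\<forall>x\<in>sphere 0 1. moebius_map b (a * x) * cis (f0 (moebius_map b (a * x))) = x * cis (f x)))"
proof -
  \<comment> \<open>The balanced angle function is bounded by \<open>8 * r\<close>: \<open>4 * r\<close> for \<open>F b\<close> and as much for its mean.\<close>
  define r where "r = min (1 / 8) (\<rho> / 8)"
  have r: "0 < r" "r \<le> 1 / 8" "8 * r \<le> \<rho>" using assms by (auto simp: r_def)
  have r2: "4 * r\<^sup>2 \<le> r / 2"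
    using r mult_right_mono[of r "1 / 8" r] by (simp add: power2_eq_square)
  have "\<exists>a b f. norm a = 1 \<and> norm b \<le> \<rho> \<and> norm b \<le> 1 / 3 \<and>
      continuous_on (sphere 0 1) f \<and> (\<forall>x\<in>sphere 0 1. \<bar>f x\<bar> \<le> \<rho>) \<and>
      fourier_coeff f 0 = 0 \<and> fourier_coeff f 1 = 0 \<and>
      (\<forall>x\<in>sphere 0 1. moebius_map b (a * x) * cis (f0 (moebius_map b (a * x))) = x * cis (f x))"
    if f0: "continuous_on (sphere 0 1) f0" "\<And>x. x \<in> sphere 0 1 \<Longrightarrow> \<bar>f0 x\<bar> \<le> r / 2" for f0 :: "complex \<Rightarrow> real"
  proof -
    define F where "F = (\<lambda>b x. moebius_angle b x + f0 (moebius_map b x))"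
    have joint: "continuous_on (cball 0 r \<times> sphere 0 1) (\<lambda>(b, x). F b x)"
    proof -
      have sub: "cball 0 r \<times> sphere 0 1 \<subseteq> {(b::complex, x::complex). norm b < 1 \<and> norm x = 1}"
        using r by auto
      have "continuous_on (cball 0 r \<times> sphere 0 1) (\<lambda>z. f0 ((\<lambda>(b, x). moebius_map b x) z))"
        using continuous_on_subset[OF continuous_on_moebius_map sub] r
        by (intro continuous_on_compose2[OF f0(1)]) (auto simp: norm_moebius_map)
      then show ?thesis
        using continuous_on_subset[OF continuous_on_moebius_angle sub]
        by (auto simp: F_def case_prod_unfold intro!: continuous_intros)
    qed
    have Fx: "continuous_on (sphere 0 1) (F b)" if "b \<in> cball 0 r" for b
    proof -
      have "continuous_on (sphere 0 1) (\<lambda>x. (\<lambda>(b, x). F b x) (b, x))"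
        using that by (intro continuous_on_compose2[OF joint] continuous_on_Pair continuous_on_const continuous_on_id) auto
      then show ?thesis by simp
    qed
    have Fb: "continuous_on (cball 0 r) (\<lambda>b. F b x)" if "x \<in> sphere 0 1" for x
    proof -
      have "continuous_on (cball 0 r) (\<lambda>b. (\<lambda>(b, x). F b x) (b, x))"
        using that by (intro continuous_on_compose2[OF joint] continuous_on_Pair continuous_on_const continuous_on_id) auto
      then show ?thesis by simp
    qed
    have bound: "\<bar>F b x - 2 * Im (b * cnj x)\<bar> \<le> r" "\<bar>F b x\<bar> \<le> 4 * r"
      if b: "b \<in> cball 0 r" and x: "x \<in> sphere 0 1" for b x
    proof -
      have nb: "norm b \<le> r" "norm b \<le> 1 / 2" "norm b < 1" using b r by auto
      have "4 * (norm b)\<^sup>2 \<le> 4 * r\<^sup>2" using nb by (simp add: power_mono)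
      then have "\<bar>moebius_angle b x - 2 * Im (b * cnj x)\<bar> \<le> r / 2"
        using moebius_angle_approx[OF nb(2), of x] x r2 by simp
      moreover have "\<bar>f0 (moebius_map b x)\<bar> \<le> r / 2"
        using nb x by (intro f0(2)) (simp add: norm_moebius_map)
      ultimately show 1: "\<bar>F b x - 2 * Im (b * cnj x)\<bar> \<le> r"
        unfolding F_def by arith
      have "\<bar>Im (b * cnj x)\<bar> \<le> r"
        using abs_Im_le_cmod[of "b * cnj x"] nb x by (simp add: norm_mult)
      then show "\<bar>F b x\<bar> \<le> 4 * r" using 1 r by linarith
    qed
    have int: "integrable arclength (\<lambda>x. of_real (F b x) * x)" "integrable arclength (F b)" if "b \<in> cball 0 r" for b
      using Fx[OF that] by (auto intro!: continuous_integrable_arclength continuous_intros)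
    \<comment> \<open>A fixed point of \<open>T\<close> is a \<open>b\<close> for which the first Fourier coefficient vanishes.\<close>
    define T where "T = (\<lambda>b. b - \<i> / of_real (2 * pi) * (\<integral>x. of_real (F b x) * x \<partial>arclength))"
    have contT: "continuous_on (cball 0 r) T"
    proof -
      have "continuous_on (cball 0 r) (\<lambda>b. \<integral>x. of_real (F b x) * x \<partial>arclength)"
        unfolding continuous_on_sequentially comp_def
      proof (intro allI ballI impI, elim conjE)
        fix B :: "nat \<Rightarrow> complex" and b :: complex
        assume b: "b \<in> cball 0 r" and B: "\<forall>n. B n \<in> cball 0 r" "B \<longlonglongrightarrow> b"
        show "(\<lambda>n. \<integral>x. of_real (F (B n) x) * x \<partial>arclength) \<longlonglongrightarrow> (\<integral>x. of_real (F b x) * x \<partial>arclength)"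
        proof (rule integral_dominated_convergence[where w = "\<lambda>_. 4 * r"])
          show "AE x in arclength. (\<lambda>n. of_real (F (B n) x) * x) \<longlonglongrightarrow> of_real (F b x) * x"
          proof (rule AE_I2)
            fix x :: complex assume "x \<in> space arclength"
            then have x: "x \<in> sphere 0 1" by simp
            have "(\<lambda>n. F (B n) x) \<longlonglongrightarrow> F b x"
              using Fb[OF x] b B unfolding continuous_on_sequentially comp_def by blast
            then show "(\<lambda>n. of_real (F (B n) x) * x) \<longlonglongrightarrow> of_real (F b x) * x"
              by (intro tendsto_intros)
          qed
          show "AE x in arclength. norm (of_real (F (B n) x) * x) \<le> 4 * r" for n
            using bound(2) B(1) by (intro AE_I2) (auto simp: norm_mult)
        qed (use int b B in \<open>auto dest: borel_measurable_integrable\<close>)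
      qed
      then show ?thesis unfolding T_def by (intro continuous_intros)
    qed
    have linear_part: "(\<integral>x. of_real (2 * Im (b * cnj x)) * x \<partial>arclength) = - \<i> * of_real (2 * pi) * b" for b
    proof -
      have "(\<integral>x. of_real (2 * Im (b * cnj x)) * x \<partial>arclength) = (\<integral>x. \<i> * cnj b * x ^ 2 - \<i> * b \<partial>arclength)"
      proof (intro Bochner_Integration.integral_cong refl)
        fix x :: complex assume "x \<in> space arclength"
        then have xx: "x * cnj x = 1" by (simp add: complex_norm_square[symmetric])
        have "of_real (2 * Im w) = - \<i> * (w - cnj w)" for w
          by (simp add: complex_eq_iff)
        then have "of_real (2 * Im (b * cnj x)) * x = - \<i> * (b * cnj x - cnj (b * cnj x)) * x"
          by metis
        also have "\<dots> = \<i> * cnj b * x ^ 2 - \<i> * b * (x * cnj x)"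
          by (simp add: power2_eq_square algebra_simps)
        finally show "of_real (2 * Im (b * cnj x)) * x = \<i> * cnj b * x ^ 2 - \<i> * b"
          by (simp add: xx)
      qed
      also have "\<dots> = \<i> * cnj b * (\<integral>x. x ^ 2 \<partial>arclength) - (\<integral>x. \<i> * b \<partial>arclength)"
        by (subst Bochner_Integration.integral_diff)
           (auto intro!: continuous_integrable_arclength continuous_intros)
      finally show ?thesis by (simp add: integral_circle_power scaleR_conv_of_real)
    qed
    have mapT: "T \<in> cball 0 r \<rightarrow> cball 0 r"
    proof
      fix b :: complex assume b: "b \<in> cball 0 r"
      let ?R = "\<integral>x. of_real (F b x - 2 * Im (b * cnj x)) * x \<partial>arclength"
      have "?R = (\<integral>x. of_real (F b x) * x - of_real (2 * Im (b * cnj x)) * x \<partial>arclength)"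
        by (simp only: of_real_diff left_diff_distrib)
      also have "\<dots> = (\<integral>x. of_real (F b x) * x \<partial>arclength) - (\<integral>x. of_real (2 * Im (b * cnj x)) * x \<partial>arclength)"
        by (intro Bochner_Integration.integral_diff int[OF b])
           (intro continuous_integrable_arclength continuous_intros)
      finally have "T b = - \<i> / of_real (2 * pi) * ?R"
        unfolding linear_part by (simp add: T_def field_simps)
      then have "norm (T b) = norm ?R / (2 * pi)"
        by (simp add: norm_mult norm_divide)
      moreover have "norm ?R \<le> (\<integral>x. r \<partial>arclength)"
      proof (intro Bochner_Integration.integral_norm_bound_integral arclength.integrable_const)
        show "integrable arclength (\<lambda>x. of_real (F b x - 2 * Im (b * cnj x)) * x)"
          using Fx[OF b] by (intro continuous_integrable_arclength continuous_intros)
        fix x :: complex assume "x \<in> space arclength"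
        then show "norm (of_real (F b x - 2 * Im (b * cnj x)) * x) \<le> r"
          using bound(1)[OF b, of x] by (simp only: norm_mult norm_of_real) simp
      qed
      moreover have "(\<integral>x. r \<partial>arclength) = r * (2 * pi)" by simp
      moreover have "0 < 2 * pi" by simp
      ultimately have "norm (T b) \<le> r" by (simp only: pos_divide_le_eq)
      then show "T b \<in> cball 0 r" by simp
    qed
    obtain b where b: "b \<in> cball 0 r" "T b = b"
      using brouwer[OF compact_cball convex_cball _ contT mapT] r by auto
    have Fb0: "(\<integral>x. of_real (F b x) * x \<partial>arclength) = 0" using b(2) by (simp add: T_def)
    define l where "l = - (\<integral>x. F b x \<partial>arclength) / (2 * pi)"
    define a where "a = cis l"
    have a: "norm a = 1" by (simp add: a_def)
    define f where "f = (\<lambda>x. l + F b (a * x))"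
    have nb: "norm b < 1" using b r by simp
    have aFc: "continuous_on (sphere 0 1) (\<lambda>x. F b (a * x))"
      by (rule continuous_on_circle_rotate[OF Fx[OF b(1)] a])
    have mean: "(\<integral>x. F b (a * x) \<partial>arclength) = (\<integral>x. F b x \<partial>arclength)"
      by (rule integral_arclength_rotate[OF continuous_borel_measurable_arclength[OF Fx[OF b(1)]] a])
    have l: "\<bar>l\<bar> \<le> 4 * r"
    proof -
      have "norm (\<integral>x. F b x \<partial>arclength) \<le> (\<integral>x. 4 * r \<partial>arclength)"
        using bound(2)[OF b(1)] int(2)[OF b(1)] by (intro Bochner_Integration.integral_norm_bound_integral) auto
      then show ?thesis by (simp add: l_def field_simps)
    qed
    show ?thesis
    proof (intro exI conjI ballI)
      show "norm a = 1" by (rule a)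
      show "norm b \<le> \<rho>" "norm b \<le> 1 / 3" using b r by auto
      show "continuous_on (sphere 0 1) f" unfolding f_def by (intro continuous_intros aFc)
      show "\<bar>f x\<bar> \<le> \<rho>" if "x \<in> sphere 0 1" for x
      proof -
        have "\<bar>F b (a * x)\<bar> \<le> 4 * r" using a that by (intro bound(2) b) (simp add: norm_mult)
        then show ?thesis using l r by (simp add: f_def)
      qed
      have "(\<integral>x. f x \<partial>arclength) = 2 * pi * l + (\<integral>x. F b (a * x) \<partial>arclength)"
        unfolding f_def using continuous_integrable_arclength[OF aFc] by simp
      also have "\<dots> = 0" by (simp add: mean l_def)
      finally show "fourier_coeff f 0 = 0" by (simp add: fourier_coeff_def)
      have "(\<integral>x. of_real (F b (a * x)) * x \<partial>arclength) = (\<integral>x. cnj a * (of_real (F b (a * x)) * (a * x)) \<partial>arclength)"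
      proof (intro Bochner_Integration.integral_cong refl)
        fix x
        have "cnj a * a = 1" using a by (simp add: complex_norm_square[symmetric] mult.commute)
        moreover have "cnj a * (of_real (F b (a * x)) * (a * x)) = (cnj a * a) * (of_real (F b (a * x)) * x)"
          by (simp only: mult_ac)
        ultimately show "of_real (F b (a * x)) * x = cnj a * (of_real (F b (a * x)) * (a * x))" by simp
      qed
      also have "\<dots> = cnj a * (\<integral>x. of_real (F b x) * x \<partial>arclength)"
        using integral_arclength_rotate[OF borel_measurable_integrable[OF int(1)[OF b(1)]] a] by simp
      finally have zero: "(\<integral>x. of_real (F b (a * x)) * x \<partial>arclength) = 0" by (simp add: Fb0)
      have "fourier_coeff f 1 = (\<integral>x. of_real l * x + of_real (F b (a * x)) * x \<partial>arclength)"
        by (simp add: fourier_coeff_def f_def distrib_right)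
      also have "\<dots> = of_real l * (\<integral>x. x ^ 1 \<partial>arclength) + (\<integral>x. of_real (F b (a * x)) * x \<partial>arclength)"
        using aFc by (subst Bochner_Integration.integral_add)
          (auto intro!: continuous_integrable_arclength continuous_intros)
      finally show "fourier_coeff f 1 = 0" by (simp only: zero) (simp add: integral_circle_power[of 1, simplified])
      fix x :: complex assume x: "x \<in> sphere 0 1"
      have ax: "norm (a * x) = 1" using a x by (simp add: norm_mult)
      show "moebius_map b (a * x) * cis (f0 (moebius_map b (a * x))) = x * cis (f x)"
        by (subst moebius_map_eq_cis[OF nb ax])
           (simp add: f_def F_def a_def flip: cis_mult)
    qed
  qed
  then show ?thesis using r by (intro exI[of _ "r / 2"]) auto
qed

section \<open>Stability of the identity\<close>

lemma sobolev_seminorm_square: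
  assumes "0 < p"
  shows "(sobolev_seminorm ((3 - p) / 2) 2 f)\<^sup>2 =
    (\<integral>\<^sup>+ (x, y). ennreal ((dist (f x) (f y))\<^sup>2 / dist x y powr (4 - p)) \<partial>(arclength \<Otimes>\<^sub>M arclength))"
proof -
  define X where "X = (\<integral>\<^sup>+ (x, y). ennreal ((dist (f x) (f y))\<^sup>2 / dist x y powr (4 - p)) \<partial>(arclength \<Otimes>\<^sub>M arclength))"
  have "dist a b powr 2 = (dist a b)\<^sup>2" for a b :: complex
    by (cases "dist a b = 0") simp_all
  moreover have "1 + (3 - p) / 2 * 2 = 4 - p" by simp
  ultimately have "sobolev_seminorm ((3 - p) / 2) 2 f = ennreal_powr X (1 / 2)"
    by (simp only: sobolev_seminorm_def X_def)
  moreover have "(ennreal_powr X (1 / 2))\<^sup>2 = X"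
  proof (cases "X = \<infinity>")
    case False
    then obtain r where r: "X = ennreal r" "r \<ge> 0" by (cases X) auto
    have "(ennreal_powr X (1 / 2))\<^sup>2 = ennreal ((r powr (1 / 2))\<^sup>2)"
      using False r by (simp add: ennreal_powr_def ennreal_power)
    also have "\<dots> = X" using r by (simp add: powr_half_sqrt)
    finally show ?thesis .
  qed (simp add: ennreal_powr_def power2_eq_square)
  ultimately show ?thesis by (simp add: X_def)
qed

lemma sobolev_seminorm_cong:
  assumes "\<And>x. x \<in> sphere 0 1 \<Longrightarrow> f x = g x"
  shows "sobolev_seminorm s q f = sobolev_seminorm s q g"
  unfolding sobolev_seminorm_def
  by (intro arg_cong2[where f = ennreal_powr] nn_integral_cong refl)
     (auto simp: space_pair_measure assms)

lemma energy_cong: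
  assumes "\<And>x. x \<in> sphere 0 1 \<Longrightarrow> u x = v x"
  shows "energy s u = energy s v"
  unfolding energy_def
  by (intro nn_integral_cong) (auto simp: space_pair_measure assms)

text \<open>
  For \<open>p \<ge> q\<close> the kernel \<open>S powr (p - 2)\<close> exceeds \<open>S powr (q - 2)\<close> only where \<open>S > 1\<close>, and there it is at
  most \<open>2\<close>. This makes the constants uniform in \<open>p \<ge> q\<close>.
\<close>

lemma chord_mass_le:
  fixes p q :: real
  assumes "1 < q" "q \<le> p" "p \<le> 3"
  shows "(\<integral>\<omega>. norm (\<omega> - 1) powr (p - 2) \<partial>arclength) \<le> (\<integral>\<omega>. norm (\<omega> - 1) powr (q - 2) \<partial>arclength) + 4 * pi"
proof -
  have "(\<integral>\<omega>. norm (\<omega> - 1) powr (p - 2) \<partial>arclength) \<le> (\<integral>\<omega>. norm (\<omega> - 1) powr (q - 2) + 2 \<partial>arclength)"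
  proof (intro integral_mono Bochner_Integration.integrable_add integrable_chord_powr arclength.integrable_const)
    fix \<omega> :: complex assume "\<omega> \<in> space arclength"
    then have s2: "norm (\<omega> - 1) \<le> 2" using norm_triangle_ineq4[of \<omega> 1] by simp
    show "norm (\<omega> - 1) powr (p - 2) \<le> norm (\<omega> - 1) powr (q - 2) + 2"
    proof (cases "norm (\<omega> - 1) \<le> 1")
      case True
      then have "norm (\<omega> - 1) powr (p - 2) \<le> norm (\<omega> - 1) powr (q - 2)"
        using assms by (intro powr_mono') auto
      then show ?thesis by simp
    next
      case False
      then have "norm (\<omega> - 1) powr (p - 2) \<le> norm (\<omega> - 1) powr 1"
        using assms by (intro powr_mono) auto
      then have "norm (\<omega> - 1) powr (p - 2) \<le> 2" using s2 False by simp
      then show ?thesis by (simp add: add_increasing)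
    qed
  qed (use assms in auto)
  also have "\<dots> = (\<integral>\<omega>. norm (\<omega> - 1) powr (q - 2) \<partial>arclength) + 4 * pi"
    using integrable_chord_powr[of "q - 2"] assms by simp
  finally show ?thesis .
qed

text \<open>
  The double integral of \<open>(f x - f y)\<^sup>2\<close> equals \<open>4 * pi\<close> times \<open>\<integral> f\<^sup>2\<close> for \<open>f\<close> of mean zero, and the kernel
  is at least \<open>1 / 8\<close>.
\<close>

lemma poincare_circle:
  fixes f :: "complex \<Rightarrow> real"
  assumes p: "1 < p" "p < 3" and f: "continuous_on (sphere 0 1) f" and mean: "fourier_coeff f 0 = 0"
  shows "ennreal (pi / 2 * (\<integral>x. (f x)\<^sup>2 \<partial>arclength)) \<le>
    fractional_energy p f"
proof -
  have if2: "integrable arclength f" "integrable arclength (\<lambda>x. (f x)\<^sup>2)"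
    using f by (auto intro!: continuous_integrable_arclength continuous_intros)
  have [measurable]: "f \<in> borel_measurable arclength"
    by (rule continuous_borel_measurable_arclength[OF f])
  have mean': "(\<integral>x. f x \<partial>arclength) = 0"
    using mean by (simp add: fourier_coeff_def)
  let ?I = "\<integral>x. (f x)\<^sup>2 \<partial>arclength"
  have I0: "0 \<le> ?I" by (intro integral_nonneg_AE) simp
  have inner: "(\<integral>\<^sup>+ y. ennreal ((f x - f y)\<^sup>2) \<partial>arclength) = ennreal (2 * pi * (f x)\<^sup>2 + ?I)" for x
  proof -
    have eq: "(f x - f y)\<^sup>2 = (f x)\<^sup>2 - 2 * f x * f y + (f y)\<^sup>2" for y
      by (simp add: power2_eq_square algebra_simps)
    have i: "integrable arclength (\<lambda>y. (f x - f y)\<^sup>2)"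
      using f by (auto intro!: continuous_integrable_arclength continuous_intros)
    have "(\<integral>y. (f x - f y)\<^sup>2 \<partial>arclength) = (\<integral>y. (f x)\<^sup>2 \<partial>arclength) - 2 * f x * (\<integral>y. f y \<partial>arclength) + ?I"
      unfolding eq
      by (simp only: Bochner_Integration.integral_add Bochner_Integration.integral_diff Bochner_Integration.integrable_diff
         integrable_mult_right Bochner_Integration.integral_mult_right if2 arclength.integrable_const)
    also have "\<dots> = 2 * pi * (f x)\<^sup>2 + ?I" by (simp add: mean')
    finally show ?thesis using i by (simp add: nn_integral_eq_integral)
  qed
  have "ennreal (4 * pi * ?I) = (\<integral>\<^sup>+ x. ennreal (2 * pi * (f x)\<^sup>2 + ?I) \<partial>arclength)"
    using if2 I0 by (subst nn_integral_eq_integral) (auto simp: algebra_simps)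
  also have "\<dots> = (\<integral>\<^sup>+ x. \<integral>\<^sup>+ y. ennreal ((f x - f y)\<^sup>2) \<partial>arclength \<partial>arclength)"
    by (simp only: inner)
  also have "\<dots> = (\<integral>\<^sup>+ (x, y). ennreal ((f x - f y)\<^sup>2) \<partial>(arclength \<Otimes>\<^sub>M arclength))"
    using arclength.nn_integral_fst[of "\<lambda>(x, y). ennreal ((f x - f y)\<^sup>2)" arclength] by simp
  also have "\<dots> \<le> (\<integral>\<^sup>+ (x, y). ennreal 8 * ennreal (dist x y powr (p - 4) * (f x - f y)\<^sup>2) \<partial>(arclength \<Otimes>\<^sub>M arclength))"
  proof (rule nn_integral_mono)
    fix z :: "complex \<times> complex" assume z: "z \<in> space (arclength \<Otimes>\<^sub>M arclength)"
    obtain x y where xy: "z = (x, y)" by (cases z)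
    have d: "dist x y \<le> 2"
      using z norm_triangle_ineq4[of x y] by (simp add: xy space_pair_measure dist_norm)
    have "(f x - f y)\<^sup>2 \<le> 8 * (dist x y powr (p - 4) * (f x - f y)\<^sup>2)"
    proof (cases "x = y")
      case False
      have "1 / 8 = 2 powr (-3 :: real)" by (simp add: powr_minus)
      also have "\<dots> \<le> 2 powr (p - 4)" using p by (intro powr_mono) auto
      also have "\<dots> \<le> dist x y powr (p - 4)" using p d False by (intro powr_mono2') auto
      finally have "1 / 8 * (f x - f y)\<^sup>2 \<le> dist x y powr (p - 4) * (f x - f y)\<^sup>2"
        by (intro mult_right_mono) auto
      then show ?thesis by simp
    qed simp
    then have "ennreal ((f x - f y)\<^sup>2) \<le> ennreal (8 * (dist x y powr (p - 4) * (f x - f y)\<^sup>2))"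
      by (rule ennreal_leI)
    also have "\<dots> = ennreal 8 * ennreal (dist x y powr (p - 4) * (f x - f y)\<^sup>2)"
      by (rule ennreal_mult') simp
    finally show "(case z of (x, y) \<Rightarrow> ennreal ((f x - f y)\<^sup>2)) \<le>
       (case z of (x, y) \<Rightarrow> ennreal 8 * ennreal (dist x y powr (p - 4) * (f x - f y)\<^sup>2))"
      by (simp add: xy)
  qed
  also have "\<dots> = ennreal 8 * fractional_energy p f"
    (is "_ = ennreal 8 * ?R")
    unfolding fractional_energy_def case_prod_unfold by (rule nn_integral_cmult) measurable
  finally have le: "ennreal (4 * pi * ?I) \<le> ennreal 8 * ?R" .
  have "ennreal (4 * pi * ?I) = ennreal (8 * (pi / 2 * ?I))" by simp
  also have "\<dots> = ennreal 8 * ennreal (pi / 2 * ?I)" by (rule ennreal_mult') simp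
  finally have "ennreal 8 * ennreal (pi / 2 * ?I) = ennreal (4 * pi * ?I)" ..
  then have le': "ennreal 8 * ennreal (pi / 2 * ?I) \<le> ennreal 8 * ?R" using le by (simp only:)
  have nz: "ennreal 8 \<noteq> 0" "ennreal 8 \<noteq> top" by simp_all
  show ?thesis by (rule iffD1[OF ennreal_mult_le_mult_iff[OF nz] le'])
qed

text \<open>
  The increment of \<open>x * cis (f x) - x\<close> splits into \<open>(x - y) * (cis (f y) - 1)\<close> and a term of size
  \<open>\<bar>f x - f y\<bar>\<close>. The energy of the first one is controlled by the Poincare inequality.
\<close>

lemma distance_to_identity_le:
  fixes f :: "complex \<Rightarrow> real" and p q :: real
  assumes q: "1 < q" "q \<le> p" and p: "p < 3"
    and f: "continuous_on (sphere 0 1) f" and mean: "fourier_coeff f 0 = 0"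
  defines "C \<equiv> 2 + 4 / pi * ((\<integral>\<omega>. norm (\<omega> - 1) powr (q - 2) \<partial>arclength) + 4 * pi)"
  shows "(sobolev_seminorm ((3 - p) / 2) 2 (\<lambda>x. x * cis (f x) - x))\<^sup>2 \<le>
    ennreal C * fractional_energy p f"
proof -
  have p1: "1 < p" using q by simp
  let ?R = "fractional_energy p f"
  let ?I = "\<integral>x. (f x)\<^sup>2 \<partial>arclength"
  let ?K = "\<integral>\<omega>. norm (\<omega> - 1) powr (p - 2) \<partial>arclength"
  have [measurable]: "f \<in> borel_measurable arclength"
    by (rule continuous_borel_measurable_arclength[OF f])
  have I0: "0 \<le> ?I" and K0: "0 \<le> ?K" by (auto intro!: integral_nonneg_AE)
  have cis_le: "norm (cis t - 1) \<le> \<bar>t\<bar>" for t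
    using abs_sin_x_le_abs_x[of "t / 2"] by (simp add: norm_cis_minus_one abs_mult)
  define w where "w = (\<lambda>x. x * cis (f x) - x)"
  have "(sobolev_seminorm ((3 - p) / 2) 2 w)\<^sup>2 =
    (\<integral>\<^sup>+ (x, y). ennreal ((dist (w x) (w y))\<^sup>2 / dist x y powr (4 - p)) \<partial>(arclength \<Otimes>\<^sub>M arclength))"
    using p1 by (intro sobolev_seminorm_square) simp
  also have "\<dots> \<le> (\<integral>\<^sup>+ (x, y). ennreal (2 * (dist x y powr (p - 2) * (f y)\<^sup>2)) +
      ennreal (2 * (dist x y powr (p - 4) * (f x - f y)\<^sup>2)) \<partial>(arclength \<Otimes>\<^sub>M arclength))"
  proof (rule nn_integral_mono)
    fix z :: "complex \<times> complex" assume z: "z \<in> space (arclength \<Otimes>\<^sub>M arclength)"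
    obtain x y where xy: "z = (x, y)" by (cases z)
    have x: "norm x = 1" using z by (simp add: xy space_pair_measure)
    have "w x - w y = (x - y) * (cis (f y) - 1) + x * cis (f y) * (cis (f x - f y) - 1)"
      by (simp add: w_def cis_divide[symmetric] algebra_simps)
    then have "dist (w x) (w y) \<le> norm ((x - y) * (cis (f y) - 1)) + norm (x * cis (f y) * (cis (f x - f y) - 1))"
      by (simp only: dist_norm norm_triangle_ineq)
    also have "\<dots> \<le> dist x y * \<bar>f y\<bar> + \<bar>f x - f y\<bar>"
      using cis_le[of "f y"] cis_le[of "f x - f y"] x
      by (intro add_mono) (simp_all add: norm_mult dist_norm mult_left_mono)
    finally have "(dist (w x) (w y))\<^sup>2 \<le> (dist x y * \<bar>f y\<bar> + \<bar>f x - f y\<bar>)\<^sup>2"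
      by (intro power_mono) auto
    also have "\<dots> \<le> 2 * ((dist x y)\<^sup>2 * (f y)\<^sup>2) + 2 * (f x - f y)\<^sup>2"
    proof -
      have "(a + b)\<^sup>2 \<le> 2 * a\<^sup>2 + 2 * b\<^sup>2" for a b :: real
        using zero_le_power2[of "a - b"] by (simp add: power2_eq_square algebra_simps)
      from this[of "dist x y * \<bar>f y\<bar>" "\<bar>f x - f y\<bar>"] show ?thesis
        by (simp add: power_mult_distrib)
    qed
    finally have le: "(dist (w x) (w y))\<^sup>2 \<le> 2 * ((dist x y)\<^sup>2 * (f y)\<^sup>2) + 2 * (f x - f y)\<^sup>2" .
    have inv: "1 / dist x y powr (4 - p) = dist x y powr (p - 4)"
      using powr_minus[of "dist x y" "4 - p"] by (simp add: inverse_eq_divide)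
    have "(dist (w x) (w y))\<^sup>2 / dist x y powr (4 - p) = dist x y powr (p - 4) * (dist (w x) (w y))\<^sup>2"
      unfolding inv[symmetric] by simp
    also have "\<dots> \<le> dist x y powr (p - 4) * (2 * ((dist x y)\<^sup>2 * (f y)\<^sup>2) + 2 * (f x - f y)\<^sup>2)"
      by (intro mult_left_mono le) simp
    also have "\<dots> = 2 * ((dist x y powr (p - 4) * (dist x y)\<^sup>2) * (f y)\<^sup>2) + 2 * (dist x y powr (p - 4) * (f x - f y)\<^sup>2)"
      by (simp only: distrib_left mult_ac)
    also have "dist x y powr (p - 4) * (dist x y)\<^sup>2 = dist x y powr (p - 2)"
      using powr_minus_two_mult_square[of "dist x y" "p - 2"] by simp
    finally have "ennreal ((dist (w x) (w y))\<^sup>2 / dist x y powr (4 - p)) \<le>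
      ennreal (2 * (dist x y powr (p - 2) * (f y)\<^sup>2) + 2 * (dist x y powr (p - 4) * (f x - f y)\<^sup>2))"
      by (rule ennreal_leI)
    also have "\<dots> = ennreal (2 * (dist x y powr (p - 2) * (f y)\<^sup>2)) + ennreal (2 * (dist x y powr (p - 4) * (f x - f y)\<^sup>2))"
      by (rule ennreal_plus) auto
    finally show "(case z of (x, y) \<Rightarrow> ennreal ((dist (w x) (w y))\<^sup>2 / dist x y powr (4 - p))) \<le>
      (case z of (x, y) \<Rightarrow> ennreal (2 * (dist x y powr (p - 2) * (f y)\<^sup>2)) +
      ennreal (2 * (dist x y powr (p - 4) * (f x - f y)\<^sup>2)))"
      by (simp add: xy)
  qed
  also have "\<dots> = (\<integral>\<^sup>+ (x, y). ennreal (2 * (dist x y powr (p - 2) * (f y)\<^sup>2)) \<partial>(arclength \<Otimes>\<^sub>M arclength)) +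
      (\<integral>\<^sup>+ (x, y). ennreal (2 * (dist x y powr (p - 4) * (f x - f y)\<^sup>2)) \<partial>(arclength \<Otimes>\<^sub>M arclength))"
    unfolding case_prod_unfold by (rule nn_integral_add) measurable
  also have "(\<integral>\<^sup>+ (x, y). ennreal (2 * (dist x y powr (p - 4) * (f x - f y)\<^sup>2)) \<partial>(arclength \<Otimes>\<^sub>M arclength)) = ennreal 2 * ?R"
    unfolding fractional_energy_def case_prod_unfold ennreal_mult'[of 2, simplified] by (subst nn_integral_cmult[symmetric]) measurable
  also have "(\<integral>\<^sup>+ (x, y). ennreal (2 * (dist x y powr (p - 2) * (f y)\<^sup>2)) \<partial>(arclength \<Otimes>\<^sub>M arclength)) = ennreal (2 * ?K * ?I)"
  proof -
    have "(\<integral>\<^sup>+ (x, y). ennreal (2 * (dist x y powr (p - 2) * (f y)\<^sup>2)) \<partial>(arclength \<Otimes>\<^sub>M arclength)) =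
      (\<integral>\<^sup>+ \<omega>. \<integral>\<^sup>+ y. ennreal (2 * (dist (\<omega> * y) y powr (p - 2) * (f y)\<^sup>2)) \<partial>arclength \<partial>arclength)"
      by (rule nn_integral_circle_pair_rotate) measurable
    also have "\<dots> = (\<integral>\<^sup>+ \<omega>. ennreal (2 * ?I * norm (\<omega> - 1) powr (p - 2)) \<partial>arclength)"
    proof (rule nn_integral_cong)
      fix \<omega> :: complex
      have "(\<integral>\<^sup>+ y. ennreal (2 * (dist (\<omega> * y) y powr (p - 2) * (f y)\<^sup>2)) \<partial>arclength) =
        (\<integral>\<^sup>+ y. ennreal (2 * norm (\<omega> - 1) powr (p - 2) * (f y)\<^sup>2) \<partial>arclength)"
        by (intro nn_integral_cong) (simp add: dist_rotate)
      also have "\<dots> = ennreal (\<integral>y. 2 * norm (\<omega> - 1) powr (p - 2) * (f y)\<^sup>2 \<partial>arclength)"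
        using f by (intro nn_integral_eq_integral continuous_integrable_arclength continuous_intros) auto
      finally show "(\<integral>\<^sup>+ y. ennreal (2 * (dist (\<omega> * y) y powr (p - 2) * (f y)\<^sup>2)) \<partial>arclength) =
        ennreal (2 * ?I * norm (\<omega> - 1) powr (p - 2))"
        by (simp add: mult_ac)
    qed
    also have "\<dots> = ennreal (\<integral>\<omega>. 2 * ?I * norm (\<omega> - 1) powr (p - 2) \<partial>arclength)"
      using p1 I0 by (intro nn_integral_eq_integral integrable_mult_right integrable_chord_powr) auto
    finally show ?thesis by (simp add: mult_ac)
  qed
  also have "ennreal (2 * ?K * ?I) \<le> ennreal (4 / pi * ?K) * ?R"
  proof -
    have "ennreal (2 * ?K * ?I) = ennreal (4 / pi * ?K) * ennreal (pi / 2 * ?I)"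
      using I0 K0 by (simp add: ennreal_mult[symmetric])
    also have "\<dots> \<le> ennreal (4 / pi * ?K) * ?R"
      by (intro mult_left_mono poincare_circle p1 p f mean) simp
    finally show ?thesis .
  qed
  also have "ennreal (4 / pi * ?K) * ?R + ennreal 2 * ?R = ennreal (4 / pi * ?K + 2) * ?R"
    using K0 by (simp add: distrib_right ennreal_plus del: ennreal_numeral)
  also have "\<dots> \<le> ennreal C * ?R"
  proof (intro mult_right_mono ennreal_leI)
    have "4 / pi * ?K \<le> 4 / pi * ((\<integral>\<omega>. norm (\<omega> - 1) powr (q - 2) \<partial>arclength) + 4 * pi)"
      using chord_mass_le[OF q(1,2)] p by (intro mult_left_mono) auto
    then show "4 / pi * ?K + 2 \<le> C" unfolding C_def by linarith
  qed simp
  finally show ?thesis by (simp add: w_def add_mono)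
qed

text \<open>
  The theorem with the seminorm hypotheses in pointwise form and without subtractions. The composition
  with \<open>moebius_map b\<close>, \<open>norm b \<le> 1 / 3\<close>, at most doubles Lipschitz constants, which accounts for the factor
  \<open>2\<close> in the Lipschitz hypothesis of \<open>balanced_energy_gap\<close>.
\<close>

lemma energy_gap_near_identity:
  fixes s p q \<Lambda> \<alpha> t \<epsilon> :: real
  assumes q: "1 < q" "q \<le> p" and p: "p < 3" "p = 1 / s"
    and pos: "\<Lambda> > 0" "\<alpha> > 0" "t > 0" "\<epsilon> > 0"
  defines "C \<equiv> 2 + 4 / pi * ((\<integral>\<omega>. norm (\<omega> - 1) powr (q - 2) \<partial>arclength) + 4 * pi)"
  shows "\<exists>\<delta>>0. \<forall>u. continuous_on (sphere 0 1) u \<and> u ` sphere 0 1 \<subseteq> sphere 0 1 \<and>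
    (\<forall>x\<in>sphere 0 1. \<forall>y\<in>sphere 0 1. dist (u x) (u y) \<le> \<Lambda> * dist x y powr \<alpha>) \<and>
    (p < 2 \<longrightarrow> (\<forall>x\<in>sphere 0 1. \<forall>y\<in>sphere 0 1. dist (u x) (u y) \<le> \<Lambda> / (2 - p) * dist x y)) \<and>
    sobolev_seminorm t (1 / t) (\<lambda>z. u z - z) \<le> ennreal \<delta> \<longrightarrow>
    (\<exists>(l::real) b. norm b < 1 \<and> norm b \<le> \<epsilon> \<and>
      (let v = u \<circ> (\<lambda>z. exp (\<i> * of_real l) * moebius_map b z) in
        energy s id + ennreal ((q - 1) / 32 * exp (- 2 * \<Lambda>) / C) *
          (sobolev_seminorm ((3 - p) / 2) 2 (\<lambda>z. v z - z))\<^sup>2 \<le> energy s v))"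
proof -
  have p1: "1 < p" "1 / p = s" using q p by (auto simp: field_simps)
  have C: "C > 0"
  proof -
    have "0 \<le> (\<integral>\<omega>. norm (\<omega> - 1) powr (q - 2) \<partial>arclength)" by (intro integral_nonneg_AE) simp
    then show ?thesis by (simp add: C_def add_pos_nonneg)
  qed
  define c where "c = (q - 1) / 32 * exp (- 2 * \<Lambda>) / C"
  have c: "c > 0" using q C by (simp add: c_def)
  define \<kappa> where "\<kappa> = (p - 1) / 2 * exp (- 2 * \<Lambda>)"
  have cC: "c * C \<le> \<kappa> / 16" using q(2) C by (simp add: c_def \<kappa>_def)
  obtain \<rho>1 where \<rho>1: "\<rho>1 > 0" and gap: "\<And>f. continuous_on (sphere 0 1) f \<Longrightarrow> (\<forall>x\<in>sphere 0 1. \<bar>f x\<bar> \<le> \<rho>1) \<Longrightarrow>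
    fourier_coeff f 0 = 0 \<Longrightarrow> fourier_coeff f 1 = 0 \<Longrightarrow>
    (p < 2 \<longrightarrow> (\<forall>x\<in>sphere 0 1. \<forall>y\<in>sphere 0 1.
      dist (x * cis (f x)) (y * cis (f y)) \<le> 2 * \<Lambda> / (2 - p) * dist x y)) \<Longrightarrow>
    energy s id + ennreal (\<kappa> / 16) * fractional_energy p f \<le> energy s (\<lambda>x. x * cis (f x))"
    using balanced_energy_gap[OF p1(1) p(1) pos(1)] unfolding \<kappa>_def p1(2) by blast
  define \<rho> where "\<rho> = min \<rho>1 \<epsilon>"
  have \<rho>: "\<rho> > 0" "\<rho> \<le> \<rho>1" "\<rho> \<le> \<epsilon>" using \<rho>1 pos by (auto simp: \<rho>_def)
  obtain \<nu> where \<nu>: "\<nu> > 0" and balance: "\<And>f0. continuous_on (sphere 0 1) f0 \<Longrightarrow> (\<forall>x\<in>sphere 0 1. \<bar>f0 x\<bar> \<le> \<nu>) \<Longrightarrow>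
    (\<exists>a b f. norm a = 1 \<and> norm b \<le> \<rho> \<and> norm b \<le> 1 / 3 \<and>
      continuous_on (sphere 0 1) f \<and> (\<forall>x\<in>sphere 0 1. \<bar>f x\<bar> \<le> \<rho>) \<and>
      fourier_coeff f 0 = 0 \<and> fourier_coeff f 1 = 0 \<and>
      (\<forall>x\<in>sphere 0 1. moebius_map b (a * x) * cis (f0 (moebius_map b (a * x))) = x * cis (f x)))"
    using moebius_balancing[OF \<rho>(1)] by blast
  define \<mu> where "\<mu> = min (1 / 2) (\<nu> / 2)"
  have \<mu>: "\<mu> > 0" "\<mu> \<le> 1 / 2" "2 * \<mu> \<le> \<nu>" using \<nu> by (auto simp: \<mu>_def)
  obtain \<delta> where \<delta>: "\<delta> > 0" and close: "\<And>u. continuous_on (sphere 0 1) u \<Longrightarrow> (\<forall>x\<in>sphere 0 1. norm (u x) = 1) \<Longrightarrow>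
    (\<forall>x\<in>sphere 0 1. \<forall>y\<in>sphere 0 1. dist (u x) (u y) \<le> \<Lambda> * dist x y powr \<alpha>) \<Longrightarrow>
    sobolev_seminorm t (1 / t) (\<lambda>z. u z - z) \<le> ennreal \<delta> \<Longrightarrow> (\<forall>x\<in>sphere 0 1. norm (u x - x) \<le> \<mu>)"
    using sobolev_close_imp_uniformly_close[OF pos(1,2,3) \<mu>(1)] by blast
  show ?thesis
  proof (rule exI[of _ \<delta>], intro conjI \<delta> allI impI, elim conjE, goal_cases)
    case (1 u)
    note uc = 1(1) and uh = 1(3) and ulip = 1(4) and ud = 1(5)
    have un: "norm (u x) = 1" if "x \<in> sphere 0 1" for x using 1(2) that by force
    have "\<forall>x\<in>sphere 0 1. norm (u x - x) \<le> \<mu>"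
      using uc un uh ud by (intro close) auto
    then obtain f0 where f0: "continuous_on (sphere 0 1) f0" "\<And>x. x \<in> sphere 0 1 \<Longrightarrow> u x = x * cis (f0 x)"
      "\<And>x. x \<in> sphere 0 1 \<Longrightarrow> \<bar>f0 x\<bar> \<le> 2 * \<mu>"
      using circle_angle_function[OF uc un _ \<mu>(2)] by blast
    have "\<forall>x\<in>sphere 0 1. \<bar>f0 x\<bar> \<le> \<nu>" using f0(3) \<mu>(3) by force
    from balance[OF f0(1) this] obtain a b f where a: "norm a = 1" and b: "norm b \<le> \<rho>" "norm b \<le> 1 / 3"
      and f: "continuous_on (sphere 0 1) f" "\<And>x. x \<in> sphere 0 1 \<Longrightarrow> \<bar>f x\<bar> \<le> \<rho>"
        "fourier_coeff f 0 = 0" "fourier_coeff f 1 = 0"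
      and eq: "\<And>x. x \<in> sphere 0 1 \<Longrightarrow> moebius_map b (a * x) * cis (f0 (moebius_map b (a * x))) = x * cis (f x)"
      by blast
    define l where "l = Arg2pi a"
    \<comment> \<open>Moves the rotation \<open>a\<close> from the argument of the Moebius map to the outside.\<close>
    define b' where "b' = b * cnj a"
    define \<phi> where "\<phi> = (\<lambda>z. exp (\<i> * of_real l) * moebius_map b' z)"
    have al: "exp (\<i> * of_real l) = a"
      using cis_Arg2pi_unit[OF a] by (simp add: l_def cis_conv_exp)
    have b'n: "norm b' = norm b" using a by (simp add: b'_def norm_mult)
    have \<phi>: "\<phi> x = moebius_map b (a * x)" for x
    proof -
      have "a * cnj a = 1" using a by (simp add: complex_norm_square[symmetric])
      then have "a * (x + b') = a * x + b" "cnj b' = cnj b * a"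
        by (simp_all add: b'_def algebra_simps)
      then show ?thesis by (simp add: \<phi>_def al moebius_map_def mult.assoc)
    qed
    have ax: "norm (a * x) = 1" if "x \<in> sphere 0 1" for x using a that by (simp add: norm_mult)
    have mx: "moebius_map b (a * x) \<in> sphere 0 1" if "x \<in> sphere 0 1" for x
      using norm_moebius_map[of b "a * x"] ax[OF that] b by simp
    have v: "(u \<circ> \<phi>) x = x * cis (f x)" if "x \<in> sphere 0 1" for x
      using f0(2)[OF mx[OF that]] eq[OF that] by (simp add: \<phi>)
    let ?D = "fractional_energy p f"
    let ?N = "(sobolev_seminorm ((3 - p) / 2) 2 (\<lambda>z. (u \<circ> \<phi>) z - z))\<^sup>2"
    have "energy s id + ennreal (\<kappa> / 16) * ?D \<le> energy s (\<lambda>x. x * cis (f x))"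
    proof (rule gap[OF f(1) _ f(3,4)])
      show "\<forall>x\<in>sphere 0 1. \<bar>f x\<bar> \<le> \<rho>1" using f(2) \<rho>(2) by force
      show "p < 2 \<longrightarrow> (\<forall>x\<in>sphere 0 1. \<forall>y\<in>sphere 0 1.
        dist (x * cis (f x)) (y * cis (f y)) \<le> 2 * \<Lambda> / (2 - p) * dist x y)"
      proof (intro impI ballI)
        fix x y :: complex assume p2: "p < 2" and x: "x \<in> sphere 0 1" and y: "y \<in> sphere 0 1"
        have "dist (x * cis (f x)) (y * cis (f y)) = dist (u (moebius_map b (a * x))) (u (moebius_map b (a * y)))"
          using v[OF x] v[OF y] by (simp add: \<phi>)
        also have "\<dots> \<le> \<Lambda> / (2 - p) * dist (moebius_map b (a * x)) (moebius_map b (a * y))"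
          using ulip p2 mx[OF x] mx[OF y] by blast
        also have "\<dots> \<le> \<Lambda> / (2 - p) * (2 * dist (a * x) (a * y))"
          using pos p2 ax x y by (intro mult_left_mono dist_moebius_map_le b) auto
        also have "dist (a * x) (a * y) = dist x y"
          using a by (simp add: dist_norm norm_mult flip: right_diff_distrib)
        finally show "dist (x * cis (f x)) (y * cis (f y)) \<le> 2 * \<Lambda> / (2 - p) * dist x y"
          by (simp add: mult_ac)
      qed
    qed
    also have "energy s (\<lambda>x. x * cis (f x)) = energy s (u \<circ> \<phi>)"
      by (rule energy_cong) (rule v[symmetric])
    finally have E: "energy s id + ennreal (\<kappa> / 16) * ?D \<le> energy s (u \<circ> \<phi>)" .
    have "?N = (sobolev_seminorm ((3 - p) / 2) 2 (\<lambda>x. x * cis (f x) - x))\<^sup>2"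
      using v by (intro arg_cong[where f = "\<lambda>z. z\<^sup>2"] sobolev_seminorm_cong) simp
    also have "\<dots> \<le> ennreal C * ?D"
      unfolding C_def by (rule distance_to_identity_le[OF q p(1) f(1,3)])
    finally have "ennreal c * ?N \<le> ennreal c * (ennreal C * ?D)"
      by (rule mult_left_mono) simp
    also have "\<dots> = ennreal (c * C) * ?D"
      using c C by (simp add: ennreal_mult mult.assoc)
    also have "\<dots> \<le> ennreal (\<kappa> / 16) * ?D"
      by (intro mult_right_mono ennreal_leI cC) simp
    finally have "ennreal c * ?N \<le> ennreal (\<kappa> / 16) * ?D" .
    then have "energy s id + ennreal c * ?N \<le> energy s (u \<circ> \<phi>)"
      using E by (meson add_left_mono order_trans)
    then show ?case
      using b b'n \<rho>(3) by (intro exI[of _ l] exI[of _ b']) (simp add: Let_def \<phi>_def c_def)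
  qed
qed

theorem theorem8p1:
  fixes s_minus s_plus \<Lambda> \<alpha> :: real
  assumes "1 / 3 < s_minus" and "s_minus < s_plus" and "s_plus < 1"
    and "\<Lambda> > 0" and "\<alpha> > 0"
  shows "\<exists>c::real. c > 0 \<and>
    (\<forall>s p. s \<in> {s_minus..s_plus} \<and> p = 1 / s \<longrightarrow>
      (\<forall>\<epsilon>::real. \<forall>t. \<epsilon> > 0 \<and> t \<in> {0<..s} \<longrightarrow>
        (\<exists>\<delta>::real. \<delta> > 0 \<and>
          (\<forall>u :: complex \<Rightarrow> complex.
            u ` sphere 0 1 \<subseteq> sphere 0 1 \<and>
            u \<in> sobolev_space ((3 - p) / 2) 2 \<inter> sobolev_space s (1 / s) \<inter> hoelder_space \<alpha> \<and>
            sobolev_seminorm s (1 / s) u + hoelder_seminorm \<alpha> u \<le> ennreal \<Lambda> \<and>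
            (p < 2 \<longrightarrow> lip_seminorm u \<le> ennreal (\<Lambda> / \<bar>p - 2\<bar>)) \<and>
            sobolev_seminorm t (1 / t) (\<lambda>z. u z - z) \<le> ennreal \<delta>
            \<longrightarrow>
            (\<exists>\<phi> \<in> moebius_group. \<exists>(l::real) b.
              \<phi> = (\<lambda>z. exp (\<i> * of_real l) * moebius_map b z) \<and> norm b < 1 \<and> norm b \<le> \<epsilon> \<and>
              enn2ereal (energy s (u \<circ> \<phi>)) - enn2ereal (energy s id) \<ge>
                ereal c * enn2ereal (INF \<psi>\<in>moebius_group.
                  (sobolev_seminorm ((3 - p) / 2) 2 (\<lambda>z. (u \<circ> \<psi>) z - z))\<^sup>2))))))"
proof -
  define q where "q = 1 / s_plus"
  have q: "1 < q" using assms by (simp add: q_def)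
  define C where "C = 2 + 4 / pi * ((\<integral>\<omega>. norm (\<omega> - 1) powr (q - 2) \<partial>arclength) + 4 * pi)"
  define c where "c = (q - 1) / 32 * exp (- 2 * \<Lambda>) / C"
  have "0 \<le> (\<integral>\<omega>. norm (\<omega> - 1) powr (q - 2) \<partial>arclength)" by (intro integral_nonneg_AE) simp
  then have "C > 0" by (simp add: C_def add_pos_nonneg)
  then have c: "c > 0" using q by (simp add: c_def)
  show ?thesis
  proof (rule exI[of _ c], intro conjI c allI impI, goal_cases)
    case (1 s p \<epsilon> t)
    then have s: "0 < s" "s < 1" "1 / 3 < s" "s \<le> s_plus" using assms by auto
    have p: "p = 1 / s" using 1 by simp
    have p': "q \<le> p" "p < 3" using s by (auto simp: p q_def field_simps)
    obtain \<delta> where \<delta>: "\<delta> > 0" and gap: "\<And>u. continuous_on (sphere 0 1) u \<Longrightarrow> u ` sphere 0 1 \<subseteq> sphere 0 1 \<Longrightarrow>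
      (\<forall>x\<in>sphere 0 1. \<forall>y\<in>sphere 0 1. dist (u x) (u y) \<le> \<Lambda> * dist x y powr \<alpha>) \<Longrightarrow>
      (p < 2 \<longrightarrow> (\<forall>x\<in>sphere 0 1. \<forall>y\<in>sphere 0 1. dist (u x) (u y) \<le> \<Lambda> / (2 - p) * dist x y)) \<Longrightarrow>
      sobolev_seminorm t (1 / t) (\<lambda>z. u z - z) \<le> ennreal \<delta> \<Longrightarrow>
      (\<exists>(l::real) b. norm b < 1 \<and> norm b \<le> \<epsilon> \<and>
        (let v = u \<circ> (\<lambda>z. exp (\<i> * of_real l) * moebius_map b z) in
          energy s id + ennreal c * (sobolev_seminorm ((3 - p) / 2) 2 (\<lambda>z. v z - z))\<^sup>2 \<le> energy s v))"
      using energy_gap_near_identity[OF q p' p assms(4,5), of t \<epsilon>] 1 unfolding c_def C_def by auto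
    show ?case
    proof (rule exI[of _ \<delta>], intro conjI \<delta> allI impI, elim conjE, goal_cases)
      case (1 u)
      note uL = 1(3) and lip = 1(4)
      have uc: "continuous_on (sphere 0 1) u" using 1(2) by (simp add: hoelder_space_def)
      have uh: "dist (u x) (u y) \<le> \<Lambda> * dist x y powr \<alpha>" if xy: "x \<in> sphere 0 1" "y \<in> sphere 0 1" for x y
      proof (cases "x = y")
        case False
        have "ennreal (dist (u x) (u y) / dist x y powr \<alpha>) \<le> hoelder_seminorm \<alpha> u"
          unfolding hoelder_seminorm_def using xy False by (intro SUP_upper2[of "(x, y)"]) auto
        also have "\<dots> \<le> ennreal \<Lambda>"
          using uL by (rule order_trans[rotated]) simp
        finally show ?thesis using assms(4) False by (simp add: divide_le_eq)
      qed simp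
      have ulip: "dist (u x) (u y) \<le> \<Lambda> / (2 - p) * dist x y"
        if "p < 2" and xy: "x \<in> sphere 0 1" "y \<in> sphere 0 1" for x y
      proof (cases "x = y")
        case False
        have "ennreal (dist (u x) (u y) / dist x y) \<le> lip_seminorm u"
          unfolding lip_seminorm_def using xy False by (intro SUP_upper2[of "(x, y)"]) auto
        also have "\<dots> \<le> ennreal (\<Lambda> / (2 - p))"
          using lip that by (simp add: abs_of_neg)
        finally show ?thesis using assms(4) that False by (simp add: divide_le_eq)
      qed simp
      obtain l b where b: "norm b < 1" "norm b \<le> \<epsilon>" and
        E: "let v = u \<circ> (\<lambda>z. exp (\<i> * of_real l) * moebius_map b z) in
          energy s id + ennreal c * (sobolev_seminorm ((3 - p) / 2) 2 (\<lambda>z. v z - z))\<^sup>2 \<le> energy s v"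
        using gap[OF uc 1(1) _ _ 1(5)] uh ulip by blast
      define \<phi> where "\<phi> = (\<lambda>z. exp (\<i> * of_real l) * moebius_map b z)"
      have \<phi>M: "\<phi> \<in> moebius_group" using b unfolding \<phi>_def moebius_group_def by blast
      let ?N = "(sobolev_seminorm ((3 - p) / 2) 2 (\<lambda>z. (u \<circ> \<phi>) z - z))\<^sup>2"
      have E: "energy s id + ennreal c * ?N \<le> energy s (u \<circ> \<phi>)" using E by (simp add: Let_def \<phi>_def)
      have "(INF \<psi>\<in>moebius_group. (sobolev_seminorm ((3 - p) / 2) 2 (\<lambda>z. (u \<circ> \<psi>) z - z))\<^sup>2) \<le> ?N"
        (is "?inf \<le> _")
        by (rule INF_lower[OF \<phi>M])
      then have "energy s id + ennreal c * ?inf \<le> energy s (u \<circ> \<phi>)"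
        using E by (meson add_left_mono mult_left_mono order_trans zero_le)
      then have "enn2ereal (energy s id + ennreal c * ?inf) \<le> enn2ereal (energy s (u \<circ> \<phi>))"
        by (simp only: less_eq_ennreal.rep_eq)
      then have "enn2ereal (energy s id) + ereal c * enn2ereal ?inf \<le> enn2ereal (energy s (u \<circ> \<phi>))"
        using c by (simp add: plus_ennreal.rep_eq times_ennreal.rep_eq enn2ereal_ennreal)
      moreover have "\<bar>enn2ereal (energy s id)\<bar> \<noteq> \<infinity>"
        using energy_id_finite[OF s(1,2)] by (cases "energy s id") auto
      ultimately have "ereal c * enn2ereal ?inf \<le> enn2ereal (energy s (u \<circ> \<phi>)) - enn2ereal (energy s id)"
        by (simp add: ereal_le_minus add.commute)
      then show ?case
        using \<phi>M b by (intro bexI[of _ \<phi>] exI[of _ l] exI[of _ b]) (auto simp: \<phi>_def)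
    qed
  qed
qed

end
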